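(* Let $1<m<\infty$ be a real number, and let $(M^4,g)$ be a $4$-dimensional complete noncompact Riemannian manifold with a smooth function $f:M\to\mathbb{R}$ such that $(M^4,g,f)$ is a steady $m$-quasi-Einstein manifold, i.e. $$Ric+\mathrm{Hess} f-\frac1m\,df\otimes df=0 .$$ Assume that $(M,g)$ has positive Ricci curvature and that $f$ has at least one critical point. If, in addition, $(M,g)$ has zero radial Weyl curvature (that is, $W_{ijkl}\nabla_l f=0$) and satisfies $\mathrm{div}^4W=0$, then $(M^4,g)$ is locally conformally flat.
   Context: Indices refer to a local orthonormal frame, repeated indices are summed, and $\nabla$ is the Levi-Civita connection. $R_{ijkl}$ is the Riemann curvature tensor, with sign convention such that the Ricci tensor is $R_{ik}=g^{jl}R_{ijkl}$; $R$ is the scalar curvature. A complete Riemannian manifold $(M^n,g)$ is called $m$-quasi-Einstein if there are a smooth function $f$ on $M$ and a constant $\lambda$ with $Ric+\mathrm{Hess} f-\frac1m df\otimes df=\lambda g$; it is called steady if $\lambda=0$. The Weyl tensor $W$ is defined (here with $n=4$) by $$W_{ijkl}=R_{ijkl}-\frac{1}{n-2}\big(R_{ik}g_{jl}+R_{jl}g_{ik}-R_{il}g_{jk}-R_{jk}g_{il}\big)+\frac{R}{(n-1)(n-2)}\big(g_{jl}g_{ik}-g_{il}g_{jk}\big).$$ The fourth order divergence is $\mathrm{div}^4W=\nabla_k\nabla_j\nabla_i\nabla_lW_{ijkl}$. Zero radial Weyl curvature means $W(\cdot,\cdot,\cdot,\nabla f)=0$. *)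

theory Defs
  imports "HOL-Analysis.Analysis"
begin

section \<open>Smooth functions on open subsets of Euclidean space\<close>

definition partial :: "'n::finite \<Rightarrow> (real^'n \<Rightarrow> 'b::real_normed_vector) \<Rightarrow> real^'n \<Rightarrow> 'b" where
  "partial i f x = frechet_derivative f (at x) (axis i 1)"

text \<open>The next two notions are meant for open sets \<open>S\<close> only.\<close>

primrec C_k_on :: "nat \<Rightarrow> (real^'n::finite) set \<Rightarrow> (real^'n \<Rightarrow> 'b::real_normed_vector) \<Rightarrow> bool" where
  "C_k_on 0 S f \<longleftrightarrow> continuous_on S f"
| "C_k_on (Suc k) S f \<longleftrightarrow> (\<forall>x\<in>S. f differentiable (at x)) \<and> (\<forall>i. C_k_on k S (partial i f))"

definition smooth_on :: "(real^'n::finite) set \<Rightarrow> (real^'n \<Rightarrow> 'b::real_normed_vector) \<Rightarrow> bool" where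
  "smooth_on S f \<longleftrightarrow> (\<forall>k. C_k_on k S f)"


section \<open>Local Riemannian geometry in coordinates\<close>

text \<open>
  A metric on a coordinate domain is a matrix-valued function \<open>g\<close> with entries
  \<open>g x $ i $ j = g(\<partial>\<^sub>i, \<partial>\<^sub>j)\<close>.  A covariant tensor field of any rank \<open>r\<close> is given by its components in
  the coordinate frame, indexed by lists of length \<open>r\<close>; values at other lists are irrelevant.
  Traces over an orthonormal frame become contractions with the inverse metric.
\<close>

type_synonym 'n metric_field = "real^'n \<Rightarrow> real^'n^'n"
type_synonym 'n tensor_field = "'n list \<Rightarrow> real^'n \<Rightarrow> real"

definition ginv :: "('n::finite) metric_field \<Rightarrow> 'n \<Rightarrow> 'n \<Rightarrow> real^'n \<Rightarrow> real" where
  "ginv g i j x = matrix_inv (g x) $ i $ j"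

text \<open>\<open>christoffel g k i j\<close> is \<open>\<Gamma>\<^sup>k\<^sub>i\<^sub>j\<close>, so the Levi-Civita connection is
  \<open>\<nabla>\<^sub>i \<partial>\<^sub>j = \<Gamma>\<^sup>k\<^sub>i\<^sub>j \<partial>\<^sub>k\<close>.\<close>

definition christoffel :: "('n::finite) metric_field \<Rightarrow> 'n \<Rightarrow> 'n \<Rightarrow> 'n \<Rightarrow> real^'n \<Rightarrow> real" where
  "christoffel g k i j x =
     (\<Sum>l\<in>UNIV. ginv g k l x *
        (partial i (\<lambda>y. g y $ j $ l) x + partial j (\<lambda>y. g y $ i $ l) x
         - partial l (\<lambda>y. g y $ i $ j) x)) / 2"

text \<open>The index of differentiation comes first:
  \<open>cov_deriv g T [k, i\<^sub>1, \<dots>, i\<^sub>r]\<close> is \<open>\<nabla>\<^sub>k T\<close> evaluated on \<open>\<partial>\<^bsub>i\<^sub>1\<^esub>, \<dots>, \<partial>\<^bsub>i\<^sub>r\<^esub>\<close>.\<close>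

fun cov_deriv :: "('n::finite) metric_field \<Rightarrow> 'n tensor_field \<Rightarrow> 'n tensor_field" where
  "cov_deriv g T [] x = 0"
| "cov_deriv g T (k # js) x =
     partial k (T js) x
     - (\<Sum>p<length js. \<Sum>m\<in>UNIV. christoffel g m k (js ! p) x * T (js[p := m]) x)"

text \<open>The Christoffel symbols do define the Levi-Civita connection: it is torsion-free and metric.\<close>

lemma christoffel_commute:
  assumes "\<And>y. transpose (g y) = g y"
  shows "christoffel g k i j x = christoffel g k j i x"
proof -
  have "g y $ a $ b = g y $ b $ a" for y a b
    using assms[of y] by (metis transpose_def vec_lambda_beta)
  then show ?thesis
    unfolding christoffel_def by (simp add: add.commute)
qed

lemma cov_deriv_metric:
  assumes sym: "\<And>y. transpose (g y) = g y" and inv: "invertible (g x)"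
  shows "cov_deriv g (\<lambda>js y. g y $ (js ! 0) $ (js ! 1)) [k, i, j] x = 0"
proof -
  have s: "g y $ a $ b = g y $ b $ a" for y a b
    using sym[of y] by (metis transpose_def vec_lambda_beta)
  have mi: "(\<Sum>m\<in>UNIV. g x $ b $ m * ginv g m l x) = (if b = l then 1 else 0)" for b l
  proof -
    have "g x ** matrix_inv (g x) = mat 1"
      using inv unfolding invertible_def matrix_inv_def by (rule someI2_ex) blast
    then have "(g x ** matrix_inv (g x)) $ b $ l = (mat 1 :: real^'a^'a) $ b $ l" by simp
    then show ?thesis by (simp add: matrix_matrix_mult_def mat_def ginv_def)
  qed
  have low: "(\<Sum>m\<in>UNIV. christoffel g m k a x * g x $ b $ m) =
      (partial k (\<lambda>y. g y $ a $ b) x + partial a (\<lambda>y. g y $ k $ b) x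
       - partial b (\<lambda>y. g y $ k $ a) x) / 2" for a b
  proof -
    define h where "h l = (partial k (\<lambda>y. g y $ a $ l) x + partial a (\<lambda>y. g y $ k $ l) x
       - partial l (\<lambda>y. g y $ k $ a) x) / 2" for l
    have "(\<Sum>m\<in>UNIV. christoffel g m k a x * g x $ b $ m) =
        (\<Sum>m\<in>UNIV. \<Sum>l\<in>UNIV. g x $ b $ m * ginv g m l x * h l)"
      unfolding christoffel_def h_def
      by (simp add: sum_distrib_right sum_distrib_left sum_divide_distrib mult_ac)
    also have "\<dots> = (\<Sum>l\<in>UNIV. (\<Sum>m\<in>UNIV. g x $ b $ m * ginv g m l x) * h l)"
      by (subst sum.swap) (simp add: sum_distrib_right)
    also have "\<dots> = h b"
      by (simp add: mi if_distrib[of "\<lambda>t. t * _"] cong: if_cong)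
    finally show ?thesis by (simp add: h_def)
  qed
  have "(\<Sum>m\<in>UNIV. christoffel g m k i x * g x $ m $ j) =
      (\<Sum>m\<in>UNIV. christoffel g m k i x * g x $ j $ m)"
    using s by metis
  then have "cov_deriv g (\<lambda>js y. g y $ (js ! 0) $ (js ! 1)) [k, i, j] x =
      partial k (\<lambda>y. g y $ i $ j) x
      - (\<Sum>m\<in>UNIV. christoffel g m k i x * g x $ j $ m)
      - (\<Sum>m\<in>UNIV. christoffel g m k j x * g x $ i $ m)"
    by (simp add: numeral_2_eq_2)
  moreover have "partial k (\<lambda>y. g y $ i $ j) x = partial k (\<lambda>y. g y $ j $ i) x"
    using s by presburger
  ultimately show ?thesis unfolding low by (simp add: field_simps)
qed

text \<open>
  \<open>R\<^sub>i\<^sub>j\<^sub>k\<^sub>l = g(R(\<partial>\<^sub>i, \<partial>\<^sub>j)\<partial>\<^sub>l, \<partial>\<^sub>k)\<close> with \<open>R(X,Y) = [\<nabla>\<^sub>X, \<nabla>\<^sub>Y] - \<nabla>\<^bsub>[X,Y]\<^esub>\<close>.  With this sign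
  \<open>R\<^sub>i\<^sub>j\<^sub>k\<^sub>l = g\<^sub>i\<^sub>k g\<^sub>j\<^sub>l - g\<^sub>i\<^sub>l g\<^sub>j\<^sub>k\<close> on the unit sphere, and \<open>g\<^sup>j\<^sup>l R\<^sub>i\<^sub>j\<^sub>k\<^sub>l\<close> is the usual Ricci tensor.
\<close>

definition riemann :: "('n::finite) metric_field \<Rightarrow> 'n \<Rightarrow> 'n \<Rightarrow> 'n \<Rightarrow> 'n \<Rightarrow> real^'n \<Rightarrow> real" where
  "riemann g i j k l x =
     (\<Sum>m\<in>UNIV. g x $ k $ m *
        (partial i (christoffel g m j l) x - partial j (christoffel g m i l) x
         + (\<Sum>p\<in>UNIV. christoffel g m i p x * christoffel g p j l x
                      - christoffel g m j p x * christoffel g p i l x)))"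

definition ricci :: "('n::finite) metric_field \<Rightarrow> 'n \<Rightarrow> 'n \<Rightarrow> real^'n \<Rightarrow> real" where
  "ricci g i k x = (\<Sum>j\<in>UNIV. \<Sum>l\<in>UNIV. ginv g j l x * riemann g i j k l x)"

definition scalar_curvature :: "('n::finite) metric_field \<Rightarrow> real^'n \<Rightarrow> real" where
  "scalar_curvature g x = (\<Sum>i\<in>UNIV. \<Sum>k\<in>UNIV. ginv g i k x * ricci g i k x)"

definition weyl :: "('n::finite) metric_field \<Rightarrow> 'n \<Rightarrow> 'n \<Rightarrow> 'n \<Rightarrow> 'n \<Rightarrow> real^'n \<Rightarrow> real" where
  "weyl g i j k l x =
     (let n = real CARD('n); G = (\<lambda>a b. g x $ a $ b); Rc = (\<lambda>a b. ricci g a b x) in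
      riemann g i j k l x
      - 1 / (n - 2) * (Rc i k * G j l + Rc j l * G i k - Rc i l * G j k - Rc j k * G i l)
      + scalar_curvature g x / ((n - 1) * (n - 2)) * (G j l * G i k - G i l * G j k))"

definition weyl_tensor :: "('n::finite) metric_field \<Rightarrow> 'n tensor_field" where
  "weyl_tensor g js = weyl g (js ! 0) (js ! 1) (js ! 2) (js ! 3)"

text \<open>\<open>\<nabla>\<^sub>k \<nabla>\<^sub>j \<nabla>\<^sub>i \<nabla>\<^sub>l T\<^sub>i\<^sub>j\<^sub>k\<^sub>l\<close>, where \<open>\<nabla>\<^sub>l\<close> is applied first.\<close>

definition div4 :: "('n::finite) metric_field \<Rightarrow> 'n tensor_field \<Rightarrow> real^'n \<Rightarrow> real" where
  "div4 g T x =
     (\<Sum>i\<in>UNIV. \<Sum>j\<in>UNIV. \<Sum>k\<in>UNIV. \<Sum>l\<in>UNIV. \<Sum>a\<in>UNIV. \<Sum>b\<in>UNIV. \<Sum>c\<in>UNIV. \<Sum>d\<in>UNIV.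
        ginv g i a x * ginv g j b x * ginv g k c x * ginv g l d x *
        (cov_deriv g ^^ 4) T [k, j, i, l, a, b, c, d] x)"

text \<open>The rank 0 tensor field of a function; its first two covariant derivatives are \<open>df\<close> and
  \<open>Hess f\<close>.\<close>

definition scalar_field :: "(real^'n::finite \<Rightarrow> real) \<Rightarrow> 'n tensor_field" where
  "scalar_field f js = f"

definition hessian :: "('n::finite) metric_field \<Rightarrow> (real^'n \<Rightarrow> real) \<Rightarrow> 'n \<Rightarrow> 'n \<Rightarrow> real^'n \<Rightarrow> real" where
  "hessian g f i j = cov_deriv g (cov_deriv g (scalar_field f)) [i, j]"

definition gradient :: "('n::finite) metric_field \<Rightarrow> (real^'n \<Rightarrow> real) \<Rightarrow> 'n \<Rightarrow> real^'n \<Rightarrow> real" where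
  "gradient g f l x = (\<Sum>m\<in>UNIV. ginv g l m x * partial m f x)"


section \<open>Smooth manifolds\<close>

text \<open>A chart is a pair of its domain and its coordinate map; an atlas is a set of charts.\<close>

type_synonym ('a, 'n) chart = "'a set \<times> ('a \<Rightarrow> real^'n)"

definition chart_image :: "('a, 'n::finite) chart \<Rightarrow> (real^'n) set" where
  "chart_image c = snd c ` fst c"

definition chart_inv :: "('a, 'n::finite) chart \<Rightarrow> real^'n \<Rightarrow> 'a" where
  "chart_inv c = inv_into (fst c) (snd c)"

definition chart_of :: "'a topology \<Rightarrow> ('a, 'n::finite) chart \<Rightarrow> bool" where
  "chart_of M c \<longleftrightarrow>
     openin M (fst c) \<and> open (chart_image c) \<and>
     homeomorphic_map (subtopology M (fst c)) (top_of_set (chart_image c)) (snd c)"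

definition transition :: "('a, 'n::finite) chart \<Rightarrow> ('a, 'n) chart \<Rightarrow> real^'n \<Rightarrow> real^'n" where
  "transition c d = snd d \<circ> chart_inv c"

definition smooth_atlas :: "'a topology \<Rightarrow> ('a, 'n::finite) chart set \<Rightarrow> bool" where
  "smooth_atlas M A \<longleftrightarrow>
     (\<forall>c\<in>A. chart_of M c) \<and> (\<Union>c\<in>A. fst c) = topspace M \<and>
     (\<forall>c\<in>A. \<forall>d\<in>A. smooth_on (snd c ` (fst c \<inter> fst d)) (transition c d))"

definition smooth_manifold :: "'a topology \<Rightarrow> ('a, 'n::finite) chart set \<Rightarrow> bool" where
  "smooth_manifold M A \<longleftrightarrow>
     Hausdorff_space M \<and> second_countable M \<and> connected_space M \<and> smooth_atlas M A"

definition smooth_fun_on :: "('a, 'n::finite) chart set \<Rightarrow> 'a set \<Rightarrow> ('a \<Rightarrow> real) \<Rightarrow> bool" where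
  "smooth_fun_on A U f \<longleftrightarrow> (\<forall>c\<in>A. smooth_on (snd c ` (fst c \<inter> U)) (f \<circ> chart_inv c))"

definition critical_point :: "('a, 'n::finite) chart set \<Rightarrow> ('a \<Rightarrow> real) \<Rightarrow> 'a \<Rightarrow> bool" where
  "critical_point A f p \<longleftrightarrow>
     (\<forall>c\<in>A. p \<in> fst c \<longrightarrow> (\<forall>i. partial i (f \<circ> chart_inv c) (snd c p) = 0))"


section \<open>Riemannian manifolds\<close>

text \<open>A metric is given by its matrix in every chart of the atlas, subject to the transformation law
  of a covariant 2-tensor.\<close>

definition riemannian_metric ::
  "('a, 'n::finite) chart set \<Rightarrow> (('a, 'n) chart \<Rightarrow> 'n metric_field) \<Rightarrow> bool" where
  "riemannian_metric A g \<longleftrightarrow>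
     (\<forall>c\<in>A. smooth_on (chart_image c) (g c) \<and>
        (\<forall>x\<in>chart_image c. transpose (g c x) = g c x \<and> (\<forall>v. v \<noteq> 0 \<longrightarrow> v \<bullet> (g c x *v v) > 0))) \<and>
     (\<forall>c\<in>A. \<forall>d\<in>A. \<forall>x \<in> snd c ` (fst c \<inter> fst d).
        (let J = matrix (frechet_derivative (transition c d) (at x)) in
         g c x = transpose J ** g d (transition c d x) ** J))"

definition riemannian_manifold ::
  "'a topology \<Rightarrow> ('a, 'n::finite) chart set \<Rightarrow> (('a, 'n) chart \<Rightarrow> 'n metric_field) \<Rightarrow> bool" where
  "riemannian_manifold M A g \<longleftrightarrow> smooth_manifold M A \<and> riemannian_metric A g"

text \<open>\<open>C\<^sup>1\<close> on a closed interval, with one-sided derivatives at the end points.\<close>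

definition C1_curve_on :: "('a, 'n::finite) chart set \<Rightarrow> real \<Rightarrow> real \<Rightarrow> (real \<Rightarrow> 'a) \<Rightarrow> bool" where
  "C1_curve_on A a b \<gamma> \<longleftrightarrow>
     (\<forall>c\<in>A. \<exists>v. continuous_on ({a..b} \<inter> \<gamma> -` fst c) v \<and>
        (\<forall>t\<in>{a..b} \<inter> \<gamma> -` fst c. ((snd c \<circ> \<gamma>) has_vector_derivative v t) (at t within {a..b})))"

definition piecewise_C1_curve ::
  "'a topology \<Rightarrow> ('a, 'n::finite) chart set \<Rightarrow> (real \<Rightarrow> 'a) \<Rightarrow> bool" where
  "piecewise_C1_curve M A \<gamma> \<longleftrightarrow>
     continuous_map (top_of_set {0..1}) M \<gamma> \<and>
     (\<exists>S. finite S \<and> {0, 1} \<subseteq> S \<and>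
        (\<forall>a\<in>S. \<forall>b\<in>S. 0 \<le> a \<and> a < b \<and> b \<le> 1 \<and> {a<..<b} \<inter> S = {} \<longrightarrow> C1_curve_on A a b \<gamma>))"

text \<open>The speed does not depend on the chart chosen around \<open>\<gamma> t\<close>.  At the finitely many break points
  of a piecewise \<open>C\<^sup>1\<close> curve its value is arbitrary, which does not affect the length.\<close>

definition curve_speed ::
  "('a, 'n::finite) chart set \<Rightarrow> (('a, 'n) chart \<Rightarrow> 'n metric_field) \<Rightarrow> (real \<Rightarrow> 'a) \<Rightarrow> real \<Rightarrow> real" where
  "curve_speed A g \<gamma> t =
     (let c = (SOME c. c \<in> A \<and> \<gamma> t \<in> fst c); v = vector_derivative (snd c \<circ> \<gamma>) (at t) in
      sqrt (v \<bullet> (g c (snd c (\<gamma> t)) *v v)))"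

definition curve_length ::
  "('a, 'n::finite) chart set \<Rightarrow> (('a, 'n) chart \<Rightarrow> 'n metric_field) \<Rightarrow> (real \<Rightarrow> 'a) \<Rightarrow> real" where
  "curve_length A g \<gamma> = integral {0..1} (curve_speed A g \<gamma>)"

definition riemannian_dist ::
  "'a topology \<Rightarrow> ('a, 'n::finite) chart set \<Rightarrow> (('a, 'n) chart \<Rightarrow> 'n metric_field) \<Rightarrow> 'a \<Rightarrow> 'a \<Rightarrow> real" where
  "riemannian_dist M A g p q =
     Inf {curve_length A g \<gamma> | \<gamma>. piecewise_C1_curve M A \<gamma> \<and> \<gamma> 0 = p \<and> \<gamma> 1 = q}"

definition complete_riemannian_manifold ::
  "'a topology \<Rightarrow> ('a, 'n::finite) chart set \<Rightarrow> (('a, 'n) chart \<Rightarrow> 'n metric_field) \<Rightarrow> bool" where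
  "complete_riemannian_manifold M A g \<longleftrightarrow>
     riemannian_manifold M A g \<and> Metric_space.mcomplete (topspace M) (riemannian_dist M A g)"

definition positive_ricci ::
  "('a, 'n::finite) chart set \<Rightarrow> (('a, 'n) chart \<Rightarrow> 'n metric_field) \<Rightarrow> bool" where
  "positive_ricci A g \<longleftrightarrow>
     (\<forall>c\<in>A. \<forall>x\<in>chart_image c. \<forall>v :: real^'n. v \<noteq> 0 \<longrightarrow>
        (\<Sum>i\<in>UNIV. \<Sum>k\<in>UNIV. ricci (g c) i k x * v $ i * v $ k) > 0)"

definition quasi_einstein ::
  "'a topology \<Rightarrow> ('a, 'n::finite) chart set \<Rightarrow> (('a, 'n) chart \<Rightarrow> 'n metric_field) \<Rightarrow>
   ('a \<Rightarrow> real) \<Rightarrow> real \<Rightarrow> real \<Rightarrow> bool" where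
  "quasi_einstein M A g f m lam \<longleftrightarrow>
     complete_riemannian_manifold M A g \<and> smooth_fun_on A (topspace M) f \<and>
     (\<forall>c\<in>A. \<forall>x\<in>chart_image c. \<forall>i j. let F = f \<circ> chart_inv c in
        ricci (g c) i j x + hessian (g c) F i j x - 1 / m * partial i F x * partial j F x
        = lam * g c x $ i $ j)"

definition steady_quasi_einstein ::
  "'a topology \<Rightarrow> ('a, 'n::finite) chart set \<Rightarrow> (('a, 'n) chart \<Rightarrow> 'n metric_field) \<Rightarrow>
   ('a \<Rightarrow> real) \<Rightarrow> real \<Rightarrow> bool" where
  "steady_quasi_einstein M A g f m \<longleftrightarrow> quasi_einstein M A g f m 0"

definition zero_radial_weyl ::
  "('a, 'n::finite) chart set \<Rightarrow> (('a, 'n) chart \<Rightarrow> 'n metric_field) \<Rightarrow> ('a \<Rightarrow> real) \<Rightarrow> bool" where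
  "zero_radial_weyl A g f \<longleftrightarrow>
     (\<forall>c\<in>A. \<forall>x\<in>chart_image c. \<forall>i j k.
        (\<Sum>l\<in>UNIV. weyl (g c) i j k l x * gradient (g c) (f \<circ> chart_inv c) l x) = 0)"

definition div4_weyl_zero ::
  "('a, 'n::finite) chart set \<Rightarrow> (('a, 'n) chart \<Rightarrow> 'n metric_field) \<Rightarrow> bool" where
  "div4_weyl_zero A g \<longleftrightarrow>
     (\<forall>c\<in>A. \<forall>x\<in>chart_image c. div4 (g c) (weyl_tensor (g c)) x = 0)"

text \<open>Every point has a neighbourhood \<open>U\<close> with a smooth function \<open>u\<close> such that the conformal metric
  \<open>e\<^sup>2\<^sup>u g\<close> on \<open>U\<close> is flat, i.e. has vanishing Riemann curvature tensor.\<close>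

definition locally_conformally_flat ::
  "'a topology \<Rightarrow> ('a, 'n::finite) chart set \<Rightarrow> (('a, 'n) chart \<Rightarrow> 'n metric_field) \<Rightarrow> bool" where
  "locally_conformally_flat M A g \<longleftrightarrow>
     (\<forall>p\<in>topspace M. \<exists>U u. openin M U \<and> p \<in> U \<and> smooth_fun_on A U u \<and>
        (\<forall>c\<in>A. \<forall>x\<in>snd c ` (fst c \<inter> U). \<forall>i j k l.
           riemann (\<lambda>y. exp (2 * u (chart_inv c y)) *\<^sub>R g c y) i j k l x = 0))"

end

theory Submission
  imports Defs
begin

text \<open>
  Where \<open>\<nabla>f \<noteq> 0\<close>, the condition \<open>W(\<cdot>,\<cdot>,\<cdot>,\<nabla>f) = 0\<close> makes \<open>W\<close> a trace-free algebraic curvature tensor on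
  the three-dimensional space orthogonal to \<open>\<nabla>f\<close>, hence zero.  If \<open>\<nabla>f\<close> vanished on an open set, the
  quasi-Einstein equation would give \<open>Ric = 0\<close> there, so by continuity \<open>W = 0\<close> everywhere.  The second
  Bianchi identity then makes the Cotton tensor vanish, and \<open>W\<close> and the Cotton tensor are exactly the
  curvature of the standard tractor connection.  A flat linear connection has local parallel sections
  with prescribed initial values (by Picard iteration along rays).  If \<open>\<tau>\<close> and \<open>\<tau>\<^sub>a\<close> are the scales of a
  null parallel tractor and of \<open>n\<close> further ones orthogonal to it, then \<open>\<tau>\<^sup>-\<^sup>2 g\<close> has constant coefficients in
  the coordinates \<open>\<tau>\<^sub>a / \<tau>\<close>; these flat coordinates are transported to all other charts.
\<close>

section \<open>Partial derivatives and smooth functions\<close>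

text \<open>Local conformal flatness asks for an actual function u with e^{2u} g flat, so passing
  from W = 0 to it (Weyl-Schouten) is an existence theorem. The equation for u is nonlinear, but in
  terms of the scale \<open>\<tau>\<close> = e^{-u}, together with its differential and one further
  scalar, it closes up to a linear system of first order, the tractor connection. Integrating such a
  system along rays only controls the radial derivative, and the one-forms met during the iteration
  are not closed. Flatness expresses their curl through the error that the current iterate makes in
  the system, so this error shrinks geometrically and the limit solves all the equations. The
  tractor that supplies the scale is taken null because a parallel tractor of nonzero norm would
  rescale g to constant nonzero curvature instead of to a flat metric. Dimension four enters twice:
  the complement of the gradient has dimension three, where the Ricci trace determines a curvature
  tensor, and the factor n - 3 in the traced Bianchi identity is not zero.\<close>

lemma partial_eqI:
  assumes "(f has_derivative f') (at x)"
  shows "partial i f x = f' (axis i 1)"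
  using frechet_derivative_at[OF assms] by (simp add: partial_def)

lemma has_derivative_partial:
  fixes f :: "real^'n::finite \<Rightarrow> 'b::real_normed_vector"
  assumes "f differentiable (at x)"
  shows "(f has_derivative (\<lambda>h. \<Sum>i\<in>UNIV. h $ i *\<^sub>R partial i f x)) (at x)"
proof -
  let ?D = "frechet_derivative f (at x)"
  have D: "(f has_derivative ?D) (at x)"
    using assms frechet_derivative_works by blast
  then have lin: "linear ?D" by (rule has_derivative_linear)
  have "?D h = (\<Sum>i\<in>UNIV. h $ i *\<^sub>R partial i f x)" for h
  proof -
    have "?D h = ?D (\<Sum>i\<in>UNIV. h $ i *\<^sub>R axis i 1)"
      using basis_expansion[of h] by (simp add: scalar_mult_eq_scaleR)
    also have "\<dots> = (\<Sum>i\<in>UNIV. h $ i *\<^sub>R ?D (axis i 1))"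
      using lin by (simp add: linear_sum linear_cmul)
    finally show ?thesis by (simp add: partial_def)
  qed
  then have "?D = (\<lambda>h. \<Sum>i\<in>UNIV. h $ i *\<^sub>R partial i f x)" by (rule ext)
  then show ?thesis using D by metis
qed

lemma partial_of_sum_form:
  assumes "(f has_derivative (\<lambda>h. \<Sum>i\<in>UNIV. h $ i *\<^sub>R c i)) (at x)"
  shows "partial i f x = c i"
  using partial_eqI[OF assms, of i]
  by (simp add: axis_def if_distrib[of "\<lambda>t. t *\<^sub>R _"] cong: if_cong)

lemma has_derivative_cong_open:
  assumes "open S" "x \<in> S" "\<And>y. y \<in> S \<Longrightarrow> f y = g y"
  shows "(f has_derivative f') (at x) \<longleftrightarrow> (g has_derivative f') (at x)"
proof
  show "(g has_derivative f') (at x)" if "(f has_derivative f') (at x)"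
    using has_derivative_transform_within_open[OF that assms] .
  show "(f has_derivative f') (at x)" if "(g has_derivative f') (at x)"
    using has_derivative_transform_within_open[OF that assms(1,2) assms(3)[symmetric]] .
qed

text \<open>Valid also at points where the functions are not differentiable:
  \<open>frechet_derivative\<close> chooses among the maps that satisfy a predicate, and this
  predicate is the same for both functions.\<close>

lemma partial_cong:
  assumes "open S" "x \<in> S" "\<And>y. y \<in> S \<Longrightarrow> f y = g y"
  shows "partial i f x = partial i g x"
  unfolding partial_def frechet_derivative_def using has_derivative_cong_open[OF assms] by simp

lemma differentiable_cong_open:
  assumes "open S" "x \<in> S" "\<And>y. y \<in> S \<Longrightarrow> f y = g y"
  shows "f differentiable (at x) \<longleftrightarrow> g differentiable (at x)"
  unfolding differentiable_def using has_derivative_cong_open[OF assms] by simp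

lemma partial_const [simp]: "partial i (\<lambda>x. c) x = 0"
  by (subst partial_eqI[where f' = "\<lambda>h. 0"]) auto

lemma partial_add:
  assumes "f differentiable (at x)" "g differentiable (at x)"
  shows "partial i (\<lambda>x. f x + g x) x = partial i f x + partial i g x"
  using partial_eqI[OF has_derivative_add[OF assms[unfolded frechet_derivative_works]]]
  by (simp add: partial_def)

lemma partial_diff:
  assumes "f differentiable (at x)" "g differentiable (at x)"
  shows "partial i (\<lambda>x. f x - g x) x = partial i f x - partial i g x"
  using partial_eqI[OF has_derivative_diff[OF assms[unfolded frechet_derivative_works]]]
  by (simp add: partial_def)

lemma partial_minus:
  assumes "f differentiable (at x)"
  shows "partial i (\<lambda>x. - f x) x = - partial i f x"
  using partial_eqI[OF has_derivative_minus[OF assms[unfolded frechet_derivative_works]]]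
  by (simp add: partial_def)

lemma partial_scaleR:
  fixes f :: "real^'n::finite \<Rightarrow> real"
  assumes "f differentiable (at x)" "g differentiable (at x)"
  shows "partial i (\<lambda>x. f x *\<^sub>R g x) x = f x *\<^sub>R partial i g x + partial i f x *\<^sub>R g x"
  using partial_eqI[OF has_derivative_scaleR[OF assms[unfolded frechet_derivative_works]]]
  by (simp add: partial_def)

lemma partial_mult:
  fixes f g :: "real^'n::finite \<Rightarrow> real"
  assumes "f differentiable (at x)" "g differentiable (at x)"
  shows "partial i (\<lambda>x. f x * g x) x = partial i f x * g x + f x * partial i g x"
  using partial_eqI[OF has_derivative_mult[OF assms[unfolded frechet_derivative_works]]]
  by (simp add: partial_def)

lemma partial_sum:
  assumes "\<And>a. a \<in> I \<Longrightarrow> f a differentiable (at x)"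
  shows "partial i (\<lambda>x. \<Sum>a\<in>I. f a x) x = (\<Sum>a\<in>I. partial i (f a) x)"
  using partial_eqI[OF has_derivative_sum[OF assms[unfolded frechet_derivative_works]]]
  by (simp add: partial_def)

lemma partial_bounded_linear:
  assumes "bounded_linear L" "f differentiable (at x)"
  shows "partial i (\<lambda>x. L (f x)) x = L (partial i f x)"
  using partial_eqI[OF bounded_linear.has_derivative[OF assms(1) assms(2)[unfolded frechet_derivative_works]]]
  by (simp add: partial_def)

lemma partial_inverse:
  fixes f :: "real^'n::finite \<Rightarrow> real"
  assumes "f differentiable (at x)" "f x \<noteq> 0"
  shows "partial i (\<lambda>x. inverse (f x)) x = - (partial i f x * (inverse (f x) * inverse (f x)))"
  using partial_eqI[OF Deriv.has_derivative_inverse[OF assms(2) assms(1)[unfolded frechet_derivative_works]]]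
  by (simp add: partial_def)

lemma partial_ln:
  fixes f :: "real^'n::finite \<Rightarrow> real"
  assumes "f differentiable (at x)" "f x > 0"
  shows "partial i (\<lambda>x. ln (f x)) x = partial i f x * inverse (f x)"
  using partial_eqI[OF has_derivative_ln[OF assms(2) assms(1)[unfolded frechet_derivative_works]]]
  by (simp add: partial_def divide_inverse)

lemma differentiable_chain_at:
  assumes "f differentiable (at (\<phi> x))" "\<phi> differentiable (at x)"
  shows "(\<lambda>x. f (\<phi> x)) differentiable (at x)"
proof -
  obtain f' \<phi>' where "(f has_derivative f') (at (\<phi> x))" "(\<phi> has_derivative \<phi>') (at x)"
    using assms unfolding differentiable_def by blast
  from diff_chain_at[OF this(2,1)] show ?thesis unfolding differentiable_def o_def by blast
qed

lemma partial_compose: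
  fixes f :: "real^'m::finite \<Rightarrow> 'b::real_normed_vector" and \<phi> :: "real^'n::finite \<Rightarrow> real^'m"
  assumes "f differentiable (at (\<phi> x))" "\<phi> differentiable (at x)"
  shows "partial i (\<lambda>x. f (\<phi> x)) x = (\<Sum>j\<in>UNIV. partial i \<phi> x $ j *\<^sub>R partial j f (\<phi> x))"
proof -
  have "((\<lambda>x. f (\<phi> x)) has_derivative
      (\<lambda>h. \<Sum>j\<in>UNIV. frechet_derivative \<phi> (at x) h $ j *\<^sub>R partial j f (\<phi> x))) (at x)"
    using diff_chain_at[OF assms(2)[unfolded frechet_derivative_works] has_derivative_partial[OF assms(1)]]
    by (simp add: o_def)
  from partial_eqI[OF this] show ?thesis by (simp add: partial_def)
qed

section \<open>Closure properties of \<open>C_k_on\<close> and \<open>smooth_on\<close>\<close>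

lemma C_k_on_cong:
  assumes "open S" "\<And>y. y \<in> S \<Longrightarrow> f y = g y"
  shows "C_k_on k S f \<longleftrightarrow> C_k_on k S g"
  using assms(2)
proof (induction k arbitrary: f g)
  case 0
  then show ?case by (simp cong: continuous_on_cong)
next
  case (Suc k)
  have "C_k_on k S (partial i f) \<longleftrightarrow> C_k_on k S (partial i g)" for i
    by (rule Suc.IH) (auto intro: partial_cong[OF assms(1)] Suc.prems)
  then show ?case
    using differentiable_cong_open[OF assms(1) _ Suc.prems] by simp
qed

lemma C_k_on_Suc_D: "C_k_on (Suc k) S f \<Longrightarrow> C_k_on k S f"
proof (induction k arbitrary: f)
  case 0
  then show ?case
    by (auto intro!: continuous_at_imp_continuous_on differentiable_imp_continuous_within)
qed auto

text \<open>A formula for the partial derivatives is usually known on \<open>S\<close> only, while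
  \<open>C_k_on\<close> speaks about the function \<open>partial i f\<close> itself; this rule lets
  the inductions below work with the formula \<open>g i\<close>.\<close>

lemma C_k_on_SucI:
  assumes "open S" "\<And>x. x \<in> S \<Longrightarrow> f differentiable (at x)" "\<And>i. C_k_on k S (g i)"
    "\<And>i x. x \<in> S \<Longrightarrow> partial i f x = g i x"
  shows "C_k_on (Suc k) S f"
  using assms C_k_on_cong[OF assms(1), of "partial i f" "g i" for i] by simp

lemma C_k_on_const: "C_k_on k S (\<lambda>x. c)"
proof (induction k arbitrary: c)
  case (Suc k)
  have "partial i (\<lambda>x. c) = (\<lambda>x::real^'a. 0)" for i by (rule ext) simp
  then show ?case using Suc by simp
qed simp

lemma C_k_on_bounded_linear:
  assumes "open S" "bounded_linear L" "C_k_on k S f"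
  shows "C_k_on k S (\<lambda>x. L (f x))"
  using assms(3)
proof (induction k arbitrary: f)
  case 0
  then show ?case by (simp add: bounded_linear.continuous_on assms(2))
next
  case (Suc k)
  have d: "f differentiable (at x)" if "x \<in> S" for x using Suc.prems that by simp
  have "(\<lambda>x. L (f x)) differentiable (at x)" if "x \<in> S" for x
    using d[OF that] bounded_linear.has_derivative[OF assms(2)] unfolding differentiable_def by blast
  then show ?case
    using Suc d by (intro C_k_on_SucI[OF assms(1), where g = "\<lambda>i x. L (partial i f x)"])
      (simp_all add: partial_bounded_linear[OF assms(2)])
qed

lemma C_k_on_add:
  assumes "open S" "C_k_on k S f" "C_k_on k S g"
  shows "C_k_on k S (\<lambda>x. f x + g x)"
  using assms(2,3)
proof (induction k arbitrary: f g)
  case 0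
  then show ?case by (simp add: continuous_on_add)
next
  case (Suc k)
  then show ?case
    by (intro C_k_on_SucI[OF assms(1), where g = "\<lambda>i x. partial i f x + partial i g x"])
      (simp_all add: partial_add)
qed

lemma C_k_on_scaleR:
  fixes f :: "real^'n::finite \<Rightarrow> real"
  assumes "open S" "C_k_on k S f" "C_k_on k S g"
  shows "C_k_on k S (\<lambda>x. f x *\<^sub>R g x)"
  using assms(2,3)
proof (induction k arbitrary: f g)
  case 0
  then show ?case by (simp add: continuous_on_scaleR)
next
  case (Suc k)
  have "C_k_on k S f" "C_k_on k S g" using Suc.prems C_k_on_Suc_D by blast+
  then show ?case
    using Suc by (intro C_k_on_SucI[OF assms(1),
          where g = "\<lambda>i x. f x *\<^sub>R partial i g x + partial i f x *\<^sub>R g x"] C_k_on_add[OF assms(1)])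
      (simp_all add: partial_scaleR)
qed

lemma C_k_on_mult:
  fixes f g :: "real^'n::finite \<Rightarrow> real"
  assumes "open S" "C_k_on k S f" "C_k_on k S g"
  shows "C_k_on k S (\<lambda>x. f x * g x)"
  using C_k_on_scaleR[OF assms] by simp

lemma C_k_on_sum:
  assumes "open S" "\<And>a. a \<in> I \<Longrightarrow> C_k_on k S (f a)"
  shows "C_k_on k S (\<lambda>x. \<Sum>a\<in>I. f a x)"
  using assms(2)
  by (induction I rule: infinite_finite_induct) (auto intro: C_k_on_const C_k_on_add[OF assms(1)])

lemma C_k_on_inverse:
  fixes f :: "real^'n::finite \<Rightarrow> real"
  assumes "open S" "C_k_on k S f" "\<And>x. x \<in> S \<Longrightarrow> f x \<noteq> 0"
  shows "C_k_on k S (\<lambda>x. inverse (f x))"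
  using assms(2)
proof (induction k)
  case 0
  then show ?case using assms(3) by (simp add: continuous_on_inverse)
next
  case (Suc k)
  have "C_k_on k S (\<lambda>x. inverse (f x))" using Suc C_k_on_Suc_D by blast
  then have "C_k_on k S (\<lambda>x. - 1 * (partial i f x * (inverse (f x) * inverse (f x))))" for i
    using Suc.prems by (intro C_k_on_mult[OF assms(1)] C_k_on_const) auto
  then show ?case
    using Suc.prems assms(3) by (intro C_k_on_SucI[OF assms(1),
          where g = "\<lambda>i x. - 1 * (partial i f x * (inverse (f x) * inverse (f x)))"])
      (simp_all add: partial_inverse)
qed

lemma C_k_on_compose:
  fixes f :: "real^'m::finite \<Rightarrow> real" and \<phi> :: "real^'n::finite \<Rightarrow> real^'m"
  assumes "open S" "\<And>x. x \<in> S \<Longrightarrow> \<phi> x \<in> T" "C_k_on k S \<phi>" "C_k_on k T f"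
  shows "C_k_on k S (\<lambda>x. f (\<phi> x))"
  using assms(3,4)
proof (induction k arbitrary: f)
  case 0
  then show ?case using assms(2) by (auto intro: continuous_on_compose2)
next
  case (Suc k)
  have d: "\<phi> differentiable (at x)" "f differentiable (at (\<phi> x))" if "x \<in> S" for x
    using Suc.prems that assms(2) by simp_all
  have "C_k_on k S (\<lambda>x. partial i \<phi> x $ j)" for i j
    using Suc.prems by (intro C_k_on_bounded_linear[OF assms(1) bounded_linear_vec_nth]) simp
  moreover have "C_k_on k S (\<lambda>x. partial j f (\<phi> x))" for j
    using Suc.prems C_k_on_Suc_D[of k S \<phi>] Suc.IH by simp
  ultimately have "C_k_on k S (\<lambda>x. \<Sum>j\<in>UNIV. partial i \<phi> x $ j * partial j f (\<phi> x))" for i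
    by (intro C_k_on_sum[OF assms(1)] C_k_on_mult[OF assms(1)])
  then show ?case
    using d by (intro C_k_on_SucI[OF assms(1),
          where g = "\<lambda>i x. \<Sum>j\<in>UNIV. partial i \<phi> x $ j * partial j f (\<phi> x)"])
      (simp_all add: partial_compose differentiable_chain_at del: C_k_on.simps)
qed

lemma smooth_on_const: "smooth_on S (\<lambda>x. c)"
  by (simp add: smooth_on_def C_k_on_const)

lemma smooth_on_add:
  "open S \<Longrightarrow> smooth_on S f \<Longrightarrow> smooth_on S g \<Longrightarrow> smooth_on S (\<lambda>x. f x + g x)"
  by (simp add: smooth_on_def C_k_on_add)

lemma smooth_on_scaleR:
  fixes f :: "real^'n::finite \<Rightarrow> real"
  shows "open S \<Longrightarrow> smooth_on S f \<Longrightarrow> smooth_on S g \<Longrightarrow> smooth_on S (\<lambda>x. f x *\<^sub>R g x)"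
  by (simp add: smooth_on_def C_k_on_scaleR)

lemma smooth_on_mult:
  fixes f g :: "real^'n::finite \<Rightarrow> real"
  shows "open S \<Longrightarrow> smooth_on S f \<Longrightarrow> smooth_on S g \<Longrightarrow> smooth_on S (\<lambda>x. f x * g x)"
  by (simp add: smooth_on_def C_k_on_mult)

lemma smooth_on_bounded_linear:
  "open S \<Longrightarrow> bounded_linear L \<Longrightarrow> smooth_on S f \<Longrightarrow> smooth_on S (\<lambda>x. L (f x))"
  by (simp add: smooth_on_def C_k_on_bounded_linear)

lemma smooth_on_component:
  "open S \<Longrightarrow> smooth_on S f \<Longrightarrow> smooth_on S (\<lambda>x. f x $ a)"
  by (rule smooth_on_bounded_linear[OF _ bounded_linear_vec_nth])

lemma smooth_on_minus:
  "open S \<Longrightarrow> smooth_on S f \<Longrightarrow> smooth_on S (\<lambda>x. - f x)"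
  by (rule smooth_on_bounded_linear[OF _ bounded_linear_minus[OF bounded_linear_ident]])

lemma smooth_on_diff:
  "open S \<Longrightarrow> smooth_on S f \<Longrightarrow> smooth_on S g \<Longrightarrow> smooth_on S (\<lambda>x. f x - g x)"
  using smooth_on_add[of S f "\<lambda>x. - g x"] smooth_on_minus[of S g] by simp

lemma smooth_on_sum:
  "open S \<Longrightarrow> (\<And>a. a \<in> I \<Longrightarrow> smooth_on S (f a)) \<Longrightarrow> smooth_on S (\<lambda>x. \<Sum>a\<in>I. f a x)"
  by (induction I rule: infinite_finite_induct) (auto intro: smooth_on_const smooth_on_add)

lemma smooth_on_prod:
  fixes f :: "'i \<Rightarrow> real^'n::finite \<Rightarrow> real"
  shows "open S \<Longrightarrow> (\<And>a. a \<in> I \<Longrightarrow> smooth_on S (f a)) \<Longrightarrow> smooth_on S (\<lambda>x. \<Prod>a\<in>I. f a x)"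
  by (induction I rule: infinite_finite_induct) (auto intro: smooth_on_const smooth_on_mult)

lemma smooth_on_inverse:
  fixes f :: "real^'n::finite \<Rightarrow> real"
  shows "open S \<Longrightarrow> smooth_on S f \<Longrightarrow> (\<And>x. x \<in> S \<Longrightarrow> f x \<noteq> 0) \<Longrightarrow> smooth_on S (\<lambda>x. inverse (f x))"
  by (simp add: smooth_on_def C_k_on_inverse)

lemma smooth_on_divide:
  fixes f :: "real^'n::finite \<Rightarrow> real"
  shows "open S \<Longrightarrow> smooth_on S f \<Longrightarrow> smooth_on S g \<Longrightarrow> (\<And>x. x \<in> S \<Longrightarrow> g x \<noteq> 0) \<Longrightarrow>
    smooth_on S (\<lambda>x. f x / g x)"
  using smooth_on_mult[OF _ _ smooth_on_inverse, of S f g] by (simp add: divide_inverse)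

lemma smooth_on_partial: "smooth_on S f \<Longrightarrow> smooth_on S (partial i f)"
  unfolding smooth_on_def by (metis C_k_on.simps(2))

lemma smooth_on_imp_differentiable: "smooth_on S f \<Longrightarrow> x \<in> S \<Longrightarrow> f differentiable (at x)"
  unfolding smooth_on_def by (metis C_k_on.simps(2))

lemma smooth_on_imp_continuous_on: "smooth_on S f \<Longrightarrow> continuous_on S f"
  unfolding smooth_on_def by (metis C_k_on.simps(1))

lemma smooth_on_cong:
  "open S \<Longrightarrow> (\<And>y. y \<in> S \<Longrightarrow> f y = g y) \<Longrightarrow> smooth_on S f \<longleftrightarrow> smooth_on S g"
  unfolding smooth_on_def using C_k_on_cong by blast

lemma smooth_on_subset: "smooth_on S f \<Longrightarrow> T \<subseteq> S \<Longrightarrow> smooth_on T f"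
proof -
  have "C_k_on k S f \<Longrightarrow> T \<subseteq> S \<Longrightarrow> C_k_on k T f" for k and f :: "real^'a \<Rightarrow> 'b"
    by (induction k arbitrary: f) (auto intro: continuous_on_subset)
  then show "smooth_on S f \<Longrightarrow> T \<subseteq> S \<Longrightarrow> smooth_on T f" by (auto simp: smooth_on_def)
qed

lemma smooth_on_compose:
  fixes f :: "real^'m::finite \<Rightarrow> real" and \<phi> :: "real^'n::finite \<Rightarrow> real^'m"
  assumes "open S" "\<And>x. x \<in> S \<Longrightarrow> \<phi> x \<in> T" "smooth_on S \<phi>" "smooth_on T f"
  shows "smooth_on S (\<lambda>x. f (\<phi> x))"
  using assms C_k_on_compose by (metis smooth_on_def)

lemma smooth_on_ln:
  fixes f :: "real^'n::finite \<Rightarrow> real"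
  assumes "open S" "smooth_on S f" "\<And>x. x \<in> S \<Longrightarrow> f x > 0"
  shows "smooth_on S (\<lambda>x. ln (f x))"
proof -
  have nz: "f x \<noteq> 0" if "x \<in> S" for x using assms(3)[OF that] by simp
  \<comment> \<open>No induction is involved: the derivative f'/f contains no logarithm and is
    already known to be smooth.\<close>
  have "C_k_on (Suc k) S (\<lambda>x. ln (f x))" for k
  proof (rule C_k_on_SucI[OF assms(1)])
    show "C_k_on k S (\<lambda>x. partial i f x * inverse (f x))" for i
      using smooth_on_mult[OF assms(1) smooth_on_partial[OF assms(2)] smooth_on_inverse[OF assms(1,2)]] nz
      by (simp add: smooth_on_def)
    fix x assume x: "x \<in> S"
    note d = smooth_on_imp_differentiable[OF assms(2) x]
    show "(\<lambda>x. ln (f x)) differentiable (at x)"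
      using has_derivative_ln[of f x _ UNIV] assms(3)[OF x] d unfolding differentiable_def by blast
    show "partial i (\<lambda>x. ln (f x)) x = partial i f x * inverse (f x)" for i
      by (rule partial_ln[OF d assms(3)[OF x]])
  qed
  then show ?thesis unfolding smooth_on_def using C_k_on_Suc_D by blast
qed

text \<open>Bootstrapping: if all components are of class C^k, so is the right-hand side, which
  consists of their partial derivatives; hence they are of class C^{k+1}.\<close>

lemma smooth_on_linear_system:
  fixes F :: "'a::finite \<Rightarrow> real^'n::finite \<Rightarrow> real"
  assumes "open S" and A: "\<And>i a b. smooth_on S (A i a b)"
    and d: "\<And>a x. x \<in> S \<Longrightarrow> F a differentiable (at x)"
    and eq: "\<And>i a x. x \<in> S \<Longrightarrow> partial i (F a) x = (\<Sum>b\<in>UNIV. A i a b x * F b x)"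
  shows "smooth_on S (F a)"
proof -
  have "\<forall>a. C_k_on k S (F a)" for k
  proof (induction k)
    case 0
    then show ?case using d
      by (auto intro!: continuous_at_imp_continuous_on differentiable_imp_continuous_within)
  next
    case (Suc k)
    have "C_k_on (Suc k) S (F a)" for a
      using A Suc d by (intro C_k_on_SucI[OF assms(1) _ _ eq] C_k_on_sum[OF assms(1)]
          C_k_on_mult[OF assms(1)]) (auto simp: smooth_on_def)
    then show ?case by blast
  qed
  then show ?thesis by (simp add: smooth_on_def)
qed

section \<open>Symmetry of second partial derivatives\<close>

lemma has_real_derivative_along_axis:
  fixes f :: "real^'n::finite \<Rightarrow> real"
  assumes "f differentiable (at (p + t *\<^sub>R axis i 1))"
  shows "((\<lambda>t. f (p + t *\<^sub>R axis i 1)) has_real_derivative partial i f (p + t *\<^sub>R axis i 1)) (at t)"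
proof -
  let ?q = "p + t *\<^sub>R axis i 1"
  have "((\<lambda>t. p + t *\<^sub>R axis i 1) has_derivative (\<lambda>s. s *\<^sub>R axis i 1)) (at t)"
    by (auto intro!: derivative_eq_intros)
  from diff_chain_at[OF this assms[unfolded frechet_derivative_works]]
  have "((\<lambda>t. f (p + t *\<^sub>R axis i 1)) has_derivative (\<lambda>s. frechet_derivative f (at ?q) (s *\<^sub>R axis i 1))) (at t)"
    by (simp add: o_def)
  moreover have "frechet_derivative f (at ?q) (s *\<^sub>R axis i 1) = partial i f ?q * s" for s
    using linear_cmul[OF has_derivative_linear[OF assms[unfolded frechet_derivative_works]]]
    by (simp add: partial_def)
  ultimately show ?thesis by (simp add: has_field_derivative_def)
qed

text \<open>The second difference is the increment in direction \<open>i\<close> of an increment in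
  direction \<open>j\<close>, so the mean value theorem applies once in each direction.\<close>

lemma mean_value_partial_partial:
  fixes f :: "real^'n::finite \<Rightarrow> real"
  assumes "h > 0"
    and d: "\<And>s t. 0 \<le> s \<Longrightarrow> s \<le> h \<Longrightarrow> 0 \<le> t \<Longrightarrow> t \<le> h \<Longrightarrow>
       f differentiable (at (x + s *\<^sub>R axis i 1 + t *\<^sub>R axis j 1)) \<and>
       partial i f differentiable (at (x + s *\<^sub>R axis i 1 + t *\<^sub>R axis j 1))"
  shows "\<exists>s t. 0 < s \<and> s < h \<and> 0 < t \<and> t < h \<and>
    f (x + h *\<^sub>R axis i 1 + h *\<^sub>R axis j 1) - f (x + h *\<^sub>R axis i 1) - f (x + h *\<^sub>R axis j 1) + f x
     = h * h * partial j (partial i f) (x + s *\<^sub>R axis i 1 + t *\<^sub>R axis j 1)"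
proof -
  let ?e = "axis i 1 :: real^'n" and ?e' = "axis j 1 :: real^'n"
  let ?u = "\<lambda>s. f (x + h *\<^sub>R ?e' + s *\<^sub>R ?e) - f (x + s *\<^sub>R ?e)"
  have "(?u has_real_derivative
      partial i f (x + h *\<^sub>R ?e' + s *\<^sub>R ?e) - partial i f (x + s *\<^sub>R ?e)) (at s)"
    if "0 \<le> s" "s \<le> h" for s
    using d[of s h] d[of s 0] that assms(1)
    by (intro DERIV_diff has_real_derivative_along_axis) (auto simp: algebra_simps)
  from MVT2[OF assms(1) this] obtain s where s: "0 < s" "s < h"
    "?u h - ?u 0 = h * (partial i f (x + h *\<^sub>R ?e' + s *\<^sub>R ?e) - partial i f (x + s *\<^sub>R ?e))"
    by auto
  have "((\<lambda>t. partial i f ((x + s *\<^sub>R ?e) + t *\<^sub>R ?e')) has_real_derivative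
      partial j (partial i f) ((x + s *\<^sub>R ?e) + t *\<^sub>R ?e')) (at t)" if "0 \<le> t" "t \<le> h" for t
    using d[of s t] s that by (intro has_real_derivative_along_axis) auto
  from MVT2[OF assms(1) this] obtain t where t: "0 < t" "t < h"
    "partial i f ((x + s *\<^sub>R ?e) + h *\<^sub>R ?e') - partial i f (x + s *\<^sub>R ?e)
      = h * partial j (partial i f) ((x + s *\<^sub>R ?e) + t *\<^sub>R ?e')"
    by auto
  have "?u h - ?u 0 = h * h * partial j (partial i f) (x + s *\<^sub>R ?e + t *\<^sub>R ?e')"
    using s(3) t(3) by (simp add: algebra_simps)
  then show ?thesis using s t
    by (intro exI[of _ s] exI[of _ t]) (simp add: algebra_simps)
qed

text \<open>The second difference over a small square is symmetric in \<open>i\<close> and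
  \<open>j\<close>. Hence the two mixed derivatives agree at two points of the square, and
  continuity forbids that they differ at \<open>x\<close>.\<close>

lemma partial_commute:
  fixes f :: "real^'n::finite \<Rightarrow> real"
  assumes "open S" "x \<in> S" "smooth_on S f"
  shows "partial i (partial j f) x = partial j (partial i f) x"
proof (rule ccontr)
  assume ne: "partial i (partial j f) x \<noteq> partial j (partial i f) x"
  define e where "e = \<bar>partial i (partial j f) x - partial j (partial i f) x\<bar> / 2"
  have "e > 0" using ne by (simp add: e_def)
  have c: "isCont (partial i (partial j f)) x" "isCont (partial j (partial i f)) x"
    using assms smooth_on_imp_continuous_on[OF smooth_on_partial[OF smooth_on_partial[OF assms(3)]]]
      continuous_on_eq_continuous_at by blast+
  obtain r1 where r1: "r1 > 0" "\<And>y. dist y x < r1 \<Longrightarrow>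
      dist (partial i (partial j f) y) (partial i (partial j f) x) < e"
    using c(1) \<open>e > 0\<close> unfolding continuous_at_eps_delta dist_real_def dist_norm by blast
  obtain r2 where r2: "r2 > 0" "\<And>y. dist y x < r2 \<Longrightarrow>
      dist (partial j (partial i f) y) (partial j (partial i f) x) < e"
    using c(2) \<open>e > 0\<close> unfolding continuous_at_eps_delta dist_real_def dist_norm by blast
  obtain r3 where r3: "r3 > 0" "ball x r3 \<subseteq> S" using assms openE by blast
  define r where "r = min r1 (min r2 r3)"
  \<comment> \<open>Two moves of length at most \<open>h\<close> stay within r/2 of
    \<open>x\<close>.\<close>
  define h where "h = r / 4"
  have "h > 0" using r1 r2 r3 by (simp add: h_def r_def)
  have near: "dist (x + s *\<^sub>R axis a 1 + t *\<^sub>R axis b 1) x < r"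
    if "0 \<le> s" "s \<le> h" "0 \<le> t" "t \<le> h" for s t a b
  proof -
    have "norm (s *\<^sub>R axis a 1 + t *\<^sub>R axis b 1 :: real^'n) \<le> s + t"
      using norm_triangle_ineq[of "s *\<^sub>R axis a 1 :: real^'n" "t *\<^sub>R axis b 1"] that by (simp add: norm_axis_1)
    also have "\<dots> < r" using that \<open>h > 0\<close> by (simp add: h_def)
    finally show ?thesis by (simp add: dist_norm add.assoc)
  qed
  have inS: "x + s *\<^sub>R axis a 1 + t *\<^sub>R axis b 1 \<in> S"
    if "0 \<le> s" "s \<le> h" "0 \<le> t" "t \<le> h" for s t a b
    using near[OF that, of a b] r3(2) by (auto simp: r_def dist_commute)
  note diff = smooth_on_imp_differentiable[OF assms(3)]
    smooth_on_imp_differentiable[OF smooth_on_partial[OF assms(3)]]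
  obtain s t where st: "0 < s" "s < h" "0 < t" "t < h"
    "f (x + h *\<^sub>R axis i 1 + h *\<^sub>R axis j 1) - f (x + h *\<^sub>R axis i 1) - f (x + h *\<^sub>R axis j 1) + f x
      = h * h * partial j (partial i f) (x + s *\<^sub>R axis i 1 + t *\<^sub>R axis j 1)"
    using mean_value_partial_partial[OF \<open>h > 0\<close>, of f x i j] diff inS by blast
  obtain s' t' where st': "0 < s'" "s' < h" "0 < t'" "t' < h"
    "f (x + h *\<^sub>R axis j 1 + h *\<^sub>R axis i 1) - f (x + h *\<^sub>R axis j 1) - f (x + h *\<^sub>R axis i 1) + f x
      = h * h * partial i (partial j f) (x + s' *\<^sub>R axis j 1 + t' *\<^sub>R axis i 1)"
    using mean_value_partial_partial[OF \<open>h > 0\<close>, of f x j i] diff inS by blast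
  have "h * h * partial j (partial i f) (x + s *\<^sub>R axis i 1 + t *\<^sub>R axis j 1)
      = h * h * partial i (partial j f) (x + s' *\<^sub>R axis j 1 + t' *\<^sub>R axis i 1)"
    using st(5) st'(5) by (simp add: algebra_simps)
  then have "partial j (partial i f) (x + s *\<^sub>R axis i 1 + t *\<^sub>R axis j 1)
      = partial i (partial j f) (x + s' *\<^sub>R axis j 1 + t' *\<^sub>R axis i 1)"
    using \<open>h > 0\<close> by simp
  moreover have "dist (partial j (partial i f) (x + s *\<^sub>R axis i 1 + t *\<^sub>R axis j 1)) (partial j (partial i f) x) < e"
    using st near[of s t i j] by (intro r2(2)) (auto simp: r_def)
  moreover have "dist (partial i (partial j f) (x + s' *\<^sub>R axis j 1 + t' *\<^sub>R axis i 1)) (partial i (partial j f) x) < e"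
    using st' near[of s' t' j i] by (intro r1(2)) (auto simp: r_def)
  ultimately show False unfolding e_def dist_real_def by argo
qed

section \<open>Linear systems of total differential equations\<close>

text \<open>For a closed one-form this is the Poincare lemma on a ball.\<close>

lemma radial_primitive:
  fixes u :: "'n::finite \<Rightarrow> real^'n \<Rightarrow> real" and V :: "'n \<Rightarrow> 'n \<Rightarrow> real^'n \<Rightarrow> real"
    and x0 :: "real^'n"
  defines "\<phi> \<equiv> \<lambda>x. integral {0..1} (\<lambda>t. \<Sum>j\<in>UNIV. (x - x0) $ j * u j (x0 + t *\<^sub>R (x - x0)))"
    and "\<psi> \<equiv> \<lambda>i x. u i x + integral {0..1} (\<lambda>t. t * (\<Sum>j\<in>UNIV. (x - x0) $ j *
            (V i j (x0 + t *\<^sub>R (x - x0)) - V j i (x0 + t *\<^sub>R (x - x0)))))"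
  assumes du: "\<And>i x. x \<in> ball x0 r \<Longrightarrow> (u i has_derivative (\<lambda>h. \<Sum>j\<in>UNIV. h $ j * V j i x)) (at x)"
    and cV: "\<And>i j. continuous_on (ball x0 r) (V i j)"
  shows "\<And>x. x \<in> ball x0 r \<Longrightarrow> (\<phi> has_derivative (\<lambda>h. \<Sum>i\<in>UNIV. h $ i * \<psi> i x)) (at x)"
    and "\<And>i. continuous_on (ball x0 r) (\<psi> i)"
proof -
  let ?B = "ball x0 r"
  let ?q = "\<lambda>x t. x0 + t *\<^sub>R (x - x0)"
  have qB: "?q x t \<in> ?B" if "x \<in> ?B" "t \<in> {0..1}" for x t
  proof -
    have "norm (t *\<^sub>R (x - x0)) \<le> norm (x - x0)" using that by (simp add: mult_left_le_one_le)
    also have "\<dots> < r" using that by (simp add: dist_norm norm_minus_commute)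
    finally show ?thesis by (simp add: dist_norm)
  qed
  have cu: "continuous_on ?B (u i)" for i
    by (rule has_derivative_continuous_on) (rule has_derivative_at_withinI[OF du])
  have cq: "continuous_on (?B \<times> {0..1}) (\<lambda>(x, t). w (?q x t))" if "continuous_on ?B w"
    for w :: "real^'n \<Rightarrow> real"
  proof -
    have "continuous_on (?B \<times> {0..1}) (\<lambda>z. w (?q (fst z) (snd z)))"
      by (rule continuous_on_compose2[OF that]) (auto intro!: continuous_intros qB)
    then show ?thesis by (simp add: case_prod_beta)
  qed
  have cq': "continuous_on {0..1} (\<lambda>t. w (?q x t))" if "continuous_on ?B w" "x \<in> ?B"
    for w :: "real^'n \<Rightarrow> real" and x
    by (rule continuous_on_compose2[OF that(1)]) (auto intro!: continuous_intros qB[OF that(2)])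
  let ?c = "\<lambda>i x t. t * (\<Sum>j\<in>UNIV. (x - x0) $ j * (V i j (?q x t) - V j i (?q x t)))"
  show "continuous_on ?B (\<psi> i)" for i
  proof -
    note [continuous_intros] = cq[OF cV, unfolded case_prod_beta]
    have "continuous_on (?B \<times> cbox 0 1) (\<lambda>(x, t). ?c i x t)"
      unfolding case_prod_beta box_real by (intro continuous_intros)
    from integral_continuous_on_param[OF this]
    show ?thesis unfolding \<psi>_def box_real by (intro continuous_intros cu)
  qed
  fix x assume x: "x \<in> ?B"
  \<comment> \<open>\<open>leibniz_rule\<close> expects the derivative of the integrand as a bounded
    linear function depending continuously on the parameters, so the coordinate functionals are
    packed into that type.\<close>
  define E :: "'n \<Rightarrow> (real^'n) \<Rightarrow>\<^sub>L real" where "E i = Blinfun (\<lambda>h. h $ i)" for i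
  have E: "blinfun_apply (E i) h = h $ i" for i h
    unfolding E_def by (simp add: bounded_linear_Blinfun_apply bounded_linear_vec_nth)
  \<comment> \<open>The partial derivative of the integrand in direction \<open>i\<close>. Since
    \<open>V i j\<close> is the derivative of \<open>u j\<close> in direction \<open>i\<close>, the
    factor \<open>t\<close> comes from the chain rule along the ray.\<close>
  define d where "d i x t = u i (?q x t) + t * (\<Sum>j\<in>UNIV. (x - x0) $ j * V i j (?q x t))" for i x t
  let ?f = "\<lambda>x t. \<Sum>j\<in>UNIV. (x - x0) $ j * u j (?q x t)"
  let ?fx = "\<lambda>x t. \<Sum>i\<in>UNIV. d i x t *\<^sub>R E i"
  have fx: "((\<lambda>x. ?f x t) has_derivative blinfun_apply (?fx x t)) (at x within ?B)"
    if x: "x \<in> ?B" and t: "t \<in> cbox 0 1" for x t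
  proof -
    have 1: "((\<lambda>x. u j (?q x t)) has_derivative (\<lambda>h. \<Sum>i\<in>UNIV. (t *\<^sub>R h) $ i * V i j (?q x t))) (at x within ?B)" for j
    proof -
      have q: "((\<lambda>x. ?q x t) has_derivative (\<lambda>h. t *\<^sub>R h)) (at x)"
        by (auto intro!: derivative_eq_intros)
      have "?q x t \<in> ?B" using qB x t by simp
      from diff_chain_at[OF q du[OF this]] show ?thesis
        unfolding o_def by (rule has_derivative_at_withinI)
    qed
    have 2: "((\<lambda>x. (x - x0) $ j) has_derivative (\<lambda>h. h $ j)) (at x within ?B)" for j
      by (auto intro!: derivative_eq_intros bounded_linear.has_derivative[OF bounded_linear_vec_nth])
    have "((\<lambda>x. ?f x t) has_derivative
        (\<lambda>h. \<Sum>j\<in>UNIV. (x - x0) $ j * (\<Sum>i\<in>UNIV. (t *\<^sub>R h) $ i * V i j (?q x t)) + h $ j * u j (?q x t)))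
        (at x within ?B)"
      by (intro has_derivative_sum has_derivative_mult 1 2)
    moreover have "(\<Sum>j\<in>UNIV. (x - x0) $ j * (\<Sum>i\<in>UNIV. (t *\<^sub>R h) $ i * V i j (?q x t)) + h $ j * u j (?q x t))
        = blinfun_apply (?fx x t) h" for h
    proof -
      have "(\<Sum>j\<in>UNIV. (x - x0) $ j * (\<Sum>i\<in>UNIV. (t *\<^sub>R h) $ i * V i j (?q x t)))
          = (\<Sum>i\<in>UNIV. h $ i * (t * (\<Sum>j\<in>UNIV. (x - x0) $ j * V i j (?q x t))))"
        unfolding sum_distrib_left by (subst sum.swap) (simp add: mult_ac)
      moreover have "blinfun_apply (?fx x t) h = (\<Sum>i\<in>UNIV. h $ i * d i x t)"
        by (simp add: blinfun.sum_left blinfun.scaleR_left E mult.commute)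
      ultimately show ?thesis by (simp only: sum.distrib d_def distrib_left add.commute)
    qed
    ultimately show ?thesis by simp
  qed
  have cd: "continuous_on (?B \<times> {0..1}) (\<lambda>z. d i (fst z) (snd z))" for i
  proof -
    note [continuous_intros] = cq[OF cV, unfolded case_prod_beta] cq[OF cu, unfolded case_prod_beta]
    show ?thesis unfolding d_def by (intro continuous_intros)
  qed
  have int: "(\<lambda>t. d i x t) integrable_on {0..1}" for i
  proof -
    note [continuous_intros] = cq'[OF cV x] cq'[OF cu x]
    show ?thesis unfolding d_def by (intro integrable_continuous_real continuous_intros)
  qed
  have cfx: "continuous_on (?B \<times> cbox 0 1) (\<lambda>(x, t). ?fx x t)"
    unfolding case_prod_beta box_real by (intro continuous_intros cd)
  have "?f x integrable_on cbox 0 1" if "x \<in> ?B" for x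
  proof -
    note [continuous_intros] = cq'[OF cu that]
    show ?thesis unfolding box_real by (intro integrable_continuous_real continuous_intros)
  qed
  from leibniz_rule[OF fx this cfx x convex_ball]
  have D: "(\<phi> has_derivative blinfun_apply (integral {0..1} (?fx x))) (at x)"
    unfolding \<phi>_def box_real using at_within_open[OF x open_ball] by simp
  have ifx: "?fx x integrable_on {0..1}"
  proof -
    note [continuous_intros] = cq'[OF cV x] cq'[OF cu x]
    show ?thesis unfolding d_def by (intro integrable_continuous_real continuous_intros)
  qed
  have "blinfun_apply (integral {0..1} (?fx x)) h = (\<Sum>i\<in>UNIV. h $ i * integral {0..1} (d i x))" for h
  proof -
    have "blinfun_apply (integral {0..1} (?fx x)) h = integral {0..1} (\<lambda>t. \<Sum>i\<in>UNIV. h $ i * d i x t)"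
      by (subst blinfun_apply_integral[OF ifx])
        (simp add: blinfun.sum_left blinfun.scaleR_left E mult.commute)
    also have "\<dots> = (\<Sum>i\<in>UNIV. integral {0..1} (\<lambda>t. h $ i * d i x t))"
      by (rule integral_sum) (auto intro: integrable_on_mult_right int)
    finally show ?thesis by simp
  qed
  moreover have "integral {0..1} (d i x) = \<psi> i x" for i
  proof -
    \<comment> \<open>\<open>?w\<close> is the derivative of t u_i along the ray, so its integral is
      \<open>u i x\<close>. It differs from \<open>d i x\<close> exactly by the curl term in
      \<open>\<psi>\<close>.\<close>
    let ?w = "\<lambda>t. u i (?q x t) + t * (\<Sum>j\<in>UNIV. (x - x0) $ j * V j i (?q x t))"
    have "((\<lambda>t. t * u i (?q x t)) has_vector_derivative ?w t) (at t within {0..1})"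
      if "t \<in> {0..1}" for t
    proof -
      have q: "((\<lambda>t. ?q x t) has_derivative (\<lambda>s. s *\<^sub>R (x - x0))) (at t)"
        by (auto intro!: derivative_eq_intros)
      from diff_chain_at[OF q du[OF qB[OF x that]]]
      have "((\<lambda>t. u i (?q x t)) has_derivative (\<lambda>s. \<Sum>j\<in>UNIV. (s *\<^sub>R (x - x0)) $ j * V j i (?q x t))) (at t)"
        by (simp add: o_def)
      moreover have "(\<lambda>s. \<Sum>j\<in>UNIV. (s *\<^sub>R (x - x0)) $ j * V j i (?q x t))
          = (*) (\<Sum>j\<in>UNIV. (x - x0) $ j * V j i (?q x t))"
        by (rule ext) (simp add: sum_distrib_left mult_ac)
      ultimately have "((\<lambda>t. u i (?q x t)) has_real_derivative (\<Sum>j\<in>UNIV. (x - x0) $ j * V j i (?q x t))) (at t)"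
        by (simp add: has_field_derivative_def)
      from DERIV_mult[OF DERIV_ident this]
      have "((\<lambda>t. t * u i (?q x t)) has_real_derivative ?w t) (at t)"
        by (simp add: mult_ac add_ac)
      then show ?thesis
        using has_real_derivative_iff_has_vector_derivative has_vector_derivative_at_within by blast
    qed
    from fundamental_theorem_of_calculus[OF _ this]
    have w: "(?w has_integral u i x) {0..1}" by simp
    have "d i x = (\<lambda>t. ?w t + ?c i x t)"
      by (rule ext) (simp add: d_def right_diff_distrib sum_subtractf del: vector_minus_component)
    moreover have "?c i x integrable_on {0..1}"
    proof -
      note [continuous_intros] = cq'[OF cV x]
      show ?thesis by (intro integrable_continuous_real continuous_intros)
    qed
    ultimately show ?thesis
      using integral_add[OF has_integral_integrable[OF w], of "?c i x"] integral_unique[OF w]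
      by (simp add: \<psi>_def)
  qed
  ultimately have "blinfun_apply (integral {0..1} (?fx x)) = (\<lambda>h. \<Sum>i\<in>UNIV. h $ i * \<psi> i x)"
    by (intro ext) simp
  then show "(\<phi> has_derivative (\<lambda>h. \<Sum>i\<in>UNIV. h $ i * \<psi> i x)) (at x)"
    using D by metis
qed


text \<open>Each iterate is \<open>F0\<close> plus the radial primitive, as in
  \<open>radial_primitive\<close>, of the one-form with coefficients A_i F_n, where F_n is the
  preceding iterate.\<close>

primrec picard_iterate ::
  "('n::finite \<Rightarrow> 'a::finite \<Rightarrow> 'a \<Rightarrow> real^'n \<Rightarrow> real) \<Rightarrow> real^'n \<Rightarrow> ('a \<Rightarrow> real) \<Rightarrow> nat \<Rightarrow> 'a \<Rightarrow> real^'n \<Rightarrow> real"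
where
  "picard_iterate A x0 F0 0 = (\<lambda>a x. F0 a)"
| "picard_iterate A x0 F0 (Suc n) = (\<lambda>a x. F0 a + integral {0..1} (\<lambda>t. \<Sum>i\<in>UNIV. (x - x0) $ i *
      (\<Sum>b\<in>UNIV. A i a b (x0 + t *\<^sub>R (x - x0)) * picard_iterate A x0 F0 n b (x0 + t *\<^sub>R (x - x0)))))"

lemma abs_sum_UNIV_le:
  fixes f :: "'i::finite \<Rightarrow> real"
  assumes "\<And>i. \<bar>f i\<bar> \<le> c"
  shows "\<bar>\<Sum>i\<in>UNIV. f i\<bar> \<le> real CARD('i) * c"
  using order_trans[OF sum_abs sum_bounded_above[of UNIV "\<lambda>i. \<bar>f i\<bar>" c]] assms by simp

text \<open>The assumption \<open>flat\<close> is the integrability condition from equating the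
  mixed second derivatives of a solution, that is, zero curvature of the connection d - A. The
  radius is fixed before \<open>F0\<close>, so one ball carries the solutions for all initial
  values.\<close>

theorem linear_total_system:
  fixes A :: "'n::finite \<Rightarrow> 'a::finite \<Rightarrow> 'a \<Rightarrow> real^'n \<Rightarrow> real" and x0 :: "real^'n"
  assumes S: "open S" "x0 \<in> S"
    and A: "\<And>i a b. smooth_on S (A i a b)"
    and flat: "\<And>i j a b x. x \<in> S \<Longrightarrow>
      partial i (A j a b) x + (\<Sum>c\<in>UNIV. A j a c x * A i c b x) =
      partial j (A i a b) x + (\<Sum>c\<in>UNIV. A i a c x * A j c b x)"
  obtains r where "r > 0" "ball x0 r \<subseteq> S"
    "\<And>F0. \<exists>F. (\<forall>a. F a x0 = F0 a \<and> smooth_on (ball x0 r) (F a)) \<and>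
      (\<forall>i a. \<forall>x\<in>ball x0 r. partial i (F a) x = (\<Sum>b\<in>UNIV. A i a b x * F b x))"
proof -
  obtain r1 where r1: "r1 > 0" "cball x0 r1 \<subseteq> S"
    using S open_contains_cball by blast
  obtain K where K: "K > 0" "\<And>i a b x. x \<in> cball x0 r1 \<Longrightarrow> \<bar>A i a b x\<bar> \<le> K"
  proof -
    let ?f = "\<lambda>x. \<Sum>z\<in>UNIV. \<bar>A (fst z) (fst (snd z)) (snd (snd z)) x\<bar>"
    have "continuous_on (cball x0 r1) ?f"
      using smooth_on_imp_continuous_on[OF A] r1(2) by (intro continuous_intros) (auto intro: continuous_on_subset)
    then have "bounded (?f ` cball x0 r1)"
      by (rule compact_imp_bounded[OF compact_continuous_image]) simp
    then obtain K where K: "K > 0" "\<And>x. x \<in> cball x0 r1 \<Longrightarrow> \<bar>?f x\<bar> \<le> K"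
      unfolding bounded_pos by auto
    have "\<bar>A i a b x\<bar> \<le> K" if "x \<in> cball x0 r1" for i a b x
    proof -
      have "\<bar>A i a b x\<bar> \<le> ?f x"
        using member_le_sum[of "(i, a, b)" UNIV "\<lambda>z. \<bar>A (fst z) (fst (snd z)) (snd (snd z)) x\<bar>"] by simp
      then show ?thesis using K(2)[OF that] by simp
    qed
    with K(1) that show ?thesis by blast
  qed
  let ?N = "real CARD('n)" and ?L = "real CARD('a)"
  \<comment> \<open>Makes one radial integration of A W contribute at most W/4. The 4 leaves room
    for the defect estimate below, where two such terms (factor 1/2) and the change of the iterate
    (1/4) add up to the ratio 3/4.\<close>
  define r where "r = min r1 (1 / (4 * ?N * ?L * K))"
  have "r > 0" using r1 K by (simp add: r_def)
  have "r * (4 * ?N * ?L * K) \<le> 1 / (4 * ?N * ?L * K) * (4 * ?N * ?L * K)"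
    using K by (intro mult_right_mono) (auto simp: r_def)
  then have small: "r * ?N * ?L * K \<le> 1 / 4" using K by (simp add: field_simps)
  let ?B = "ball x0 r"
  let ?q = "\<lambda>x t. x0 + t *\<^sub>R (x - x0)"
  have BS: "?B \<subseteq> S" "?B \<subseteq> cball x0 r1" using r1 by (auto simp: r_def)
  have AK: "\<bar>A i a b x\<bar> \<le> K" if "x \<in> ?B" for i a b x
    using K(2) BS(2) that by blast
  have qB: "?q x t \<in> ?B" if "x \<in> ?B" "t \<in> {0..1}" for x t
  proof -
    have "norm (t *\<^sub>R (x - x0)) \<le> norm (x - x0)" using that by (simp add: mult_left_le_one_le)
    also have "\<dots> < r" using that by (simp add: dist_norm norm_minus_commute)
    finally show ?thesis by (simp add: dist_norm)
  qed
  have comp: "\<bar>(x - x0) $ j\<bar> \<le> r" if "x \<in> ?B" for x j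
    using component_le_norm_cart[of "x - x0" j] that by (simp add: dist_norm norm_minus_commute)
  have cA: "continuous_on ?B (A i a b)" "continuous_on ?B (partial j (A i a b))" for i j a b
    using smooth_on_imp_continuous_on A smooth_on_partial continuous_on_subset BS(1) by blast+
  have cq: "continuous_on {0..1} (\<lambda>t. w (?q x t))" if "continuous_on ?B w" "x \<in> ?B"
    for w :: "real^'n \<Rightarrow> real" and x
    by (rule continuous_on_compose2[OF that(1)]) (auto intro!: continuous_intros qB[OF that(2)])
  have Aw: "\<bar>\<Sum>b\<in>UNIV. A i a b x * w b\<bar> \<le> ?L * (K * W)"
    if "x \<in> ?B" "\<And>b. \<bar>w b\<bar> \<le> W" for i a x w W
    using that AK by (intro abs_sum_UNIV_le) (auto simp: abs_mult intro!: mult_mono order_less_imp_le[OF K(1)])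
  have "\<exists>F. (\<forall>a. F a x0 = F0 a \<and> smooth_on ?B (F a)) \<and>
      (\<forall>i a. \<forall>x\<in>?B. partial i (F a) x = (\<Sum>b\<in>UNIV. A i a b x * F b x))" for F0
  proof -
    define Fs where "Fs = picard_iterate A x0 F0"
    define u where "u n i a x = (\<Sum>b\<in>UNIV. A i a b x * Fs n b x)" for n i a x
    have Fs0: "Fs 0 a x = F0 a" for a x by (simp add: Fs_def)
    have FsS: "Fs (Suc n) a x = F0 a + integral {0..1} (\<lambda>t. \<Sum>i\<in>UNIV. (x - x0) $ i * u n i a (?q x t))"
      for n a x by (simp add: Fs_def u_def)
    define C1 where "C1 n P \<longleftrightarrow> (\<forall>i a. continuous_on ?B (P i a)) \<and>
      (\<forall>a. \<forall>x\<in>?B. (Fs n a has_derivative (\<lambda>h. \<Sum>i\<in>UNIV. h $ i * P i a x)) (at x))" for n P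
    \<comment> \<open>\<open>E n P\<close> is the defect of the n-th iterate in the system, if
      \<open>P\<close> are its partial derivatives; \<open>P'\<close> is the resulting formula for
      the partial derivatives of the next iterate.\<close>
    define E where "E n P i a x = P i a x - u n i a x" for n and P :: "'n \<Rightarrow> 'a \<Rightarrow> real^'n \<Rightarrow> real" and i a x
    define P' where "P' n P i a x = u n i a x + integral {0..1} (\<lambda>t. t * (\<Sum>j\<in>UNIV. (x - x0) $ j *
        (\<Sum>b\<in>UNIV. A j a b (?q x t) * E n P i b (?q x t) - A i a b (?q x t) * E n P j b (?q x t))))"
      for n P i a x
    have cFs: "continuous_on ?B (Fs n a)" if "C1 n P" for n P a
    proof (rule has_derivative_continuous_on)
      show "(Fs n a has_derivative (\<lambda>h. \<Sum>i\<in>UNIV. h $ i * P i a x)) (at x within ?B)" if "x \<in> ?B" for x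
        using \<open>C1 n P\<close> that unfolding C1_def by (auto intro: has_derivative_at_withinI)
    qed
    have step: "C1 (Suc n) (P' n P)" if C1: "C1 n P" for n P
    proof -
      define V where "V a i j x = (\<Sum>b\<in>UNIV. partial i (A j a b) x * Fs n b x + A j a b x * P i b x)" for a i j x
      have P: "continuous_on ?B (P i a)" for i a using C1 by (auto simp: C1_def)
      have cV: "continuous_on ?B (V a i j)" for a i j
        unfolding V_def by (intro continuous_intros P cA cFs[OF C1])
      have du: "(u n j a has_derivative (\<lambda>h. \<Sum>i\<in>UNIV. h $ i * V a i j x)) (at x)" if x: "x \<in> ?B" for j a x
      proof -
        have "x \<in> S" using BS x by blast
        have "((\<lambda>x. A j a b x * Fs n b x) has_derivative
          (\<lambda>h. A j a b x * (\<Sum>i\<in>UNIV. h $ i * P i b x) + (\<Sum>i\<in>UNIV. h $ i *\<^sub>R partial i (A j a b) x) * Fs n b x)) (at x)" for b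
          using C1 x by (intro has_derivative_mult has_derivative_partial smooth_on_imp_differentiable[OF A \<open>x \<in> S\<close>])
            (auto simp: C1_def)
        from has_derivative_sum[of UNIV, OF this]
        have "(u n j a has_derivative (\<lambda>h. \<Sum>b\<in>UNIV. A j a b x * (\<Sum>i\<in>UNIV. h $ i * P i b x) + (\<Sum>i\<in>UNIV. h $ i *\<^sub>R partial i (A j a b) x) * Fs n b x)) (at x)"
          unfolding u_def by simp
        moreover have "(\<Sum>b\<in>UNIV. A j a b x * (\<Sum>i\<in>UNIV. h $ i * P i b x) + (\<Sum>i\<in>UNIV. h $ i *\<^sub>R partial i (A j a b) x) * Fs n b x)
           = (\<Sum>i\<in>UNIV. h $ i * V a i j x)" for h
        proof -
          have "(\<Sum>i\<in>UNIV. h $ i * V a i j x) = (\<Sum>b\<in>UNIV. \<Sum>i\<in>UNIV. h $ i * (partial i (A j a b) x * Fs n b x + A j a b x * P i b x))"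
            unfolding V_def sum_distrib_left by (rule sum.swap)
          then show ?thesis
            by (simp add: sum_distrib_left sum_distrib_right sum.distrib distrib_left mult_ac add.commute)
        qed
        ultimately show ?thesis by simp
      qed
      \<comment> \<open>Writing P_i = A_i F + E_i, the curl of A F splits into the curvature of
        \<open>A\<close> applied to F, which vanishes by \<open>flat\<close>, and terms linear in
        the defect. Without this the derivatives of \<open>A\<close> would spoil the
        recursion.\<close>
      have curl: "V a i j x - V a j i x = (\<Sum>b\<in>UNIV. A j a b x * E n P i b x - A i a b x * E n P j b x)"
        if x: "x \<in> ?B" for a i j x
      proof -
        have AA: "(\<Sum>b\<in>UNIV. A j a b x * u n i b x) = (\<Sum>b\<in>UNIV. (\<Sum>c\<in>UNIV. A j a c x * A i c b x) * Fs n b x)" for i j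
          unfolding u_def sum_distrib_left sum_distrib_right by (subst sum.swap) (simp add: mult_ac)
        have "x \<in> S" using BS x by blast
        have "(\<Sum>b\<in>UNIV. partial i (A j a b) x * Fs n b x) + (\<Sum>b\<in>UNIV. A j a b x * u n i b x)
          = (\<Sum>b\<in>UNIV. partial j (A i a b) x * Fs n b x) + (\<Sum>b\<in>UNIV. A i a b x * u n j b x)"
          unfolding AA sum.distrib[symmetric] distrib_right[symmetric] flat[OF \<open>x \<in> S\<close>] ..
        then show ?thesis
          by (simp add: V_def E_def sum.distrib sum_subtractf right_diff_distrib)
      qed
      have eq: "u n i a x + integral {0..1} (\<lambda>t. t * (\<Sum>j\<in>UNIV. (x - x0) $ j *
            (V a i j (?q x t) - V a j i (?q x t)))) = P' n P i a x" if "x \<in> ?B" for i a x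
        unfolding P'_def using curl qB[OF that] by (intro arg_cong2[where f = "(+)"] integral_cong) auto
      have "continuous_on ?B (P' n P i a)" for i a
        by (rule continuous_on_eq[OF radial_primitive(2)[of x0 r "\<lambda>j. u n j a" "V a", OF du cV] eq])
      moreover have "(Fs (Suc n) a has_derivative (\<lambda>h. \<Sum>i\<in>UNIV. h $ i * P' n P i a x)) (at x)" if "x \<in> ?B" for a x
        using has_derivative_add[OF has_derivative_const radial_primitive(1)[of x0 r "\<lambda>j. u n j a" "V a", OF du cV that], of "F0 a"]
          eq[OF that] by (simp add: FsS[abs_def])
      ultimately show ?thesis by (auto simp: C1_def)
    qed
    have init: "C1 0 (\<lambda>i a x. 0)" by (simp add: C1_def Fs0[abs_def])
    have "\<exists>P. C1 n P" for n by (induction n) (use init step in blast)+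
    then have cF: "continuous_on ?B (Fs n a)" for n a using cFs by blast
    then have cu: "continuous_on ?B (u n i a)" for n i a
      unfolding u_def by (intro continuous_intros cA)
    have scale: "r * (?N * (?L * (K * W))) \<le> W / 4" if "W \<ge> 0" for W
      using mult_right_mono[OF small that] by (simp add: mult_ac)
    define c where "c = (\<Sum>a\<in>UNIV. \<bar>F0 a\<bar>)"
    have c: "\<bar>F0 a\<bar> \<le> c" for a unfolding c_def by (rule member_le_sum) auto
    have "c \<ge> 0" unfolding c_def by (simp add: sum_nonneg)
    have radial: "\<bar>integral {0..1} (\<lambda>t. \<Sum>j\<in>UNIV. (x - x0) $ j * w j (?q x t))\<bar> \<le> W / 4"
      if x: "x \<in> ?B" and w: "\<And>j. continuous_on ?B (w j)" "\<And>j y. y \<in> ?B \<Longrightarrow> \<bar>w j y\<bar> \<le> ?L * (K * W)" and "W \<ge> 0"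
      for x w W
    proof -
      have "norm (integral {0..1} (\<lambda>t. \<Sum>j\<in>UNIV. (x - x0) $ j * w j (?q x t))) \<le> W / 4 * (1 - 0)"
      proof (rule integral_bound)
        show "continuous_on {0..1} (\<lambda>t. \<Sum>j\<in>UNIV. (x - x0) $ j * w j (?q x t))"
          by (intro continuous_intros cq[OF w(1) x])
        fix t :: real assume "t \<in> {0..1}"
        then have "\<bar>(x - x0) $ j * w j (?q x t)\<bar> \<le> r * (?L * (K * W))" for j
          unfolding abs_mult using comp[OF x] w(2)[OF qB[OF x]] \<open>r > 0\<close> by (intro mult_mono) auto
        then have "\<bar>\<Sum>j\<in>UNIV. (x - x0) $ j * w j (?q x t)\<bar> \<le> ?N * (r * (?L * (K * W)))"
          by (rule abs_sum_UNIV_le)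
        then show "norm (\<Sum>j\<in>UNIV. (x - x0) $ j * w j (?q x t)) \<le> W / 4"
          using scale[OF \<open>W \<ge> 0\<close>] by (simp add: mult_ac)
      qed simp
      then show ?thesis by simp
    qed
    have d: "\<forall>a. \<forall>x\<in>?B. \<bar>Fs (Suc n) a x - Fs n a x\<bar> \<le> c * (1/2)^n" for n
    proof (induction n)
      case 0
      have "\<bar>Fs (Suc 0) a x - Fs 0 a x\<bar> \<le> c / 4" if "x \<in> ?B" for a x
      proof -
        have "\<bar>u 0 j a y\<bar> \<le> ?L * (K * c)" if "y \<in> ?B" for j y
          unfolding u_def Fs0 using Aw[OF that] c by blast
        from radial[OF that cu this \<open>c \<ge> 0\<close>] show ?thesis by (simp add: FsS Fs0)
      qed
      moreover have "c / 4 \<le> c * (1/2)^0" using \<open>c \<ge> 0\<close> by simp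
      ultimately show ?case by (meson order_trans)
    next
      case (Suc n)
      have "\<bar>Fs (Suc (Suc n)) a x - Fs (Suc n) a x\<bar> \<le> c * (1/2)^n / 4" if x: "x \<in> ?B" for a x
      proof -
        note [continuous_intros] = cq[OF cu x]
        have "integral {0..1} (\<lambda>t. \<Sum>j\<in>UNIV. (x - x0) $ j * (u (Suc n) j a (?q x t) - u n j a (?q x t)))
          = integral {0..1} (\<lambda>t. (\<Sum>j\<in>UNIV. (x - x0) $ j * u (Suc n) j a (?q x t)) - (\<Sum>j\<in>UNIV. (x - x0) $ j * u n j a (?q x t)))"
          by (simp only: right_diff_distrib sum_subtractf)
        also have "\<dots> = integral {0..1} (\<lambda>t. \<Sum>j\<in>UNIV. (x - x0) $ j * u (Suc n) j a (?q x t))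
            - integral {0..1} (\<lambda>t. \<Sum>j\<in>UNIV. (x - x0) $ j * u n j a (?q x t))"
          by (intro integral_diff integrable_continuous_real continuous_intros)
        also have "\<dots> = Fs (Suc (Suc n)) a x - Fs (Suc n) a x"
          unfolding FsS by simp
        finally have *: "Fs (Suc (Suc n)) a x - Fs (Suc n) a x
          = integral {0..1} (\<lambda>t. \<Sum>j\<in>UNIV. (x - x0) $ j * (u (Suc n) j a (?q x t) - u n j a (?q x t)))" ..
        have "\<bar>u (Suc n) j a y - u n j a y\<bar> \<le> ?L * (K * (c * (1/2)^n))" if "y \<in> ?B" for j y
          using Aw[OF that, of "\<lambda>b. Fs (Suc n) b y - Fs n b y"] Suc that
          by (simp add: u_def right_diff_distrib sum_subtractf)
        then show ?thesis
          unfolding * using \<open>c \<ge> 0\<close>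
          by (intro radial[OF x, where w = "\<lambda>j y. u (Suc n) j a y - u n j a y"] continuous_intros cu) auto
      qed
      moreover have "c * (1/2)^n / 4 \<le> c * (1/2)^Suc n" using \<open>c \<ge> 0\<close> by simp
      ultimately show ?case by (meson order_trans)
    qed
    have du: "\<bar>u (Suc n) i a x - u n i a x\<bar> \<le> ?L * (K * (c * (1/2)^n))" if "x \<in> ?B" for n i a x
      using Aw[OF that, of "\<lambda>b. Fs (Suc n) b x - Fs n b x"] d[of n] that
      by (simp add: u_def right_diff_distrib sum_subtractf)
    \<comment> \<open>With the factor 4, the change from \<open>u n\<close> to
      \<open>u (Suc n)\<close> is at most a quarter of M (3/4)^n; the curl integral gives at most
      half of it.\<close>
    define M where "M = 4 * (?L * (K * c))"
    have "M \<ge> 0" using K \<open>c \<ge> 0\<close> by (simp add: M_def)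
    have "\<exists>P. C1 n P \<and> (\<forall>i a. \<forall>x\<in>?B. \<bar>E n P i a x\<bar> \<le> M * (3/4)^n)" for n
    proof (induction n)
      case 0
      have "\<bar>E 0 (\<lambda>i a x. 0) i a x\<bar> \<le> M" if "x \<in> ?B" for i a x
      proof -
        have "\<bar>u 0 i a x\<bar> \<le> ?L * (K * c)"
          using Aw[OF that, of "F0" c] c by (simp add: u_def Fs0)
        also have "\<dots> \<le> M" using K \<open>c \<ge> 0\<close> by (simp add: M_def)
        finally show ?thesis by (simp add: E_def)
      qed
      with init show ?case by (intro exI[of _ "\<lambda>i a x. 0"]) simp
    next
      case (Suc n)
      then obtain P where P: "C1 n P" "\<And>i a x. x \<in> ?B \<Longrightarrow> \<bar>E n P i a x\<bar> \<le> M * (3/4)^n" by blast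
      let ?e = "M * (3/4)^n"
      have "?e \<ge> 0" using \<open>M \<ge> 0\<close> by simp
      have cE: "continuous_on ?B (E n P i a)" for i a
        using P(1) unfolding E_def C1_def by (intro continuous_intros cu) auto
      have "\<bar>E (Suc n) (P' n P) i a x\<bar> \<le> M * (3/4)^Suc n" if x: "x \<in> ?B" for i a x
      proof -
        let ?w = "\<lambda>j y. \<Sum>b\<in>UNIV. A j a b y * E n P i b y - A i a b y * E n P j b y"
        have w: "\<bar>?w j y\<bar> \<le> ?L * (K * (2 * ?e))" if y: "y \<in> ?B" for j y
        proof (rule abs_sum_UNIV_le)
          fix b
          have "\<bar>A j a b y * E n P i b y\<bar> \<le> K * ?e" "\<bar>A i a b y * E n P j b y\<bar> \<le> K * ?e"
            unfolding abs_mult using AK[OF y] P(2)[OF y] K(1) by (intro mult_mono; simp)+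
          then show "\<bar>A j a b y * E n P i b y - A i a b y * E n P j b y\<bar> \<le> K * (2 * ?e)" by linarith
        qed
        have cw: "continuous_on ?B (?w j)" for j by (intro continuous_intros cE cA)
        have "norm (integral {0..1} (\<lambda>t. t * (\<Sum>j\<in>UNIV. (x - x0) $ j * ?w j (?q x t)))) \<le> 2 * ?e / 4 * (1 - 0)"
        proof (rule integral_bound)
          show "continuous_on {0..1} (\<lambda>t. t * (\<Sum>j\<in>UNIV. (x - x0) $ j * ?w j (?q x t)))"
            by (intro continuous_on_mult continuous_on_sum continuous_on_const continuous_on_id cq[OF cw x])
          fix t :: real assume t: "t \<in> {0..1}"
          then have "\<bar>(x - x0) $ j * ?w j (?q x t)\<bar> \<le> r * (?L * (K * (2 * ?e)))" for j
            unfolding abs_mult using comp[OF x] w[OF qB[OF x]] \<open>r > 0\<close> by (intro mult_mono) auto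
          then have "\<bar>\<Sum>j\<in>UNIV. (x - x0) $ j * ?w j (?q x t)\<bar> \<le> ?N * (r * (?L * (K * (2 * ?e))))"
            by (rule abs_sum_UNIV_le)
          also have "\<dots> \<le> 2 * ?e / 4" using scale[of "2 * ?e"] \<open>?e \<ge> 0\<close> by (simp add: mult_ac)
          finally have "\<bar>\<Sum>j\<in>UNIV. (x - x0) $ j * ?w j (?q x t)\<bar> \<le> 2 * ?e / 4" .
          then have "\<bar>t\<bar> * \<bar>\<Sum>j\<in>UNIV. (x - x0) $ j * ?w j (?q x t)\<bar> \<le> 1 * (2 * ?e / 4)"
            using t by (intro mult_mono) auto
          then show "norm (t * (\<Sum>j\<in>UNIV. (x - x0) $ j * ?w j (?q x t))) \<le> 2 * ?e / 4"
            by (simp add: abs_mult)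
        qed simp
        then have "\<bar>P' n P i a x - u n i a x\<bar> \<le> ?e / 2" by (simp add: P'_def)
        moreover have "?L * (K * (c * (1/2)^n)) \<le> ?e / 4"
        proof -
          have "M * (1/2)^n \<le> M * (3/4)^n" using \<open>M \<ge> 0\<close> by (intro mult_left_mono power_mono) auto
          then show ?thesis by (simp add: M_def)
        qed
        moreover have "M * (3/4)^Suc n = 3/4 * ?e" by simp
        ultimately show ?thesis using du[OF x, of n i a] unfolding E_def by linarith
      qed
      then show ?case using step[OF P(1)] by blast
    qed
    then obtain Ps where Ps: "\<And>n. C1 n (Ps n)" "\<And>n i a x. x \<in> ?B \<Longrightarrow> \<bar>E n (Ps n) i a x\<bar> \<le> M * (3/4)^n"
      by metis
    define F where "F a x = lim (\<lambda>n. Fs n a x)" for a x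
    have conv: "(\<lambda>n. Fs n a x) \<longlonglongrightarrow> F a x" "\<bar>F a x - Fs n a x\<bar> \<le> 2 * c * (1/2)^n" if x: "x \<in> ?B" for a x n
    proof -
      have sm: "summable (\<lambda>n. c * (1/2::real)^n)" by (intro summable_mult summable_geometric) simp
      have "summable (\<lambda>n. Fs (Suc n) a x - Fs n a x)"
        by (rule summable_comparison_test'[OF sm, of 0]) (use d x in auto)
      then have "convergent (\<lambda>n. \<Sum>k<n. Fs (Suc k) a x - Fs k a x)"
        by (simp add: summable_iff_convergent)
      from convergent_add[OF this convergent_const[of "Fs 0 a x"]]
      have "convergent (\<lambda>n. Fs n a x)"
        by (simp add: sum_lessThan_telescope[of "\<lambda>n. Fs n a x"])
      then show L: "(\<lambda>n. Fs n a x) \<longlonglongrightarrow> F a x"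
        unfolding F_def by (simp add: convergent_LIMSEQ_iff)
      \<comment> \<open>The right-hand side is the exact partial sum of the geometric series; the
        weaker bound 2 c (1/2)^n alone would not pass through the induction on
        \<open>k\<close>.\<close>
      have "\<bar>Fs (n + k) a x - Fs n a x\<bar> \<le> 2 * c * (1/2)^n - 2 * c * (1/2)^(n+k)" for k
      proof (induction k)
        case (Suc k)
        have "\<bar>Fs (Suc (n + k)) a x - Fs (n + k) a x\<bar> \<le> c * (1/2)^(n+k)" using d x by blast
        then show ?case using Suc by simp
      qed simp
      moreover have "2 * c * (1/2)^(n+k) \<ge> 0" for k using \<open>c \<ge> 0\<close> by simp
      ultimately have "\<bar>Fs (k + n) a x - Fs n a x\<bar> \<le> 2 * c * (1/2)^n" for k
        by (smt (verit) add.commute)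
      moreover have "(\<lambda>k. \<bar>Fs (k + n) a x - Fs n a x\<bar>) \<longlonglongrightarrow> \<bar>F a x - Fs n a x\<bar>"
        by (intro tendsto_intros LIMSEQ_ignore_initial_segment L)
      ultimately show "\<bar>F a x - Fs n a x\<bar> \<le> 2 * c * (1/2)^n"
        by (intro LIMSEQ_le_const2) auto
    qed
    have F: "(F a has_derivative (\<lambda>h. \<Sum>i\<in>UNIV. h $ i *\<^sub>R (\<Sum>b\<in>UNIV. A i a b x * F b x))) (at x)"
      if x: "x \<in> ?B" for a x
    proof -
      let ?g = "\<lambda>x h. \<Sum>i\<in>UNIV. h $ i * (\<Sum>b\<in>UNIV. A i a b x * F b x)"
      \<comment> \<open>Term-by-term differentiation: the derivatives \<open>Ps n\<close> tend
        uniformly to A F, being within the defect of \<open>u n\<close>, which is within a multiple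
        of (1/2)^n of A F.\<close>
      have "\<exists>g. \<forall>x\<in>?B. (\<lambda>n. Fs n a x) \<longlonglongrightarrow> g x \<and> (g has_derivative ?g x) (at x within ?B)"
      proof (rule has_derivative_sequence[where f' = "\<lambda>n x h. \<Sum>i\<in>UNIV. h $ i * Ps n i a x"])
        show "(Fs n a has_derivative (\<lambda>h. \<Sum>i\<in>UNIV. h $ i * Ps n i a x)) (at x within ?B)" if "x \<in> ?B" for n x
          using Ps(1)[of n] that by (auto simp: C1_def intro: has_derivative_at_withinI)
        show "x0 \<in> ?B" using \<open>r > 0\<close> by simp
        then show "(\<lambda>n. Fs n a x0) \<longlonglongrightarrow> F a x0" by (rule conv)
        fix e :: real assume "e > 0"
        let ?b = "\<lambda>n. ?N * (M * (3/4)^n + ?L * (K * (2 * c * (1/2)^n)))"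
        have "(\<lambda>n. ?b n) \<longlonglongrightarrow> ?N * (M * 0 + ?L * (K * (2 * c * 0)))"
          by (intro tendsto_intros) auto
        then have "\<forall>\<^sub>F n in sequentially. ?b n < e"
          using \<open>e > 0\<close> by (intro order_tendstoD(2)) auto
        then show "\<forall>\<^sub>F n in sequentially. \<forall>x\<in>?B. \<forall>h. norm ((\<Sum>i\<in>UNIV. h $ i * Ps n i a x) - ?g x h) \<le> e * norm h"
        proof eventually_elim
          case (elim n)
          have "norm ((\<Sum>i\<in>UNIV. h $ i * Ps n i a x) - ?g x h) \<le> e * norm h" if x: "x \<in> ?B" for x h
          proof -
            have 1: "\<bar>Ps n i a x - (\<Sum>b\<in>UNIV. A i a b x * F b x)\<bar> \<le> M * (3/4)^n + ?L * (K * (2 * c * (1/2)^n))" for i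
            proof -
              have "\<bar>(\<Sum>b\<in>UNIV. A i a b x * F b x) - u n i a x\<bar> \<le> ?L * (K * (2 * c * (1/2)^n))"
                using Aw[OF x, of "\<lambda>b. F b x - Fs n b x"] conv(2)[OF x]
                by (simp add: u_def right_diff_distrib sum_subtractf)
              then show ?thesis using Ps(2)[OF x, of n i a] unfolding E_def by linarith
            qed
            have "\<bar>h $ i * (Ps n i a x - (\<Sum>b\<in>UNIV. A i a b x * F b x))\<bar>
                \<le> norm h * (M * (3/4)^n + ?L * (K * (2 * c * (1/2)^n)))" for i
              unfolding abs_mult using component_le_norm_cart[of h i] 1 by (intro mult_mono) auto
            then have "\<bar>\<Sum>i\<in>UNIV. h $ i * (Ps n i a x - (\<Sum>b\<in>UNIV. A i a b x * F b x))\<bar>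
                \<le> ?N * (norm h * (M * (3/4)^n + ?L * (K * (2 * c * (1/2)^n))))"
              by (rule abs_sum_UNIV_le)
            also have "\<dots> = ?b n * norm h" by (simp add: mult_ac)
            also have "\<dots> \<le> e * norm h" using elim by (intro mult_right_mono) auto
            finally show ?thesis by (simp add: right_diff_distrib sum_subtractf)
          qed
          then show ?case by blast
        qed
      qed simp
      then obtain g where g: "\<And>x. x \<in> ?B \<Longrightarrow> (\<lambda>n. Fs n a x) \<longlonglongrightarrow> g x"
        "\<And>x. x \<in> ?B \<Longrightarrow> (g has_derivative ?g x) (at x within ?B)" by blast
      have "g y = F a y" if "y \<in> ?B" for y using LIMSEQ_unique[OF g(1) conv(1)] that by blast
      then show ?thesis
        using has_derivative_transform_within_open[of g "?g x" x UNIV ?B "F a"] g(2)[OF x]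
          at_within_open[OF x open_ball] x by simp
    qed
    have P: "partial i (F a) x = (\<Sum>b\<in>UNIV. A i a b x * F b x)" if "x \<in> ?B" for i a x
      by (rule partial_of_sum_form[OF F[OF that]])
    moreover have "smooth_on ?B (F a)" for a
    proof (rule smooth_on_linear_system[where A = A])
      show "F a differentiable (at x)" if "x \<in> ?B" for a x
        unfolding differentiable_def using F[OF that] by blast
    qed (use smooth_on_subset[OF A BS(1)] P in auto)
    moreover have "F a x0 = F0 a" for a
    proof -
      have "Fs n a x0 = F0 a" for n by (cases n) (simp_all add: Fs0 FsS)
      then show ?thesis by (simp add: F_def)
    qed
    ultimately show ?thesis by blast
  qed
  with that \<open>r > 0\<close> BS(1) show ?thesis by blast
qed

section \<open>Metrics on open subsets of Euclidean space\<close>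

lemma sum_delta_mult:
  fixes f :: "'n::finite \<Rightarrow> real"
  shows "(\<Sum>k\<in>UNIV. (if i = k then 1 else 0) * f k) = f i"
    and "(\<Sum>k\<in>UNIV. (if k = i then 1 else 0) * f k) = f i"
    and "(\<Sum>k\<in>UNIV. f k * (if i = k then 1 else 0)) = f i"
    and "(\<Sum>k\<in>UNIV. f k * (if k = i then 1 else 0)) = f i"
  by (simp_all add: if_distrib[of "\<lambda>t. t * _"] if_distrib[of "\<lambda>t. _ * t"] cong: if_cong)

lemma matrix_inv_right: "A ** matrix_inv A = mat 1"
  and matrix_inv_left: "matrix_inv A ** A = mat 1" if "invertible A"
proof -
  have "A ** matrix_inv A = mat 1 \<and> matrix_inv A ** A = mat 1"
    using that unfolding invertible_def matrix_inv_def by (rule someI_ex)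
  then show "A ** matrix_inv A = mat 1" "matrix_inv A ** A = mat 1" by blast+
qed

text \<open>By Cramer's rule every entry of the inverse is a quotient of determinants, and
  determinants are polynomials in the entries.\<close>

lemma smooth_on_matrix_inv:
  fixes h :: "real^'n::finite \<Rightarrow> real^'m::finite^'m"
  assumes "open S" "smooth_on S h" "\<And>x. x \<in> S \<Longrightarrow> invertible (h x)"
  shows "smooth_on S (\<lambda>x. matrix_inv (h x) $ i $ j)"
proof -
  have sm: "smooth_on S (\<lambda>x. h x $ a $ b)" for a b
    using smooth_on_component[OF assms(1) smooth_on_component[OF assms(1,2)]] .
  have det: "smooth_on S (\<lambda>x. det (k x))" if "\<And>a b. smooth_on S (\<lambda>x. k x $ a $ b)" for k :: "real^'n \<Rightarrow> real^'m^'m"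
    unfolding det_def
    by (intro smooth_on_sum smooth_on_mult smooth_on_prod smooth_on_const assms(1) that)
  have "smooth_on S (\<lambda>x. det (\<chi> a b. if b = i then axis j 1 $ a else h x $ a $ b) / det (h x))"
  proof (intro smooth_on_divide det assms(1) sm)
    show "smooth_on S (\<lambda>x. (\<chi> a b. if b = i then axis j 1 $ a else h x $ a $ b) $ a $ b)" for a b
      by (cases "b = i") (auto intro: sm smooth_on_const)
    show "det (h x) \<noteq> 0" if "x \<in> S" for x using assms(3)[OF that] invertible_det_nz by blast
  qed
  moreover have "matrix_inv (h x) $ i $ j = det (\<chi> a b. if b = i then axis j 1 $ a else h x $ a $ b) / det (h x)"
    if "x \<in> S" for x
  proof -
    have "h x *v (matrix_inv (h x) *v axis j 1) = axis j 1"
      using assms(3)[OF that] by (simp add: matrix_vector_mul_assoc matrix_inv_right)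
    then have "matrix_inv (h x) *v axis j 1 =
        (\<chi> k. det (\<chi> a b. if b = k then axis j 1 $ a else h x $ a $ b) / det (h x))"
      using cramer[of "h x"] assms(3)[OF that] invertible_det_nz by blast
    moreover have "matrix_inv (h x) $ i $ j = (matrix_inv (h x) *v axis j 1) $ i"
      by (simp add: matrix_vector_mul_component inner_axis)
    ultimately show ?thesis by simp
  qed
  ultimately show ?thesis using smooth_on_cong[OF assms(1)] by (metis (no_types, lifting))
qed

text \<open>Symmetry and positivity are required on \<open>S\<close> only, because the matrix of a
  Riemannian metric in a chart is arbitrary off the chart image. Identities between coefficients are
  therefore differentiated by means of \<open>partial_cong\<close>.\<close>

locale local_metric =
  fixes g :: "('n::finite) metric_field" and S :: "(real^'n) set"
  assumes open_S: "open S"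
    and smooth_g: "smooth_on S g"
    and transpose_g: "x \<in> S \<Longrightarrow> transpose (g x) = g x"
    and pos_g: "x \<in> S \<Longrightarrow> v \<noteq> 0 \<Longrightarrow> v \<bullet> (g x *v v) > 0"
begin

abbreviation "G i j \<equiv> (\<lambda>x. g x $ i $ j)"
abbreviation "H \<equiv> ginv g"
abbreviation "\<Gamma> \<equiv> christoffel g"
abbreviation "R \<equiv> riemann g"

lemma G_sym: "x \<in> S \<Longrightarrow> G i j x = G j i x"
  using transpose_g[of x] by (auto simp: transpose_def vec_eq_iff)

lemma invertible_g: "x \<in> S \<Longrightarrow> invertible (g x)"
proof -
  assume x: "x \<in> S"
  then have "\<forall>v. g x *v v = 0 \<longrightarrow> v = 0" using pos_g[OF x] by fastforce
  then obtain B where "B ** g x = mat 1" using matrix_left_invertible_ker by blast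
  then show ?thesis using invertible_left_inverse by blast
qed

lemma HG: "x \<in> S \<Longrightarrow> (\<Sum>k\<in>UNIV. H i k x * G k j x) = (if i = j then 1 else 0)"
proof -
  assume "x \<in> S"
  then have "(matrix_inv (g x) ** g x) $ i $ j = (mat 1 :: real^'n^'n) $ i $ j"
    by (simp add: matrix_inv_left invertible_g)
  then show ?thesis by (simp add: matrix_matrix_mult_def mat_def ginv_def)
qed

lemma GH: "x \<in> S \<Longrightarrow> (\<Sum>k\<in>UNIV. G i k x * H k j x) = (if i = j then 1 else 0)"
proof -
  assume "x \<in> S"
  then have "(g x ** matrix_inv (g x)) $ i $ j = (mat 1 :: real^'n^'n) $ i $ j"
    by (simp add: matrix_inv_right invertible_g)
  then show ?thesis by (simp add: matrix_matrix_mult_def mat_def ginv_def)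
qed

lemma H_sym: "x \<in> S \<Longrightarrow> H i j x = H j i x"
proof -
  assume x: "x \<in> S"
  \<comment> \<open>Both sides are entries of H G H^T, bracketed in two ways.\<close>
  have "(\<Sum>k\<in>UNIV. (\<Sum>l\<in>UNIV. H i l x * G l k x) * H j k x) = (\<Sum>l\<in>UNIV. H i l x * (\<Sum>k\<in>UNIV. H j k x * G k l x))"
    unfolding sum_distrib_left sum_distrib_right
    by (subst sum.swap) (simp add: mult_ac G_sym[OF x])
  then show ?thesis by (simp add: HG[OF x] sum_delta_mult)
qed

lemma smooth_G: "smooth_on S (G i j)"
  using smooth_on_component[OF open_S smooth_on_component[OF open_S smooth_g]] .

lemma smooth_H: "smooth_on S (H i j)"
  using smooth_on_matrix_inv[OF open_S smooth_g invertible_g] by (simp add: ginv_def[abs_def])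

lemma smooth_\<Gamma>: "smooth_on S (\<Gamma> k i j)"
proof -
  have "smooth_on S (\<lambda>x. (\<Sum>l\<in>UNIV. H k l x * (partial i (G j l) x + partial j (G i l) x - partial l (G i j) x)) / 2)"
    by (intro smooth_on_divide smooth_on_sum smooth_on_mult smooth_on_add smooth_on_diff smooth_on_const
        smooth_on_partial smooth_G smooth_H open_S) simp
  then show ?thesis by (simp add: christoffel_def[abs_def])
qed

lemmas smooth_intros = smooth_on_sum smooth_on_mult smooth_on_add smooth_on_diff smooth_on_minus smooth_on_const
  smooth_on_partial smooth_G smooth_H smooth_\<Gamma> open_S

lemma \<Gamma>_sym: "x \<in> S \<Longrightarrow> \<Gamma> k i j x = \<Gamma> k j i x"
  unfolding christoffel_def
  using partial_cong[OF open_S, of x "G i j" "G j i"] G_sym by (simp add: add.commute)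

lemma \<Gamma>_lower:
  assumes x: "x \<in> S"
  shows "(\<Sum>m\<in>UNIV. G b m x * \<Gamma> m k a x) =
      (partial k (G a b) x + partial a (G k b) x - partial b (G k a) x) / 2"
proof -
  define h where "h l = (partial k (G a l) x + partial a (G k l) x - partial l (G k a) x) / 2" for l
  have "(\<Sum>m\<in>UNIV. G b m x * \<Gamma> m k a x) = (\<Sum>m\<in>UNIV. \<Sum>l\<in>UNIV. G b m x * H m l x * h l)"
    unfolding christoffel_def h_def
    by (simp add: sum_distrib_right sum_distrib_left sum_divide_distrib mult_ac)
  also have "\<dots> = (\<Sum>l\<in>UNIV. (\<Sum>m\<in>UNIV. G b m x * H m l x) * h l)"
    by (subst sum.swap) (simp add: sum_distrib_right)
  finally show ?thesis by (simp only: GH[OF x] sum_delta_mult) (simp add: h_def)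
qed

lemma partial_G:
  assumes x: "x \<in> S"
  shows "partial k (G i j) x = (\<Sum>m\<in>UNIV. \<Gamma> m k i x * G m j x) + (\<Sum>m\<in>UNIV. \<Gamma> m k j x * G i m x)"
proof -
  have "partial l (G a b) x = partial l (G b a) x" for l a b
    by (rule partial_cong[OF open_S x]) (rule G_sym)
  moreover have "(\<Sum>m\<in>UNIV. \<Gamma> m k i x * G m j x) = (\<Sum>m\<in>UNIV. G j m x * \<Gamma> m k i x)"
    using G_sym[OF x] by (metis (no_types) mult.commute)
  moreover have "(\<Sum>m\<in>UNIV. \<Gamma> m k j x * G i m x) = (\<Sum>m\<in>UNIV. G i m x * \<Gamma> m k j x)"
    by (metis (no_types) mult.commute)
  ultimately show ?thesis unfolding \<Gamma>_lower[OF x] by (simp add: field_simps)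
qed

text \<open>Uniqueness of the Levi-Civita connection: inserting metric compatibility into the
  definition of the Christoffel symbols, symmetry cancels all terms but one. It serves to recognise
  the symbols of a metric given in terms of other coordinates.\<close>

lemma \<Gamma>_unique:
  assumes x: "x \<in> S"
    and sym: "\<And>m i j. B m i j = B m j i"
    and compat: "\<And>k i j. partial k (G i j) x = (\<Sum>m\<in>UNIV. B m k i * G m j x) + (\<Sum>m\<in>UNIV. B m k j * G i m x)"
  shows "\<Gamma> m i j x = B m i j"
proof -
  define b where "b i j l = (\<Sum>m\<in>UNIV. B m i j * G m l x)" for i j l
  have c: "partial k (G i j) x = b k i j + b k j i" for k i j
    unfolding b_def using compat[of k i j] G_sym[OF x] by simp
  have s: "b i j l = b j i l" for i j l unfolding b_def using sym by simp
  have "\<Gamma> m i j x = (\<Sum>l\<in>UNIV. H m l x * b i j l)"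
    unfolding christoffel_def c using s by (simp add: sum_divide_distrib)
  also have "\<dots> = (\<Sum>a\<in>UNIV. (\<Sum>l\<in>UNIV. H m l x * G l a x) * B a i j)"
    unfolding b_def sum_distrib_left sum_distrib_right
    by (subst sum.swap) (simp add: mult_ac G_sym[OF x])
  finally show ?thesis by (simp add: HG[OF x] sum_delta_mult)
qed

subsection \<open>Symmetries of the curvature tensor and the second Bianchi identity\<close>

text \<open>The component along the m-th coordinate field of the covariant derivative, first in
  direction \<open>j\<close> and then in direction \<open>i\<close>, of the l-th coordinate field.
  Antisymmetrising in \<open>i\<close> and \<open>j\<close> gives the curvature with one raised
  index.\<close>

definition half_curv :: "'n \<Rightarrow> 'n \<Rightarrow> 'n \<Rightarrow> 'n \<Rightarrow> real^'n \<Rightarrow> real" where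
  "half_curv i j m l x = partial i (\<Gamma> m j l) x + (\<Sum>p\<in>UNIV. \<Gamma> m i p x * \<Gamma> p j l x)"

definition curv :: "'n \<Rightarrow> 'n \<Rightarrow> 'n \<Rightarrow> 'n \<Rightarrow> real^'n \<Rightarrow> real" where
  "curv i j m l x = half_curv i j m l x - half_curv j i m l x"

lemma riemann_curv: "R i j k l x = (\<Sum>m\<in>UNIV. G k m x * curv i j m l x)"
  unfolding riemann_def curv_def half_curv_def by (simp add: sum_subtractf algebra_simps)

lemma smooth_curv: "smooth_on S (curv i j m l)"
  unfolding curv_def[abs_def] half_curv_def by (intro smooth_intros)

lemma smooth_R: "smooth_on S (R i j k l)"
  unfolding riemann_curv[abs_def] by (intro smooth_intros smooth_curv)

lemma differentiable:
  "x \<in> S \<Longrightarrow> G i j differentiable (at x)" "x \<in> S \<Longrightarrow> H i j differentiable (at x)"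
  "x \<in> S \<Longrightarrow> \<Gamma> k i j differentiable (at x)" "x \<in> S \<Longrightarrow> curv i j k l differentiable (at x)"
  "x \<in> S \<Longrightarrow> R i j k l differentiable (at x)" "x \<in> S \<Longrightarrow> partial p (\<Gamma> k i j) differentiable (at x)"
  by (auto intro!: smooth_on_imp_differentiable[where S = S] smooth_intros smooth_curv smooth_R)

lemma R_anti12: "R j i k l x = - R i j k l x"
  unfolding riemann_curv curv_def by (simp add: right_diff_distrib sum_subtractf)

text \<open>Metric compatibility differentiated once more. The two \<open>M\<close> terms are
  exchanged by swapping \<open>i\<close> and \<open>j\<close>, so commuting the partial derivatives
  leaves only curvature; this gives the antisymmetry in the last pair.\<close>

lemma partial_partial_G:
  assumes x: "x \<in> S"
  defines "M \<equiv> \<lambda>i j k l. \<Sum>m\<in>UNIV. \<Sum>p\<in>UNIV. \<Gamma> m i k x * \<Gamma> p j l x * G m p x"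
  shows "partial j (partial i (G k l)) x =
    (\<Sum>p\<in>UNIV. half_curv j i p k x * G p l x) + (\<Sum>p\<in>UNIV. half_curv j i p l x * G k p x) + M i j k l + M j i k l"
proof -
  have "partial j (partial i (G k l)) x =
    partial j (\<lambda>x. (\<Sum>m\<in>UNIV. \<Gamma> m i k x * G m l x) + (\<Sum>m\<in>UNIV. \<Gamma> m i l x * G k m x)) x"
    by (rule partial_cong[OF open_S x]) (rule partial_G)
  also have "\<dots> = (\<Sum>m\<in>UNIV. partial j (\<Gamma> m i k) x * G m l x + \<Gamma> m i k x * partial j (G m l) x)
     + (\<Sum>m\<in>UNIV. partial j (\<Gamma> m i l) x * G k m x + \<Gamma> m i l x * partial j (G k m) x)"
    using differentiable[OF x] by (simp add: partial_add partial_sum partial_mult)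
  also have "(\<Sum>m\<in>UNIV. partial j (\<Gamma> m i k) x * G m l x + \<Gamma> m i k x * partial j (G m l) x)
     = (\<Sum>p\<in>UNIV. half_curv j i p k x * G p l x) + M i j k l"
  proof -
    have "(\<Sum>m\<in>UNIV. \<Gamma> m i k x * (\<Sum>p\<in>UNIV. \<Gamma> p j m x * G p l x)) = (\<Sum>p\<in>UNIV. (\<Sum>m\<in>UNIV. \<Gamma> p j m x * \<Gamma> m i k x) * G p l x)"
      unfolding sum_distrib_left sum_distrib_right by (subst sum.swap) (simp add: mult_ac)
    then show ?thesis
      unfolding partial_G[OF x] half_curv_def M_def
      by (simp add: distrib_left distrib_right sum.distrib sum_distrib_left mult_ac)
  qed
  also have "(\<Sum>m\<in>UNIV. partial j (\<Gamma> m i l) x * G k m x + \<Gamma> m i l x * partial j (G k m) x)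
     = (\<Sum>p\<in>UNIV. half_curv j i p l x * G k p x) + M j i k l"
  proof -
    have "(\<Sum>m\<in>UNIV. \<Gamma> m i l x * (\<Sum>p\<in>UNIV. \<Gamma> p j m x * G k p x)) = (\<Sum>p\<in>UNIV. (\<Sum>m\<in>UNIV. \<Gamma> p j m x * \<Gamma> m i l x) * G k p x)"
      unfolding sum_distrib_left sum_distrib_right by (subst sum.swap) (simp add: mult_ac)
    moreover have "(\<Sum>m\<in>UNIV. \<Gamma> m i l x * (\<Sum>p\<in>UNIV. \<Gamma> p j k x * G p m x)) = M j i k l"
      unfolding M_def sum_distrib_left by (subst sum.swap) (simp add: mult_ac)
    ultimately show ?thesis
      unfolding partial_G[OF x] half_curv_def
      by (simp add: distrib_left distrib_right sum.distrib)
  qed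
  finally show ?thesis by simp
qed

lemma R_anti34:
  assumes x: "x \<in> S"
  shows "R i j l k x = - R i j k l x"
proof -
  have "(\<Sum>p\<in>UNIV. curv i j p k x * G p l x) + (\<Sum>p\<in>UNIV. curv i j p l x * G k p x) = 0"
    using partial_commute[OF open_S x smooth_G, of i j k l]
    unfolding partial_partial_G[OF x] curv_def
    by (simp add: left_diff_distrib sum_subtractf)
  then show ?thesis
    unfolding riemann_curv using G_sym[OF x] by (simp add: mult.commute)
qed

text \<open>Symmetry of the Christoffel symbols makes \<open>half_curv\<close> symmetric in its
  second and last index, so the six terms of the cyclic sum over \<open>i\<close>, \<open>j\<close>,
  \<open>l\<close> cancel in pairs.\<close>

lemma R_bianchi1:
  assumes x: "x \<in> S"
  shows "R i j k l x + R j l k i x + R l i k j x = 0"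
proof -
  have p: "partial i (\<Gamma> m j l) x = partial i (\<Gamma> m l j) x" for i j l m
    by (rule partial_cong[OF open_S x]) (rule \<Gamma>_sym)
  have "half_curv i j m l x = half_curv i l m j x" for i j l m
    unfolding half_curv_def using p \<Gamma>_sym[OF x] by simp
  then have "curv i j m l x + curv j l m i x + curv l i m j x = 0" for m
    unfolding curv_def by simp
  then show ?thesis
    unfolding riemann_curv sum.distrib[symmetric] distrib_left[symmetric] by simp
qed

text \<open>Pure linear algebra: four instances of the first Bianchi identity combined with the two
  antisymmetries.\<close>

lemma R_pair:
  assumes x: "x \<in> S"
  shows "R i j k l x = R k l i j x"
  using R_bianchi1[OF x, of i j k l] R_bianchi1[OF x, of j k l i] R_bianchi1[OF x, of k l i j]
    R_bianchi1[OF x, of l i j k]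
    R_anti12 R_anti34[OF x]
  by (smt (verit))

lemma ricci_sym:
  assumes x: "x \<in> S"
  shows "ricci g i k x = ricci g k i x"
  unfolding ricci_def using R_pair[OF x] H_sym[OF x]
  by (subst sum.swap) simp

lemma smooth_ricci: "smooth_on S (ricci g i k)"
  unfolding ricci_def[abs_def] by (intro smooth_intros smooth_R)

lemma smooth_scalar: "smooth_on S (scalar_curvature g)"
  unfolding scalar_curvature_def[abs_def] by (intro smooth_intros smooth_ricci)

text \<open>The identity dK + [\<Gamma>, K] = 0 for the curvature K of the connection form \<Gamma>.
  In \<open>X\<close> and \<open>Y\<close> the derivative falls on the left or right factor of a
  product, \<open>Z\<close> has three factors and no derivative; all of them cancel cyclically, and
  the second derivatives of \<Gamma> do so because partial derivatives commute.\<close>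

lemma curv_bianchi2:
  assumes x: "x \<in> S"
  defines "B \<equiv> \<lambda>k i j m b. partial k (curv i j m b) x + (\<Sum>p\<in>UNIV. \<Gamma> m k p x * curv i j p b x)
      - (\<Sum>p\<in>UNIV. curv i j m p x * \<Gamma> p k b x)"
  shows "B k i j m b + B i j k m b + B j k i m b = 0"
proof -
  define X where "X k i j = (\<Sum>p\<in>UNIV. partial k (\<Gamma> m i p) x * \<Gamma> p j b x)" for k i j
  define Y where "Y k i j = (\<Sum>p\<in>UNIV. \<Gamma> m i p x * partial k (\<Gamma> p j b) x)" for k i j
  define Z where "Z k i j = (\<Sum>p\<in>UNIV. \<Sum>q\<in>UNIV. \<Gamma> m k p x * \<Gamma> p i q x * \<Gamma> q j b x)" for k i j
  have 1: "partial k (half_curv i j m b) x = partial k (partial i (\<Gamma> m j b)) x + X k i j + Y k i j" for k i j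
    unfolding half_curv_def[abs_def] X_def Y_def using differentiable[OF x]
    by (simp add: partial_add partial_sum partial_mult sum.distrib)
  have 2: "(\<Sum>p\<in>UNIV. \<Gamma> m k p x * half_curv i j p b x) = Y i k j + Z k i j" for k i j
    unfolding half_curv_def X_def Y_def Z_def
    by (simp add: distrib_left sum.distrib sum_distrib_left mult_ac)
  have 3: "(\<Sum>p\<in>UNIV. half_curv i j m p x * \<Gamma> p k b x) = X i j k + Z i j k" for k i j
  proof -
    have "(\<Sum>p\<in>UNIV. (\<Sum>q\<in>UNIV. \<Gamma> m i q x * \<Gamma> q j p x) * \<Gamma> p k b x) = Z i j k"
      unfolding Z_def sum_distrib_right by (subst sum.swap) simp
    then show ?thesis unfolding half_curv_def X_def by (simp add: distrib_right sum.distrib)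
  qed
  have d: "half_curv i j m b differentiable (at x)" for i j
    unfolding half_curv_def[abs_def] by (intro smooth_on_imp_differentiable[OF _ x] smooth_intros)
  have 4: "partial k (curv i j m b) x = partial k (half_curv i j m b) x - partial k (half_curv j i m b) x" for k i j
    unfolding curv_def[abs_def] by (intro partial_diff d)
  have c: "partial k (partial i (\<Gamma> m j b)) x = partial i (partial k (\<Gamma> m j b)) x" for k i j
    by (rule partial_commute[OF open_S x smooth_\<Gamma>])
  have "B k i j m b = (partial k (partial i (\<Gamma> m j b)) x + X k i j + Y k i j)
      - (partial k (partial j (\<Gamma> m i b)) x + X k j i + Y k j i)
      + ((Y i k j + Z k i j) - (Y j k i + Z k j i)) - ((X i j k + Z i j k) - (X j i k + Z j i k))" for k i j
    unfolding B_def 4 1 curv_def right_diff_distrib left_diff_distrib sum_subtractf 2 3 ..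
  then show ?thesis
    using c[of k i j] c[of i j k] c[of j k i] by simp
qed

text \<open>\<open>D\<close> is the covariant derivative without the connection terms of the first
  two indices; those cancel in the cyclic sum, since \<Gamma> is symmetric and \<open>R\<close>
  antisymmetric. Lowering the index of \<open>curv_bianchi2\<close> costs nothing because the metric
  is parallel.\<close>

lemma R_bianchi2:
  assumes x: "x \<in> S"
  defines "D \<equiv> \<lambda>k i j a b. partial k (R i j a b) x - (\<Sum>p\<in>UNIV. \<Gamma> p k a x * R i j p b x)
      - (\<Sum>p\<in>UNIV. \<Gamma> p k b x * R i j a p x)"
  shows "D k i j a b + D i j k a b + D j k i a b = 0"
proof -
  have D: "D k i j a b = (\<Sum>m\<in>UNIV. G a m x * (partial k (curv i j m b) x + (\<Sum>p\<in>UNIV. \<Gamma> m k p x * curv i j p b x)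
      - (\<Sum>p\<in>UNIV. curv i j m p x * \<Gamma> p k b x)))" for k i j
  proof -
    have "partial k (R i j a b) x = (\<Sum>m\<in>UNIV. partial k (G a m) x * curv i j m b x) + (\<Sum>m\<in>UNIV. G a m x * partial k (curv i j m b) x)"
      unfolding riemann_curv[abs_def] using differentiable[OF x]
      by (simp add: partial_sum partial_mult sum.distrib)
    also have "(\<Sum>m\<in>UNIV. partial k (G a m) x * curv i j m b x) =
       (\<Sum>m\<in>UNIV. (\<Sum>p\<in>UNIV. \<Gamma> p k a x * G p m x) * curv i j m b x) + (\<Sum>m\<in>UNIV. (\<Sum>p\<in>UNIV. \<Gamma> p k m x * G a p x) * curv i j m b x)"
      unfolding partial_G[OF x] by (simp add: distrib_right sum.distrib)
    also have "(\<Sum>m\<in>UNIV. (\<Sum>p\<in>UNIV. \<Gamma> p k a x * G p m x) * curv i j m b x) = (\<Sum>p\<in>UNIV. \<Gamma> p k a x * R i j p b x)"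
      unfolding riemann_curv sum_distrib_left sum_distrib_right by (subst sum.swap) (simp add: mult_ac)
    also have "(\<Sum>m\<in>UNIV. (\<Sum>p\<in>UNIV. \<Gamma> p k m x * G a p x) * curv i j m b x) = (\<Sum>m\<in>UNIV. G a m x * (\<Sum>p\<in>UNIV. \<Gamma> m k p x * curv i j p b x))"
      unfolding sum_distrib_left sum_distrib_right by (subst sum.swap) (simp add: mult_ac)
    finally have "D k i j a b = (\<Sum>m\<in>UNIV. G a m x * (\<Sum>p\<in>UNIV. \<Gamma> m k p x * curv i j p b x)) + (\<Sum>m\<in>UNIV. G a m x * partial k (curv i j m b) x)
       - (\<Sum>p\<in>UNIV. \<Gamma> p k b x * R i j a p x)"
      unfolding D_def by simp
    also have "(\<Sum>p\<in>UNIV. \<Gamma> p k b x * R i j a p x) = (\<Sum>m\<in>UNIV. G a m x * (\<Sum>p\<in>UNIV. curv i j m p x * \<Gamma> p k b x))"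
      unfolding riemann_curv sum_distrib_left by (subst sum.swap) (simp add: mult_ac)
    finally show ?thesis by (simp add: right_diff_distrib distrib_left sum_subtractf sum.distrib)
  qed
  show ?thesis
    unfolding D sum.distrib[symmetric] distrib_left[symmetric] using curv_bianchi2[OF x] by simp
qed

end

section \<open>The Weyl and Cotton tensors\<close>

lemma sum_inverse_commute:
  fixes X :: "'n::finite \<Rightarrow> 'n \<Rightarrow> real"
  assumes "\<And>a c. (\<Sum>i\<in>UNIV. X a i * Y i c) = (if a = c then 1 else 0)"
  shows "(\<Sum>a\<in>UNIV. Y i a * X a j) = (if i = j then 1 else 0)"
proof -
  let ?X = "\<chi> a i. X a i" and ?Y = "\<chi> i a. Y i a"
  have "?X ** ?Y = mat 1" using assms by (simp add: matrix_matrix_mult_def mat_def vec_eq_iff)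
  then have "?Y ** ?X = mat 1" using matrix_left_right_inverse by blast
  then have "(?Y ** ?X) $ i $ j = (mat 1 :: real^'n^'n) $ i $ j" by simp
  then show ?thesis by (simp add: matrix_matrix_mult_def mat_def)
qed

text \<open>Each new vector exists by counting dimensions: at most three linear conditions on real^4
  have a nonzero common solution. Rescaling comes last, so that \<open>e 1\<close> remains a
  multiple of \<open>v\<close>.\<close>

lemma orthonormal_frame_4:
  fixes g :: "real^4^4"
  assumes sym: "transpose g = g" and pos: "\<And>v. v \<noteq> 0 \<Longrightarrow> v \<bullet> (g *v v) > 0" and v: "v \<noteq> 0"
  obtains e :: "4 \<Rightarrow> real^4" and c where "e 1 = c *\<^sub>R v"
    "\<And>a b. e a \<bullet> (g *v e b) = (if a = b then 1 else 0)"
proof -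
  have comm: "x \<bullet> (g *v y) = y \<bullet> (g *v x)" for x y
  proof -
    have "x \<bullet> (g *v y) = (x v* g) \<bullet> y" by (simp add: dot_lmul_matrix)
    also have "x v* g = g *v x" using vector_transpose_matrix[of x g] sym by simp
    also have "(g *v x) \<bullet> y = y \<bullet> (g *v x)" by (rule inner_commute)
    finally show ?thesis .
  qed
  have ex: "\<exists>b. b \<noteq> 0 \<and> (\<forall>y\<in>set xs. b \<bullet> y = 0)" if "length xs \<le> 3" for xs :: "(real^4) list"
  proof -
    have "dim (set xs) < DIM(real^4)"
      using dim_le_card'[of "set xs"] card_length[of xs] that by simp
    from orthogonal_to_subspace_exists[OF this] obtain b
      where "b \<noteq> 0" "\<And>y. y \<in> span (set xs) \<Longrightarrow> orthogonal b y" by blast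
    then show ?thesis unfolding orthogonal_def using span_base by blast
  qed
  obtain b2 where b2: "b2 \<noteq> 0" "b2 \<bullet> (g *v v) = 0"
    using ex[of "[g *v v]"] by auto
  obtain b3 where b3: "b3 \<noteq> 0" "b3 \<bullet> (g *v v) = 0" "b3 \<bullet> (g *v b2) = 0"
    using ex[of "[g *v v, g *v b2]"] by auto
  obtain b4 where b4: "b4 \<noteq> 0" "b4 \<bullet> (g *v v) = 0" "b4 \<bullet> (g *v b2) = 0" "b4 \<bullet> (g *v b3) = 0"
    using ex[of "[g *v v, g *v b2, g *v b3]"] by auto
  define b :: "4 \<Rightarrow> real^4" where "b a = (if a = 1 then v else if a = 2 then b2 else if a = 3 then b3 else b4)" for a
  have ort: "b a \<bullet> (g *v b c) = 0" if "a \<noteq> c" for a c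
  proof -
    have "\<forall>a c. a \<noteq> c \<longrightarrow> b a \<bullet> (g *v b c) = 0"
      unfolding forall_4 using b2 b3 b4 comm[of v b2] comm[of v b3] comm[of v b4] comm[of b2 b3] comm[of b2 b4] comm[of b3 b4]
      by (simp add: b_def)
    then show ?thesis using that by blast
  qed
  have "b a \<noteq> 0" for a using v b2 b3 b4 by (simp add: b_def)
  then have p: "b a \<bullet> (g *v b a) > 0" for a using pos by blast
  define e where "e a = (1 / sqrt (b a \<bullet> (g *v b a))) *\<^sub>R b a" for a
  have "e a \<bullet> (g *v e c) = (if a = c then 1 else 0)" for a c
    using ort[of a c] p[of a] by (cases "a = c") (simp_all add: e_def matrix_vector_mult_scaleR)
  moreover have "e 1 = (1 / sqrt (b 1 \<bullet> (g *v b 1))) *\<^sub>R v" by (simp add: e_def b_def)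
  ultimately show ?thesis using that by blast
qed

lemma antisymmetric_zero_4:
  fixes f :: "4 \<Rightarrow> 4 \<Rightarrow> real"
  assumes "\<And>a b. f b a = - f a b" "\<And>b. f 1 b = 0" "f 2 3 = 0" "f 2 4 = 0" "f 3 4 = 0"
  shows "f a b = 0"
proof -
  have d: "f a a = 0" for a using assms(1)[of a a] by simp
  have "f b 1 = 0" for b using assms(1)[of 1 b] assms(2)[of b] by simp
  moreover have "f 3 2 = 0" "f 4 2 = 0" "f 4 3 = 0"
    using assms(1)[of 3 2] assms(1)[of 4 2] assms(1)[of 4 3] assms(3-5) by simp_all
  ultimately have "\<forall>a b. f a b = 0"
    unfolding forall_4 by (simp add: assms(2-5) d)
  then show ?thesis by blast
qed

text \<open>In an orthonormal frame whose first vector lies in the kernel, the tensor lives on a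
  three-dimensional space, where a trace-free curvature tensor vanishes.\<close>

lemma trace_free_curvature_zero_4:
  fixes W :: "4 \<Rightarrow> 4 \<Rightarrow> 4 \<Rightarrow> 4 \<Rightarrow> real" and g :: "real^4^4" and H :: "4 \<Rightarrow> 4 \<Rightarrow> real"
  assumes anti: "\<And>i j k l. W j i k l = - W i j k l"
    and pair: "\<And>i j k l. W k l i j = W i j k l"
    and trace: "\<And>i k. (\<Sum>j\<in>UNIV. \<Sum>l\<in>UNIV. H j l * W i j k l) = 0"
    and sym: "transpose g = g" and pos: "\<And>v. v \<noteq> 0 \<Longrightarrow> v \<bullet> (g *v v) > 0"
    and inv: "\<And>i j. (\<Sum>k\<in>UNIV. H i k * g $ k $ j) = (if i = j then 1 else 0)"
    and v: "v \<noteq> 0" "\<And>i j k. (\<Sum>l\<in>UNIV. W i j k l * v $ l) = 0"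
  shows "W i j k l = 0"
proof -
  obtain e :: "4 \<Rightarrow> real^4" and c where e1: "e 1 = c *\<^sub>R v"
    and e: "\<And>a b. e a \<bullet> (g *v e b) = (if a = b then 1 else 0)"
    using orthonormal_frame_4[OF sym pos v(1)] by blast
  define Y where "Y i a = (g *v e a) $ i" for i a
  have XY: "(\<Sum>i\<in>UNIV. e a $ i * Y i b) = (if a = b then 1 else 0)" for a b
    using e[of a b] by (simp add: Y_def inner_vec_def)
  note YX = sum_inverse_commute[OF XY]
  have zero: "f i = 0" if "\<And>a. (\<Sum>i\<in>UNIV. e a $ i * f i) = 0" for f :: "4 \<Rightarrow> real" and i
  proof -
    have "f i = (\<Sum>j\<in>UNIV. (\<Sum>a\<in>UNIV. Y i a * e a $ j) * f j)" by (simp add: YX sum_delta_mult)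
    also have "\<dots> = (\<Sum>a\<in>UNIV. Y i a * (\<Sum>j\<in>UNIV. e a $ j * f j))"
      unfolding sum_distrib_left sum_distrib_right by (subst sum.swap) (simp add: mult_ac)
    finally show ?thesis by (simp add: that)
  qed
  \<comment> \<open>The inverse metric expressed in an orthonormal frame; it turns the trace with
    \<open>H\<close> into a plain sum over frame components.\<close>
  have H: "H i j = (\<Sum>a\<in>UNIV. e a $ i * e a $ j)" for i j
  proof -
    have "(\<Sum>k\<in>UNIV. H i k * (\<Sum>a\<in>UNIV. Y k a * e a $ j)) = (\<Sum>a\<in>UNIV. (\<Sum>k\<in>UNIV. H i k * Y k a) * e a $ j)"
      unfolding sum_distrib_left sum_distrib_right by (subst sum.swap) (simp add: mult_ac)
    moreover have "(\<Sum>k\<in>UNIV. H i k * Y k a) = e a $ i" for a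
    proof -
      have "(\<Sum>k\<in>UNIV. H i k * Y k a) = (\<Sum>j\<in>UNIV. (\<Sum>k\<in>UNIV. H i k * g $ k $ j) * e a $ j)"
        unfolding Y_def matrix_vector_mult_def sum_distrib_left sum_distrib_right
        by (simp add: sum_distrib_left) (subst sum.swap, simp add: mult_ac)
      then show ?thesis by (simp add: inv sum_delta_mult)
    qed
    ultimately show ?thesis by (simp add: YX sum_delta_mult)
  qed
  \<comment> \<open>\<open>r\<close> holds the frame components of \<open>W\<close>. In
    \<open>U\<close> only the first and third slots are contracted, which are the slots that the
    trace leaves free.\<close>
  define U where "U a c j l = (\<Sum>i\<in>UNIV. e a $ i * (\<Sum>k\<in>UNIV. e c $ k * W i j k l))" for a c j l
  define r where "r a b c d = (\<Sum>i\<in>UNIV. e a $ i * (\<Sum>j\<in>UNIV. e b $ j * (\<Sum>k\<in>UNIV. e c $ k * (\<Sum>l\<in>UNIV. e d $ l * W i j k l))))"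
    for a b c d
  have rU: "r a b c d = (\<Sum>j\<in>UNIV. \<Sum>l\<in>UNIV. e b $ j * e d $ l * U a c j l)" for a b c d
  proof -
    have "r a b c d = (\<Sum>i\<in>UNIV. \<Sum>j\<in>UNIV. \<Sum>k\<in>UNIV. \<Sum>l\<in>UNIV. e a $ i * e b $ j * e c $ k * e d $ l * W i j k l)"
      by (simp add: r_def sum_distrib_left mult_ac)
    also have "\<dots> = (\<Sum>j\<in>UNIV. \<Sum>i\<in>UNIV. \<Sum>l\<in>UNIV. \<Sum>k\<in>UNIV. e a $ i * e b $ j * e c $ k * e d $ l * W i j k l)"
      by (subst sum.swap) (intro sum.cong refl sum.swap)
    also have "\<dots> = (\<Sum>j\<in>UNIV. \<Sum>l\<in>UNIV. \<Sum>i\<in>UNIV. \<Sum>k\<in>UNIV. e a $ i * e b $ j * e c $ k * e d $ l * W i j k l)"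
      by (intro sum.cong refl sum.swap)
    finally show ?thesis by (simp add: U_def sum_distrib_left mult_ac)
  qed
  have trU: "(\<Sum>j\<in>UNIV. \<Sum>l\<in>UNIV. H j l * U a c j l) = 0" for a c
  proof -
    have "(\<Sum>j\<in>UNIV. \<Sum>l\<in>UNIV. H j l * U a c j l)
      = (\<Sum>j\<in>UNIV. \<Sum>l\<in>UNIV. \<Sum>i\<in>UNIV. \<Sum>k\<in>UNIV. e a $ i * e c $ k * (H j l * W i j k l))"
      by (simp add: U_def sum_distrib_left mult_ac)
    also have "\<dots> = (\<Sum>j\<in>UNIV. \<Sum>i\<in>UNIV. \<Sum>k\<in>UNIV. \<Sum>l\<in>UNIV. e a $ i * e c $ k * (H j l * W i j k l))"
      by (rule sum.cong[OF refl], subst sum.swap, rule sum.cong[OF refl], rule sum.swap)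
    also have "\<dots> = (\<Sum>i\<in>UNIV. \<Sum>k\<in>UNIV. \<Sum>j\<in>UNIV. \<Sum>l\<in>UNIV. e a $ i * e c $ k * (H j l * W i j k l))"
      by (subst sum.swap) (intro sum.cong refl sum.swap)
    also have "\<dots> = (\<Sum>i\<in>UNIV. \<Sum>k\<in>UNIV. e a $ i * e c $ k * (\<Sum>j\<in>UNIV. \<Sum>l\<in>UNIV. H j l * W i j k l))"
      by (simp add: sum_distrib_left)
    finally show ?thesis by (simp add: trace)
  qed
  have rtrace: "(\<Sum>b\<in>UNIV. r a b c b) = 0" for a c
  proof -
    have "(\<Sum>b\<in>UNIV. r a b c b) = (\<Sum>j\<in>UNIV. \<Sum>l\<in>UNIV. (\<Sum>b\<in>UNIV. e b $ j * e b $ l) * U a c j l)"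
      unfolding rU sum_distrib_right by (subst sum.swap) (intro sum.cong refl sum.swap)
    then show ?thesis using trU[of a c] by (simp add: H)
  qed
  have ranti: "r b a c d = - r a b c d" for a b c d
  proof -
    define V where "V i j = (\<Sum>k\<in>UNIV. e c $ k * (\<Sum>l\<in>UNIV. e d $ l * W i j k l))" for i j
    have V: "V j i = - V i j" for i j
      unfolding V_def anti[of i j] by (simp add: sum_negf)
    have "r b a c d = (\<Sum>i\<in>UNIV. \<Sum>j\<in>UNIV. e b $ i * (e a $ j * V i j))"
      by (simp add: r_def V_def sum_distrib_left)
    also have "\<dots> = (\<Sum>j\<in>UNIV. \<Sum>i\<in>UNIV. e b $ i * (e a $ j * V i j))"
      by (rule sum.swap)
    also have "\<dots> = (\<Sum>j\<in>UNIV. \<Sum>i\<in>UNIV. - (e a $ j * (e b $ i * V j i)))"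
      by (intro sum.cong refl) (subst V, simp)
    also have "\<dots> = - r a b c d" by (simp add: r_def V_def sum_distrib_left sum_negf)
    finally show ?thesis .
  qed
  have rpair: "r c d a b = r a b c d" for a b c d
  proof -
    have "r c d a b = (\<Sum>i\<in>UNIV. \<Sum>j\<in>UNIV. \<Sum>k\<in>UNIV. \<Sum>l\<in>UNIV. e c $ i * e d $ j * e a $ k * e b $ l * W k l i j)"
      by (simp add: r_def sum_distrib_left mult_ac pair)
    also have "\<dots> = (\<Sum>i\<in>UNIV. \<Sum>k\<in>UNIV. \<Sum>l\<in>UNIV. \<Sum>j\<in>UNIV. e c $ i * e d $ j * e a $ k * e b $ l * W k l i j)"
      by (rule sum.cong[OF refl], subst sum.swap, rule sum.cong[OF refl], rule sum.swap)
    also have "\<dots> = (\<Sum>k\<in>UNIV. \<Sum>l\<in>UNIV. \<Sum>i\<in>UNIV. \<Sum>j\<in>UNIV. e c $ i * e d $ j * e a $ k * e b $ l * W k l i j)"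
      by (subst sum.swap) (intro sum.cong refl sum.swap)
    also have "\<dots> = r a b c d" by (simp add: r_def sum_distrib_left mult_ac)
    finally show ?thesis .
  qed
  have ranti': "r a b d c = - r a b c d" for a b c d
    using ranti rpair by metis
  have r1: "r a b d 1 = 0" for a b d
  proof -
    have "(\<Sum>l\<in>UNIV. e 1 $ l * W i j k l) = c * (\<Sum>l\<in>UNIV. W i j k l * v $ l)" for i j k
      by (simp add: e1 sum_distrib_left mult_ac)
    then show ?thesis by (simp add: r_def v)
  qed
  have ra: "r a a c d = 0" and rb: "r a b c c = 0" and r3: "r a b 1 d = 0" for a b c d
    using ranti[of a a c d] ranti'[of a b c c] r1[of a b d] ranti'[of a b d 1] by simp_all
  have r2: "r 1 b c d = 0" "r a 1 c d = 0" for a b c d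
    using rpair[of 1 b c d] rpair[of a 1 c d] r3 r1 by simp_all
  note z = ra rb r1 r2 r3
  \<comment> \<open>The surviving components form a symmetric 3x3 matrix indexed by the pairs 23,
    24, 34, and the traces give six equations for its six entries: each mixed trace contains a
    single off-diagonal entry, and the diagonal traces say that any two diagonal entries add up to
    zero.\<close>
  have t: "r a 2 c 2 + r a 3 c 3 + r a 4 c 4 = 0" for a c
    using rtrace[of a c] by (simp add: sum_4 z)
  have n: "r 3 2 c d = - r 2 3 c d" "r 4 2 c d = - r 2 4 c d" "r 4 3 c d = - r 3 4 c d"
    "r c d 3 2 = - r c d 2 3" "r c d 4 2 = - r c d 2 4" "r c d 4 3 = - r c d 3 4" for c d
    by (rule ranti ranti')+
  have v: "r 2 3 2 4 = 0" "r 2 3 3 4 = 0" "r 2 4 3 4 = 0"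
    using t[of 2 3] t[of 2 4] t[of 3 4] by (simp_all add: z n)
  have "r 2 3 2 3 + r 2 4 2 4 = 0" "r 2 3 2 3 + r 3 4 3 4 = 0" "r 2 4 2 4 + r 3 4 3 4 = 0"
    using t[of 2 2] t[of 3 3] t[of 4 4] by (simp_all add: z n)
  then have v': "r 2 3 2 3 = 0" "r 2 4 2 4 = 0" "r 3 4 3 4 = 0" by linarith+
  have v'': "r 2 4 2 3 = 0" "r 3 4 2 3 = 0" "r 3 4 2 4 = 0"
    using v rpair[of 2 3 2 4] rpair[of 2 3 3 4] rpair[of 2 4 3 4] by simp_all
  have *: "r a b c d = 0" if "r a b 2 3 = 0" "r a b 2 4 = 0" "r a b 3 4 = 0" for a b c d
    by (rule antisymmetric_zero_4) (fact ranti' r3 that)+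
  have r: "r a b c d = 0" for a b c d
    by (rule antisymmetric_zero_4[of "\<lambda>a b. r a b c d"]) (rule ranti r2 v v' v'' *)+
  \<comment> \<open>The frame is stripped off one index at a time, since a covector vanishing on all
    frame vectors is zero.\<close>
  have "(\<Sum>j\<in>UNIV. e b $ j * (\<Sum>k\<in>UNIV. e c $ k * (\<Sum>l\<in>UNIV. e d $ l * W i j k l))) = 0" for b c d i
    by (rule zero) (rule r[unfolded r_def])
  then have "(\<Sum>k\<in>UNIV. e c $ k * (\<Sum>l\<in>UNIV. e d $ l * W i j k l)) = 0" for c d i j
    by (rule zero)
  then have "(\<Sum>l\<in>UNIV. e d $ l * W i j k l) = 0" for d i j k
    by (rule zero)
  then show ?thesis by (rule zero)
qed

text \<open>The relation is the second Bianchi identity of a curvature tensor built from the metric and a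
  symmetric tensor with exterior covariant derivative \<open>C\<close>; it is traced twice.\<close>

lemma cotton_trace_zero:
  fixes C :: "'n::finite \<Rightarrow> 'n \<Rightarrow> 'n \<Rightarrow> real" and G H :: "'n \<Rightarrow> 'n \<Rightarrow> real"
  assumes card: "CARD('n) > 3"
    and G: "\<And>i j. G i j = G j i"
    and HG: "\<And>i j. (\<Sum>k\<in>UNIV. H i k * G k j) = (if i = j then 1 else 0)"
    and H: "\<And>i j. H i j = H j i"
    and anti: "\<And>i j k. C j i k = - C i j k"
    and rel: "\<And>k i j a b. C k i a * G j b + C i j a * G k b + C j k a * G i b
       - C k i b * G j a - C i j b * G k a - C j k b * G i a = 0"
  shows "C k i a = 0"
proof -
  let ?n = "real CARD('n)"
  let ?T = "\<lambda>f. \<Sum>j\<in>UNIV. \<Sum>b\<in>UNIV. H j b * f j b"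
  define c where "c k = ?T (\<lambda>j b. C k j b)" for k
  have HG': "(\<Sum>b\<in>UNIV. H j b * G k b) = (if j = k then 1 else 0)" for j k
    using HG[of j k] G by simp
  have HG'': "(\<Sum>j\<in>UNIV. H j b * G j k) = (if b = k then 1 else 0)" for b k
    using HG[of b k] H by simp
  have T1: "?T (\<lambda>j b. f * G j b) = ?n * f" for f
  proof -
    have "?T (\<lambda>j b. f * G j b) = (\<Sum>j\<in>UNIV. f * (\<Sum>b\<in>UNIV. H j b * G j b))"
      by (simp add: sum_distrib_left mult_ac)
    then show ?thesis by (simp add: HG')
  qed
  have T2: "?T (\<lambda>j b. f j * G k b) = f k" for f k
  proof -
    have "?T (\<lambda>j b. f j * G k b) = (\<Sum>j\<in>UNIV. f j * (\<Sum>b\<in>UNIV. H j b * G k b))"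
      by (simp add: sum_distrib_left mult_ac)
    then show ?thesis by (simp add: HG' sum_delta_mult)
  qed
  have T3: "?T (\<lambda>j b. f b * G j k) = f k" for f k
  proof -
    have "?T (\<lambda>j b. f b * G j k) = (\<Sum>b\<in>UNIV. f b * (\<Sum>j\<in>UNIV. H j b * G j k))"
      by (subst sum.swap) (simp add: sum_distrib_left mult_ac)
    then show ?thesis by (simp add: HG'' sum_delta_mult)
  qed
  have T4: "?T (\<lambda>j b. f j b * e) = ?T f * e" for f e
    by (simp add: sum_distrib_right mult.assoc)
  have cneg: "?T (\<lambda>j b. C j k b) = - c k" for k
    unfolding c_def anti[of k] by (simp add: sum_negf)
  \<comment> \<open>Contraction over \<open>j\<close> and \<open>b\<close>. The factor arises as n -
    1 - 2: the first term yields n, the fourth -1, and the second and third yield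
    \<open>C i k a\<close> each, which is the negative of \<open>C k i a\<close>.\<close>
  have main: "(?n - 3) * C k i a = G k a * c i - G i a * c k" for k i a
  proof -
    have "0 = ?T (\<lambda>j b. C k i a * G j b + C i j a * G k b + C j k a * G i b
       - C k i b * G j a - C i j b * G k a - C j k b * G i a)"
      by (simp add: rel)
    also have "\<dots> = ?T (\<lambda>j b. C k i a * G j b) + ?T (\<lambda>j b. C i j a * G k b) + ?T (\<lambda>j b. C j k a * G i b)
       - ?T (\<lambda>j b. C k i b * G j a) - ?T (\<lambda>j b. C i j b * G k a) - ?T (\<lambda>j b. C j k b * G i a)"
      by (simp only: distrib_left right_diff_distrib sum.distrib sum_subtractf)
    also have "\<dots> = ?n * C k i a + C i k a + C i k a - C k i a - c i * G k a + c k * G i a"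
      unfolding T1 T2 T3 T4 cneg by (simp add: c_def)
    finally show ?thesis using anti[of i k a] by (simp add: algebra_simps)
  qed
  \<comment> \<open>Contracting \<open>main\<close> once more gives (n - 3) c = (1 - n) c.\<close>
  have "c k = 0" for k
  proof -
    have "(?n - 3) * c k = ?T (\<lambda>i a. (?n - 3) * C k i a)"
      unfolding c_def by (simp add: sum_distrib_left mult_ac)
    also have "\<dots> = ?T (\<lambda>i a. G k a * c i - G i a * c k)" by (simp only: main)
    also have "\<dots> = ?T (\<lambda>i a. c i * G k a) - ?T (\<lambda>i a. c k * G i a)"
      by (simp only: right_diff_distrib sum_subtractf mult.commute)
    also have "\<dots> = c k - ?n * c k" unfolding T1 T2 ..
    finally have "(2 * ?n - 4) * c k = 0" by (simp add: algebra_simps)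
    then show ?thesis using card by simp
  qed
  then have "(?n - 3) * C k i a = 0" using main by simp
  then show ?thesis using card by simp
qed

section \<open>The Schouten tensor and the vanishing of the Cotton tensor\<close>

context local_metric
begin

definition schouten :: "'n \<Rightarrow> 'n \<Rightarrow> real^'n \<Rightarrow> real" where
  "schouten i j x = 1 / (real CARD('n) - 2) *
     (ricci g i j x - scalar_curvature g x / (2 * (real CARD('n) - 1)) * G i j x)"

lemma smooth_schouten: "smooth_on S (schouten i j)"
  unfolding schouten_def[abs_def] divide_inverse
  by (intro smooth_intros smooth_ricci smooth_scalar)

lemma schouten_sym: "x \<in> S \<Longrightarrow> schouten i j x = schouten j i x"
  unfolding schouten_def using ricci_sym G_sym by metis

lemma smooth_weyl: "smooth_on S (weyl g i j k l)"
  unfolding weyl_def[abs_def] Let_def divide_inverse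
  by (intro smooth_intros smooth_ricci smooth_scalar smooth_R)

lemma weyl_anti12: "weyl g j i k l x = - weyl g i j k l x"
  unfolding weyl_def Let_def using R_anti12[of j i] by (simp add: algebra_simps)

lemma weyl_pair:
  assumes x: "x \<in> S"
  shows "weyl g k l i j x = weyl g i j k l x"
  unfolding weyl_def Let_def
  using R_pair[OF x, of k l i j] ricci_sym[OF x] G_sym[OF x] by (simp add: algebra_simps)

text \<open>The Ricci terms contract to (n - 2) Ric + R g and the product of metrics to (n - 1) g.
  The denominators in \<open>weyl\<close> make the first cancel the Ricci tensor, and the remaining
  multiples of R g / (n - 2) cancel each other.\<close>

lemma weyl_trace:
  assumes x: "x \<in> S" and card: "CARD('n) > 2"
  shows "(\<Sum>j\<in>UNIV. \<Sum>l\<in>UNIV. H j l x * weyl g i j k l x) = 0"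
proof -
  let ?n = "real CARD('n)" and ?s = "scalar_curvature g x" and ?r = "\<lambda>i j. ricci g i j x"
  let ?T = "\<lambda>f. \<Sum>j\<in>UNIV. \<Sum>l\<in>UNIV. H j l x * f j l"
  have HG': "(\<Sum>l\<in>UNIV. H j l x * G k l x) = (if j = k then 1 else 0)" for j k
    using HG[OF x, of j k] G_sym[OF x, of k] by simp
  have HG'': "(\<Sum>j\<in>UNIV. H j l x * G j k x) = (if l = k then 1 else 0)" for l k
    using HG[OF x, of l k] H_sym[OF x, of l] by simp
  have T1: "?T (\<lambda>j l. f * G j l x) = ?n * f" for f
  proof -
    have "?T (\<lambda>j l. f * G j l x) = (\<Sum>j\<in>UNIV. f * (\<Sum>l\<in>UNIV. H j l x * G j l x))"
      by (simp add: sum_distrib_left mult_ac)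
    then show ?thesis by (simp add: HG')
  qed
  have T2: "?T (\<lambda>j l. f j * G i l x) = f i" for f i
  proof -
    have "?T (\<lambda>j l. f j * G i l x) = (\<Sum>j\<in>UNIV. f j * (\<Sum>l\<in>UNIV. H j l x * G i l x))"
      by (simp add: sum_distrib_left mult_ac)
    then show ?thesis by (simp add: HG' sum_delta_mult)
  qed
  have T3: "?T (\<lambda>j l. f l * G j k x) = f k" for f k
  proof -
    have "?T (\<lambda>j l. f l * G j k x) = (\<Sum>l\<in>UNIV. f l * (\<Sum>j\<in>UNIV. H j l x * G j k x))"
      by (subst sum.swap) (simp add: sum_distrib_left mult_ac)
    then show ?thesis by (simp add: HG'' sum_delta_mult)
  qed
  have T4: "?T (\<lambda>j l. f j l * e) = ?T f * e" and T5: "?T (\<lambda>j l. e * f j l) = e * ?T f" for f e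
    by (simp_all add: sum_distrib_right sum_distrib_left mult_ac)
  have "?T (\<lambda>j l. weyl g i j k l x) = ?T (\<lambda>j l. R i j k l x)
      - 1 / (?n - 2) * (?T (\<lambda>j l. ?r i k * G j l x) + ?T (\<lambda>j l. ?r j l * G i k x)
         - ?T (\<lambda>j l. ?r i l * G j k x) - ?T (\<lambda>j l. ?r j k * G i l x))
      + ?s / ((?n - 1) * (?n - 2)) * (?T (\<lambda>j l. G i k x * G j l x) - ?T (\<lambda>j l. G j k x * G i l x))"
    unfolding weyl_def Let_def T5[symmetric] distrib_left right_diff_distrib sum.distrib sum_subtractf
    by (simp add: mult_ac)
  also have "\<dots> = ?r i k - 1 / (?n - 2) * (?n * ?r i k + ?s * G i k x - ?r i k - ?r i k)
      + ?s / ((?n - 1) * (?n - 2)) * (?n * G i k x - G i k x)"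
    unfolding T1 T2 T3 T4 by (simp add: ricci_def scalar_curvature_def)
  also have "1 / (?n - 2) * (?n * ?r i k + ?s * G i k x - ?r i k - ?r i k) = ?r i k + ?s * G i k x / (?n - 2)"
    using card by (simp add: field_simps)
  also have "?s / ((?n - 1) * (?n - 2)) * (?n * G i k x - G i k x) = ?s * G i k x / (?n - 2)"
  proof -
    have "?n * G i k x - G i k x = (?n - 1) * G i k x" by (simp add: algebra_simps)
    then show ?thesis using card by simp
  qed
  also have "?r i k - (?r i k + ?s * G i k x / (?n - 2)) + ?s * G i k x / (?n - 2) = 0" by simp
  finally show ?thesis .
qed

lemma riemann_schouten:
  assumes x: "x \<in> S" and card: "CARD('n) > 2" and W: "weyl g i j k l x = 0"
  shows "R i j k l x = schouten i k x * G j l x + schouten j l x * G i k x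
    - schouten i l x * G j k x - schouten j k x * G i l x"
proof -
  define u where "u = 1 / (real CARD('n) - 2)"
  define w where "w = scalar_curvature g x / (2 * (real CARD('n) - 1))"
  have "scalar_curvature g x / ((real CARD('n) - 1) * (real CARD('n) - 2)) = 2 * w * u"
  proof -
    have "s / (a * b) = 2 * (s / (2 * a)) * (1 / b)" for s a b :: real by simp
    then show ?thesis unfolding u_def w_def .
  qed
  then show ?thesis
    using W unfolding weyl_def Let_def schouten_def u_def[symmetric] w_def[symmetric]
    by (simp add: algebra_simps)
qed

text \<open>With W = 0 the curvature is built from the Schouten tensor and the parallel metric, so
  the second Bianchi identity becomes the relation treated in \<open>cotton_trace_zero\<close>. The
  connection terms that pair \<open>k\<close> with \<open>j\<close> agree on both sides and are left
  out of the statement.\<close>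

lemma cotton_zero:
  assumes x: "x \<in> S" and card: "CARD('n) > 3"
    and W: "\<And>y i j k l. y \<in> S \<Longrightarrow> weyl g i j k l y = 0"
  shows "partial k (schouten j l) x - (\<Sum>p\<in>UNIV. \<Gamma> p k l x * schouten j p x) =
    partial j (schouten k l) x - (\<Sum>p\<in>UNIV. \<Gamma> p j l x * schouten k p x)"
proof -
  let ?P = schouten
  define D where "D k i j = partial k (?P i j) x - (\<Sum>p\<in>UNIV. \<Gamma> p k i x * ?P p j x) - (\<Sum>p\<in>UNIV. \<Gamma> p k j x * ?P i p x)" for k i j
  define C where "C k i j = D k i j - D i k j" for k i j
  define DR where "DR k i j a b = partial k (R i j a b) x - (\<Sum>p\<in>UNIV. \<Gamma> p k a x * R i j p b x)
      - (\<Sum>p\<in>UNIV. \<Gamma> p k b x * R i j a p x)" for k i j a b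
  \<comment> \<open>The connection terms of the first two indices, absent from \<open>DR\<close>.
    They cancel cyclically (\<open>cycE\<close>), but only \<open>DR\<close> - \<open>E\<close>
    obeys a product rule in terms of \<open>D\<close>; \<open>Q\<close> gathers all connection terms
    of one product P g.\<close>
  define E where "E k i j a b = (\<Sum>p\<in>UNIV. \<Gamma> p k i x * R p j a b x) + (\<Sum>p\<in>UNIV. \<Gamma> p k j x * R i p a b x)" for k i j a b
  have dec: "R i j k l y = ?P i k y * G j l y + ?P j l y * G i k y - ?P i l y * G j k y - ?P j k y * G i l y"
    if "y \<in> S" for i j k l y
    using riemann_schouten[OF that _ W[OF that]] card by simp
  have dP: "?P i j differentiable (at x)" for i j
    by (rule smooth_on_imp_differentiable[OF smooth_schouten x])
  define Q where "Q k i a j b = (\<Sum>p\<in>UNIV. \<Gamma> p k i x * (?P p a x * G j b x)) + (\<Sum>p\<in>UNIV. \<Gamma> p k a x * (?P i p x * G j b x))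
     + (\<Sum>p\<in>UNIV. \<Gamma> p k j x * (?P i a x * G p b x)) + (\<Sum>p\<in>UNIV. \<Gamma> p k b x * (?P i a x * G j p x))" for k i a j b
  have prod: "partial k (\<lambda>x. ?P i a x * G j b x) x - Q k i a j b = D k i a * G j b x" for k i a j b
  proof -
    have "partial k (\<lambda>x. ?P i a x * G j b x) x = partial k (?P i a) x * G j b x + ?P i a x * partial k (G j b) x"
      using dP differentiable[OF x] by (simp add: partial_mult)
    then show ?thesis
      unfolding partial_G[OF x] Q_def D_def
      by (simp add: algebra_simps sum_distrib_left sum_distrib_right)
  qed
  have DRE: "DR k i j a b - E k i j a b = D k i a * G j b x + D k j b * G i a x - D k i b * G j a x - D k j a * G i b x"
    for k i j a b
  proof -
    have "partial k (R i j a b) x = partial k (\<lambda>y. ?P i a y * G j b y + ?P j b y * G i a y - ?P i b y * G j a y - ?P j a y * G i b y) x"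
      by (rule partial_cong[OF open_S x]) (rule dec)
    also have "\<dots> = partial k (\<lambda>y. ?P i a y * G j b y) x + partial k (\<lambda>y. ?P j b y * G i a y) x
        - partial k (\<lambda>y. ?P i b y * G j a y) x - partial k (\<lambda>y. ?P j a y * G i b y) x"
      using dP differentiable[OF x] by (simp add: partial_add partial_diff)
    finally have 1: "partial k (R i j a b) x = \<dots>" .
    show ?thesis
      unfolding prod[symmetric] DR_def E_def 1 dec[OF x] Q_def distrib_left right_diff_distrib sum.distrib sum_subtractf
      by simp
  qed
  have cyc: "DR k i j a b + DR i j k a b + DR j k i a b = 0" for k i j a b
    unfolding DR_def by (rule R_bianchi2[OF x])
  have cycE: "E k i j a b + E i j k a b + E j k i a b = 0" for k i j a b
  proof -
    have "(\<Sum>p\<in>UNIV. \<Gamma> p k i x * R p j a b x) = - (\<Sum>p\<in>UNIV. \<Gamma> p i k x * R j p a b x)" for k i j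
      unfolding sum_negf[symmetric] using \<Gamma>_sym[OF x, of _ k i] R_anti12[of j] by simp
    then show ?thesis unfolding E_def by simp
  qed
  have rel: "C k i a * G j b x + C i j a * G k b x + C j k a * G i b x
       - C k i b * G j a x - C i j b * G k a x - C j k b * G i a x = 0" for k i j a b
    using cyc[of k i j a b] cycE[of k i j a b] DRE[of k i j a b] DRE[of i j k a b] DRE[of j k i a b]
    unfolding C_def by (simp add: algebra_simps)
  have "C k j l = 0"
    by (rule cotton_trace_zero[OF card G_sym[OF x] HG[OF x] H_sym[OF x] _ rel]) (simp add: C_def)
  moreover have "(\<Sum>p\<in>UNIV. \<Gamma> p k j x * ?P p l x) = (\<Sum>p\<in>UNIV. \<Gamma> p j k x * ?P p l x)"
    using \<Gamma>_sym[OF x] by metis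
  ultimately show ?thesis unfolding C_def D_def by simp
qed

end

section \<open>Flat coordinates from parallel tractors\<close>

lemma sum_UNIV_option_option:
  fixes f :: "'n::finite option option \<Rightarrow> real"
  shows "(\<Sum>a\<in>UNIV. f a) = f None + f (Some None) + (\<Sum>j\<in>UNIV. f (Some (Some j)))"
proof -
  have "sum h UNIV = h None + (\<Sum>j\<in>UNIV. h (Some j))" for h :: "'b::finite option \<Rightarrow> real"
    by (simp add: UNIV_option_conv sum.reindex)
  from this[of f] this[of "\<lambda>a. f (Some a)"] show ?thesis by simp
qed

lemma sum3_reverse:
  "(\<Sum>a\<in>A. \<Sum>b\<in>B. \<Sum>c\<in>C. f a b c) = (\<Sum>c\<in>C. \<Sum>b\<in>B. \<Sum>a\<in>A. f a b c :: real)"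
proof -
  have "(\<Sum>a\<in>A. \<Sum>b\<in>B. \<Sum>c\<in>C. f a b c) = (\<Sum>a\<in>A. \<Sum>c\<in>C. \<Sum>b\<in>B. f a b c)"
    by (rule sum.cong[OF refl]) (rule sum.swap)
  also have "\<dots> = (\<Sum>c\<in>C. \<Sum>a\<in>A. \<Sum>b\<in>B. f a b c)" by (rule sum.swap)
  also have "\<dots> = (\<Sum>c\<in>C. \<Sum>b\<in>B. \<Sum>a\<in>A. f a b c)"
    by (rule sum.cong[OF refl]) (rule sum.swap)
  finally show ?thesis .
qed

section \<open>The tractor connection, its flatness and its parallel metric\<close>

context local_metric
begin

text \<open>The inverse metric is parallel too: differentiate H G = 1 and insert
  \<open>partial_G\<close>.\<close>

lemma partial_H:
  assumes x: "x \<in> S"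
  shows "partial i (H k l) x = - (\<Sum>p\<in>UNIV. \<Gamma> k i p x * H p l x) - (\<Sum>p\<in>UNIV. \<Gamma> l i p x * H k p x)"
proof -
  have 0: "(\<Sum>m\<in>UNIV. partial i (H k m) x * G m j x) = - (\<Sum>m\<in>UNIV. H k m x * partial i (G m j) x)" for j
  proof -
    have "partial i (\<lambda>x. \<Sum>m\<in>UNIV. H k m x * G m j x) x = partial i (\<lambda>x. if k = j then 1 else 0) x"
      by (rule partial_cong[OF open_S x]) (rule HG)
    then show ?thesis using differentiable[OF x]
      by (simp add: partial_sum partial_mult sum.distrib)
  qed
  have 1: "(\<Sum>m\<in>UNIV. H k m x * partial i (G m j) x) =
      (\<Sum>p\<in>UNIV. (\<Sum>m\<in>UNIV. H k m x * \<Gamma> p i m x) * G p j x) + \<Gamma> k i j x" for j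
  proof -
    have "(\<Sum>m\<in>UNIV. H k m x * (\<Sum>p\<in>UNIV. \<Gamma> p i j x * G m p x)) = (\<Sum>p\<in>UNIV. (\<Sum>m\<in>UNIV. H k m x * G m p x) * \<Gamma> p i j x)"
      unfolding sum_distrib_left sum_distrib_right by (subst sum.swap) (simp add: mult_ac)
    moreover have "(\<Sum>m\<in>UNIV. H k m x * (\<Sum>p\<in>UNIV. \<Gamma> p i m x * G p j x)) = (\<Sum>p\<in>UNIV. (\<Sum>m\<in>UNIV. H k m x * \<Gamma> p i m x) * G p j x)"
      unfolding sum_distrib_left sum_distrib_right by (subst sum.swap) (simp add: mult_ac)
    ultimately show ?thesis
      unfolding partial_G[OF x] by (simp add: distrib_left sum.distrib HG[OF x] sum_delta_mult)
  qed
  have contract: "(\<Sum>j\<in>UNIV. (\<Sum>m\<in>UNIV. f m * G m j x) * H j l x) = f l" for f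
  proof -
    have "(\<Sum>j\<in>UNIV. (\<Sum>m\<in>UNIV. f m * G m j x) * H j l x) = (\<Sum>m\<in>UNIV. f m * (\<Sum>j\<in>UNIV. G m j x * H j l x))"
      unfolding sum_distrib_left sum_distrib_right by (subst sum.swap) (simp add: mult_ac)
    then show ?thesis by (simp add: GH[OF x] sum_delta_mult)
  qed
  have "partial i (H k l) x = (\<Sum>j\<in>UNIV. (\<Sum>m\<in>UNIV. partial i (H k m) x * G m j x) * H j l x)"
    by (simp only: contract)
  also have "\<dots> = - (\<Sum>j\<in>UNIV. (\<Sum>p\<in>UNIV. (\<Sum>m\<in>UNIV. H k m x * \<Gamma> p i m x) * G p j x) * H j l x) - (\<Sum>j\<in>UNIV. \<Gamma> k i j x * H j l x)"
    unfolding 0 1 by (simp add: distrib_right sum.distrib sum_negf left_diff_distrib sum_subtractf)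
  finally show ?thesis unfolding contract by (simp add: mult.commute)
qed

text \<open>The standard tractor connection: the index \<open>None\<close> stands for a conformal scale \<open>\<tau>\<close>,
  \<open>Some (Some j)\<close> for its differential \<open>\<mu>\<^sub>j\<close>, and \<open>Some None\<close> for a scalar \<open>\<sigma>\<close>.  Parallel sections satisfy
  \<open>\<partial>\<^sub>i \<tau> = \<mu>\<^sub>i\<close>, \<open>\<nabla>\<^sub>i \<mu>\<^sub>j = \<sigma> g\<^sub>i\<^sub>j - \<tau> P\<^sub>i\<^sub>j\<close> and \<open>\<partial>\<^sub>i \<sigma> = - P\<^sub>i\<^sub>k \<mu>\<^sup>k\<close> with the Schouten tensor \<open>P\<close>.\<close>

fun tractor :: "'n \<Rightarrow> 'n option option \<Rightarrow> 'n option option \<Rightarrow> real^'n \<Rightarrow> real" where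
  "tractor i None None = (\<lambda>x. 0)"
| "tractor i None (Some None) = (\<lambda>x. 0)"
| "tractor i None (Some (Some k)) = (\<lambda>x. if i = k then 1 else 0)"
| "tractor i (Some None) None = (\<lambda>x. 0)"
| "tractor i (Some None) (Some None) = (\<lambda>x. 0)"
| "tractor i (Some None) (Some (Some k)) = (\<lambda>x. - (\<Sum>p\<in>UNIV. H k p x * schouten i p x))"
| "tractor i (Some (Some j)) None = (\<lambda>x. - schouten i j x)"
| "tractor i (Some (Some j)) (Some None) = (\<lambda>x. G i j x)"
| "tractor i (Some (Some j)) (Some (Some k)) = (\<lambda>x. \<Gamma> k i j x)"

lemma smooth_tractor: "smooth_on S (tractor i a b)"
  by (cases "(i, a, b)" rule: tractor.cases)
    (auto intro!: smooth_intros smooth_schouten simp del: sum_negf)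

text \<open>Nine blocks. The block from \<open>Some (Some _)\<close> to itself is the Weyl tensor
  with one index raised; the two blocks containing derivatives of the Schouten tensor are the Cotton
  tensor, once with an index raised. The other six hold by symmetry of the Schouten tensor, of the
  metric and of \<Gamma>, and by metric compatibility.\<close>

lemma tractor_flat:
  assumes x: "x \<in> S" and card: "CARD('n) > 3"
    and W: "\<And>y i j k l. y \<in> S \<Longrightarrow> weyl g i j k l y = 0"
  shows "partial i (tractor j a b) x + (\<Sum>c\<in>UNIV. tractor j a c x * tractor i c b x) =
    partial j (tractor i a b) x + (\<Sum>c\<in>UNIV. tractor i a c x * tractor j c b x)"
proof -
  let ?P = schouten
  let ?U = "\<lambda>i k x. \<Sum>p\<in>UNIV. H k p x * ?P i p x"
  have dP: "?P i j differentiable (at x)" for i j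
    by (rule smooth_on_imp_differentiable[OF smooth_schouten x])
  have dU: "?U i j differentiable (at x)" for i j
    by (intro smooth_on_imp_differentiable[OF _ x] smooth_intros smooth_schouten)
  note P = schouten_sym[OF x]
  note \<Gamma> = \<Gamma>_sym[OF x]
  note C = cotton_zero[OF x card W]
  have lower: "(\<Sum>k\<in>UNIV. G l k y * ?U i k y) = ?P i l y" if y: "y \<in> S" for i l y
  proof -
    have "(\<Sum>k\<in>UNIV. G l k y * ?U i k y) = (\<Sum>p\<in>UNIV. (\<Sum>k\<in>UNIV. G l k y * H k p y) * ?P i p y)"
      unfolding sum_distrib_left sum_distrib_right by (subst sum.swap) (simp add: mult_ac)
    then show ?thesis by (simp add: GH[OF y] sum_delta_mult)
  qed
  \<comment> \<open>Equations with a raised index are checked after lowering it, since the Cotton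
    and Weyl identities are available in lowered form.\<close>
  have inj: "f k = h k" if "\<And>l. (\<Sum>k\<in>UNIV. G l k x * f k) = (\<Sum>k\<in>UNIV. G l k x * h k)" for f h k
  proof -
    have raise: "(\<Sum>l\<in>UNIV. H k l x * (\<Sum>j\<in>UNIV. G l j x * f j)) = f k" for f
    proof -
      have "(\<Sum>l\<in>UNIV. H k l x * (\<Sum>j\<in>UNIV. G l j x * f j)) = (\<Sum>j\<in>UNIV. (\<Sum>l\<in>UNIV. H k l x * G l j x) * f j)"
        unfolding sum_distrib_left sum_distrib_right by (subst sum.swap) (simp add: mult_ac)
      then show ?thesis by (simp add: HG[OF x] sum_delta_mult)
    qed
    show ?thesis using raise[of f] raise[of h] that by simp
  qed
  have dUl: "(\<Sum>k\<in>UNIV. G l k x * (partial i (?U j k) x + (\<Sum>p\<in>UNIV. ?U j p x * \<Gamma> k i p x)))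
      = partial i (?P j l) x - (\<Sum>p\<in>UNIV. \<Gamma> p i l x * ?P j p x)" for i j l
  proof -
    have "partial i (?P j l) x = partial i (\<lambda>y. \<Sum>k\<in>UNIV. G l k y * ?U j k y) x"
      by (rule partial_cong[OF open_S x]) (rule lower[symmetric])
    also have "\<dots> = (\<Sum>k\<in>UNIV. partial i (G l k) x * ?U j k x) + (\<Sum>k\<in>UNIV. G l k x * partial i (?U j k) x)"
      using differentiable[OF x] dU by (simp only: partial_sum partial_mult sum.distrib differentiable_mult)
    also have "(\<Sum>k\<in>UNIV. partial i (G l k) x * ?U j k x)
      = (\<Sum>k\<in>UNIV. (\<Sum>p\<in>UNIV. \<Gamma> p i l x * G p k x) * ?U j k x) + (\<Sum>k\<in>UNIV. (\<Sum>p\<in>UNIV. \<Gamma> p i k x * G l p x) * ?U j k x)"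
      unfolding partial_G[OF x] by (simp only: distrib_right sum.distrib)
    also have "(\<Sum>k\<in>UNIV. (\<Sum>p\<in>UNIV. \<Gamma> p i l x * G p k x) * ?U j k x) = (\<Sum>p\<in>UNIV. \<Gamma> p i l x * (\<Sum>k\<in>UNIV. G p k x * ?U j k x))"
    proof -
      have "(\<Sum>k\<in>UNIV. (\<Sum>p\<in>UNIV. b p * a p k) * u k) = (\<Sum>p\<in>UNIV. b p * (\<Sum>k\<in>UNIV. a p k * u k))"
        for a and b u :: "'n \<Rightarrow> real"
        unfolding sum_distrib_left sum_distrib_right by (subst sum.swap) (simp add: mult_ac)
      then show ?thesis .
    qed
    also have "(\<Sum>k\<in>UNIV. (\<Sum>p\<in>UNIV. \<Gamma> p i k x * G l p x) * ?U j k x) = (\<Sum>k\<in>UNIV. G l k x * (\<Sum>p\<in>UNIV. ?U j p x * \<Gamma> k i p x))"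
    proof -
      have "(\<Sum>k\<in>UNIV. (\<Sum>p\<in>UNIV. a p k * b p) * u k) = (\<Sum>k\<in>UNIV. b k * (\<Sum>p\<in>UNIV. u p * a k p))"
        for a and b u :: "'n \<Rightarrow> real"
        unfolding sum_distrib_left sum_distrib_right by (subst sum.swap) (simp add: mult_ac)
      then show ?thesis .
    qed
    finally show ?thesis unfolding lower[OF x] by (simp add: distrib_left sum.distrib)
  qed
  have C': "partial i (?U j k) x + (\<Sum>p\<in>UNIV. ?U j p x * \<Gamma> k i p x)
      = partial j (?U i k) x + (\<Sum>p\<in>UNIV. ?U i p x * \<Gamma> k j p x)" for k
    by (rule inj) (simp only: dUl C)
  have UP: "(\<Sum>k\<in>UNIV. ?U j k x * ?P i k x) = (\<Sum>k\<in>UNIV. ?U i k x * ?P j k x)" for i j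
    unfolding sum_distrib_right by (subst sum.swap) (simp add: mult_ac H_sym[OF x])
  have UG: "(\<Sum>k\<in>UNIV. ?U j k x * G i k x) = ?P i j x" for i j
    using lower[OF x, of i j] P[of j i] by (simp add: mult.commute)
  have curv: "half_curv i j k l x - ?P j l x * (if i = k then 1 else 0) - G j l x * ?U i k x =
      half_curv j i k l x - ?P i l x * (if j = k then 1 else 0) - G i l x * ?U j k x" for k l
  proof -
    define f where "f k = half_curv i j k l x - ?P j l x * (if i = k then 1 else 0) - G j l x * ?U i k x
       - (half_curv j i k l x - ?P i l x * (if j = k then 1 else 0) - G i l x * ?U j k x)" for k
    have "f k = 0"
    proof (rule inj)
      fix m
      have "(\<Sum>k\<in>UNIV. G m k x * f k) = (\<Sum>k\<in>UNIV. G m k x * curv i j k l x)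
        - ?P j l x * (\<Sum>k\<in>UNIV. G m k x * (if i = k then 1 else 0)) - G j l x * (\<Sum>k\<in>UNIV. G m k x * ?U i k x)
        + ?P i l x * (\<Sum>k\<in>UNIV. G m k x * (if j = k then 1 else 0)) + G i l x * (\<Sum>k\<in>UNIV. G m k x * ?U j k x)"
      proof -
        have "(\<Sum>k\<in>UNIV. w k * (a k - p * d k - q * u k - (a' k - p' * d' k - q' * u' k)))
          = (\<Sum>k\<in>UNIV. w k * (a k - a' k)) - p * (\<Sum>k\<in>UNIV. w k * d k) - q * (\<Sum>k\<in>UNIV. w k * u k)
            + p' * (\<Sum>k\<in>UNIV. w k * d' k) + q' * (\<Sum>k\<in>UNIV. w k * u' k)"
          for w a a' d d' u u' :: "'n \<Rightarrow> real" and p p' q q'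
          by (simp add: algebra_simps sum.distrib sum_subtractf sum_distrib_left)
        then show ?thesis unfolding f_def curv_def .
      qed
      also have "\<dots> = R i j m l x - ?P j l x * G m i x - G j l x * ?P i m x + ?P i l x * G m j x + G i l x * ?P j m x"
        unfolding lower[OF x] riemann_curv sum_delta_mult ..
      also have "\<dots> = 0"
        using riemann_schouten[OF x _ W[OF x], of i j m l] card G_sym[OF x, of m] by (simp add: mult_ac)
      finally show "(\<Sum>k\<in>UNIV. G m k x * f k) = (\<Sum>k\<in>UNIV. G m k x * 0)" by simp
    qed
    then show ?thesis unfolding f_def by linarith
  qed
  show ?thesis
  proof (cases "(i, a, b)" rule: tractor.cases)
    case (1 i')
    then show ?thesis using P[of i j] by (simp add: sum_UNIV_option_option sum_delta_mult sum_negf)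
  next
    case (2 i')
    then show ?thesis using G_sym[OF x, of i j] by (simp add: sum_UNIV_option_option sum_delta_mult)
  next
    case (3 i' k)
    then show ?thesis using \<Gamma>[of k i j] by (simp add: sum_UNIV_option_option sum_delta_mult)
  next
    case (4 i')
    then show ?thesis using UP[of i j] by (simp add: sum_UNIV_option_option)
  next
    case (5 i')
    then show ?thesis using UG[of i j] UG[of j i] P[of i j] by (simp add: sum_UNIV_option_option sum_negf)
  next
    case (6 i' k)
    then show ?thesis using C'[of k] dU by (simp add: sum_UNIV_option_option sum_negf partial_minus)
  next
    case (7 i' l)
    then show ?thesis using C[of i j l] dP by (simp add: sum_UNIV_option_option sum_negf partial_minus mult.commute)
  next
    case (8 i' l)
    have "(\<Sum>m\<in>UNIV. \<Gamma> m i j x * G m l x) = (\<Sum>m\<in>UNIV. \<Gamma> m j i x * G m l x)"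
      by (intro sum.cong refl) (simp only: \<Gamma>[of _ i j])
    with 8 show ?thesis
      using partial_G[OF x, of i j l] partial_G[OF x, of j i l]
      by (simp add: sum_UNIV_option_option)
  next
    case (9 i' l k)
    then show ?thesis using curv[of k l] unfolding half_curv_def
      by (simp add: sum_UNIV_option_option mult.commute)
  qed
qed


definition tractor_parallel :: "(real^'n) set \<Rightarrow> ('n option option \<Rightarrow> real^'n \<Rightarrow> real) \<Rightarrow> bool" where
  "tractor_parallel B F \<longleftrightarrow> (\<forall>a. smooth_on B (F a)) \<and>
     (\<forall>i a. \<forall>x\<in>B. partial i (F a) x = (\<Sum>b\<in>UNIV. tractor i a b x * F b x))"

text \<open>The tractor metric, of signature (n+1, 1): the inverse metric on the differentials plus
  a hyperbolic pairing of the scale with the remaining scalar.\<close>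

definition tractor_form ::
  "('n option option \<Rightarrow> real^'n \<Rightarrow> real) \<Rightarrow> ('n option option \<Rightarrow> real^'n \<Rightarrow> real) \<Rightarrow> real^'n \<Rightarrow> real" where
  "tractor_form F F' x =
     (\<Sum>k\<in>UNIV. \<Sum>l\<in>UNIV. H k l x * (F (Some (Some k)) x * F' (Some (Some l)) x))
     - F None x * F' (Some None) x - F' None x * F (Some None) x"

lemma tractor_parallelD:
  assumes "tractor_parallel B F"
  shows "smooth_on B (F a)"
    and "x \<in> B \<Longrightarrow> partial i (F None) x = F (Some (Some i)) x"
    and "x \<in> B \<Longrightarrow> partial i (F (Some None)) x =
       - (\<Sum>k\<in>UNIV. (\<Sum>p\<in>UNIV. H k p x * schouten i p x) * F (Some (Some k)) x)"
    and "x \<in> B \<Longrightarrow> partial i (F (Some (Some j))) x =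
       - schouten i j x * F None x + G i j x * F (Some None) x + (\<Sum>k\<in>UNIV. \<Gamma> k i j x * F (Some (Some k)) x)"
  using assms unfolding tractor_parallel_def
  by (simp_all add: sum_UNIV_option_option sum_delta_mult sum_negf)

text \<open>The tractor connection preserves the tractor metric. The \<Gamma> terms cancel against
  the derivative of \<open>H\<close>, the Schouten terms of the differential against those of the
  scalar, and the metric terms against the derivative of the scale.\<close>

lemma partial_tractor_form:
  assumes B: "open B" "B \<subseteq> S" and x: "x \<in> B"
    and F: "tractor_parallel B F" and F': "tractor_parallel B F'"
  shows "partial i (tractor_form F F') x = 0"
proof -
  have xS: "x \<in> S" using B x by blast
  note d = smooth_on_imp_differentiable[OF tractor_parallelD(1)[OF F] x]
    smooth_on_imp_differentiable[OF tractor_parallelD(1)[OF F'] x] differentiable[OF xS]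
  define \<mu> \<tau> \<sigma> where "\<mu> k = F (Some (Some k)) x" and "\<tau> = F None x" and "\<sigma> = F (Some None) x" for k
  define \<mu>' \<tau>' \<sigma>' where "\<mu>' k = F' (Some (Some k)) x" and "\<tau>' = F' None x" and "\<sigma>' = F' (Some None) x" for k
  define P where "P k = (\<Sum>p\<in>UNIV. H k p x * schouten i p x)" for k
  define m where "m k = (\<Sum>p\<in>UNIV. \<Gamma> p i k x * \<mu> p)" for k
  define m' where "m' k = (\<Sum>p\<in>UNIV. \<Gamma> p i k x * \<mu>' p)" for k
  let ?B = "\<lambda>f. \<Sum>k\<in>UNIV. \<Sum>l\<in>UNIV. H k l x * f k l"
  have HP: "(\<Sum>l\<in>UNIV. H k l x * schouten i l x) = P k" for k by (simp add: P_def)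
  have HP': "(\<Sum>k\<in>UNIV. H k l x * schouten i k x) = P l" for l
    unfolding P_def using H_sym[OF xS] by simp
  have HG1: "(\<Sum>l\<in>UNIV. H k l x * G i l x) = (if k = i then 1 else 0)" for k
    using HG[OF xS, of k i] G_sym[OF xS, of i] by simp
  have HG2: "(\<Sum>k\<in>UNIV. H k l x * G i k x) = (if l = i then 1 else 0)" for l
    using HG1[of l] H_sym[OF xS, of l] by simp
  have B1: "?B (\<lambda>k l. a k * c l) = (\<Sum>k\<in>UNIV. a k * (\<Sum>l\<in>UNIV. H k l x * c l))" for a c
    by (simp add: sum_distrib_left mult_ac)
  have B2: "?B (\<lambda>k l. a k * c l) = (\<Sum>l\<in>UNIV. c l * (\<Sum>k\<in>UNIV. H k l x * a k))" for a c
    by (subst sum.swap) (simp add: sum_distrib_left mult_ac)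
  have dH: "(\<Sum>k\<in>UNIV. \<Sum>l\<in>UNIV. partial i (H k l) x * (\<mu> k * \<mu>' l))
      = - ?B (\<lambda>k l. m k * \<mu>' l) - ?B (\<lambda>k l. \<mu> k * m' l)"
  proof -
    have 1: "(\<Sum>k\<in>UNIV. \<Sum>l\<in>UNIV. \<Sum>p\<in>UNIV. \<Gamma> k i p x * H p l x * (\<mu> k * \<mu>' l)) = ?B (\<lambda>k l. m k * \<mu>' l)"
      by (subst sum3_reverse) (simp add: m_def sum_distrib_left sum_distrib_right mult_ac)
    have 2: "(\<Sum>k\<in>UNIV. \<Sum>l\<in>UNIV. \<Sum>p\<in>UNIV. \<Gamma> l i p x * H k p x * (\<mu> k * \<mu>' l)) = ?B (\<lambda>k l. \<mu> k * m' l)"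
    proof -
      have "(\<Sum>k\<in>UNIV. \<Sum>l\<in>UNIV. \<Sum>p\<in>UNIV. \<Gamma> l i p x * H k p x * (\<mu> k * \<mu>' l))
        = (\<Sum>k\<in>UNIV. \<Sum>p\<in>UNIV. \<Sum>l\<in>UNIV. \<Gamma> l i p x * H k p x * (\<mu> k * \<mu>' l))"
        by (rule sum.cong[OF refl], rule sum.swap)
      then show ?thesis by (simp add: m'_def sum_distrib_left mult_ac)
    qed
    show ?thesis
      unfolding partial_H[OF xS] 1[symmetric] 2[symmetric]
      by (simp add: left_diff_distrib sum_subtractf sum_distrib_right sum_negf)
  qed
  have dF: "partial i (F (Some (Some k))) x = - \<tau> * schouten i k x + \<sigma> * G i k x + m k" for k
    using tractor_parallelD(4)[OF F x] by (simp add: \<mu>_def \<tau>_def \<sigma>_def m_def)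
  have dF': "partial i (F' (Some (Some k))) x = - \<tau>' * schouten i k x + \<sigma>' * G i k x + m' k" for k
    using tractor_parallelD(4)[OF F' x] by (simp add: \<mu>'_def \<tau>'_def \<sigma>'_def m'_def)
  have 1: "?B (\<lambda>k l. partial i (F (Some (Some k))) x * \<mu>' l) = - \<tau> * (\<Sum>k\<in>UNIV. \<mu>' k * P k) + \<sigma> * \<mu>' i + ?B (\<lambda>k l. m k * \<mu>' l)"
  proof -
    have "?B (\<lambda>k l. partial i (F (Some (Some k))) x * \<mu>' l)
      = - \<tau> * ?B (\<lambda>k l. schouten i k x * \<mu>' l) + \<sigma> * ?B (\<lambda>k l. G i k x * \<mu>' l) + ?B (\<lambda>k l. m k * \<mu>' l)"
      unfolding dF by (simp add: algebra_simps sum.distrib sum_subtractf sum_distrib_left sum_negf)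
    then show ?thesis unfolding B2[of "\<lambda>k. schouten i k x"] B2[of "\<lambda>k. G i k x"] HP' HG2 sum_delta_mult .
  qed
  have 2: "?B (\<lambda>k l. \<mu> k * partial i (F' (Some (Some l))) x) = - \<tau>' * (\<Sum>k\<in>UNIV. \<mu> k * P k) + \<sigma>' * \<mu> i + ?B (\<lambda>k l. \<mu> k * m' l)"
  proof -
    have "?B (\<lambda>k l. \<mu> k * partial i (F' (Some (Some l))) x)
      = - \<tau>' * ?B (\<lambda>k l. \<mu> k * schouten i l x) + \<sigma>' * ?B (\<lambda>k l. \<mu> k * G i l x) + ?B (\<lambda>k l. \<mu> k * m' l)"
      unfolding dF' by (simp add: algebra_simps sum.distrib sum_subtractf sum_distrib_left sum_negf)
    then show ?thesis unfolding B1[of \<mu> "\<lambda>l. schouten i l x"] B1[of \<mu> "\<lambda>l. G i l x"] HP HG1 sum_delta_mult .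
  qed
  have "partial i (tractor_form F F') x =
      (\<Sum>k\<in>UNIV. \<Sum>l\<in>UNIV. partial i (H k l) x * (\<mu> k * \<mu>' l)) + ?B (\<lambda>k l. partial i (F (Some (Some k))) x * \<mu>' l)
      + ?B (\<lambda>k l. \<mu> k * partial i (F' (Some (Some l))) x)
      - (partial i (F None) x * \<sigma>' + \<tau> * partial i (F' (Some None)) x)
      - (partial i (F' None) x * \<sigma> + \<tau>' * partial i (F (Some None)) x)"
    unfolding tractor_form_def[abs_def] \<mu>_def \<tau>_def \<sigma>_def \<mu>'_def \<tau>'_def \<sigma>'_def using d
    by (simp add: partial_diff partial_sum partial_mult sum.distrib distrib_left)
  also have "\<dots> = 0"
    unfolding dH 1 2 tractor_parallelD(2)[OF F x] tractor_parallelD(2)[OF F' x]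
      tractor_parallelD(3)[OF F x] tractor_parallelD(3)[OF F' x]
      \<mu>_def[symmetric] \<tau>_def[symmetric] \<sigma>_def[symmetric] \<mu>'_def[symmetric] \<tau>'_def[symmetric] \<sigma>'_def[symmetric] P_def[symmetric]
    by (simp add: mult.commute)
  finally show ?thesis .
qed

lemma tractor_form_constant:
  assumes B: "ball x0 r \<subseteq> S" and x: "x \<in> ball x0 r"
    and F: "tractor_parallel (ball x0 r) F" and F': "tractor_parallel (ball x0 r) F'"
  shows "tractor_form F F' x = tractor_form F F' x0"
proof -
  let ?B = "ball x0 r"
  have "smooth_on ?B (tractor_form F F')"
    unfolding tractor_form_def[abs_def]
    using tractor_parallelD(1)[OF F] tractor_parallelD(1)[OF F'] smooth_on_subset[OF smooth_H B]
    by (intro smooth_on_diff smooth_on_sum smooth_on_mult open_ball) auto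
  then have "(tractor_form F F' has_derivative (\<lambda>h. 0)) (at y within ?B)" if "y \<in> ?B" for y
    using has_derivative_partial[OF smooth_on_imp_differentiable[OF _ that], of "tractor_form F F'"]
      partial_tractor_form[OF open_ball B that F F'] has_derivative_at_withinI by simp
  from has_derivative_zero_constant[OF convex_ball this]
  obtain c where "\<And>y. y \<in> ?B \<Longrightarrow> tractor_form F F' y = c" by blast
  moreover have "x0 \<in> ?B" using x zero_le_dist[of x0 x] by (simp del: zero_le_dist)
  ultimately show ?thesis using x by simp
qed

text \<open>Quotients of parallel tractors by a null one are coordinates in which \<open>\<tau>\<^sup>-\<^sup>2 g\<close> has constant
  coefficients.\<close>

theorem conformally_flat_coordinates:
  assumes x0: "x0 \<in> S" and card: "CARD('n) > 3"
    and W: "\<And>y i j k l. y \<in> S \<Longrightarrow> weyl g i j k l y = 0"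
  obtains r \<tau> and y :: "'n \<Rightarrow> real^'n \<Rightarrow> real" where "r > 0" "ball x0 r \<subseteq> S"
    "smooth_on (ball x0 r) \<tau>" "\<And>x. x \<in> ball x0 r \<Longrightarrow> \<tau> x > 0" "\<And>a. smooth_on (ball x0 r) (y a)"
    "\<And>x i j. x \<in> ball x0 r \<Longrightarrow> G i j x / (\<tau> x)\<^sup>2 =
       (\<Sum>a\<in>UNIV. \<Sum>b\<in>UNIV. G a b x0 * (partial i (y a) x * partial j (y b) x))"
proof -
  obtain r1 where r1: "r1 > 0" "ball x0 r1 \<subseteq> S"
    and ex: "\<And>F0. \<exists>F. (\<forall>a. F a x0 = F0 a \<and> smooth_on (ball x0 r1) (F a)) \<and>
      (\<forall>i a. \<forall>x\<in>ball x0 r1. partial i (F a) x = (\<Sum>b\<in>UNIV. tractor i a b x * F b x))"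
  proof (rule linear_total_system[OF open_S x0 smooth_tractor])
    show "partial i (tractor j a b) x + (\<Sum>c\<in>UNIV. tractor j a c x * tractor i c b x) =
      partial j (tractor i a b) x + (\<Sum>c\<in>UNIV. tractor i a c x * tractor j c b x)" if "x \<in> S" for i j a b x
      using tractor_flat[OF that card W] by blast
  qed (rule that)
  define sol where "sol F0 = (SOME F. (\<forall>a. F a x0 = F0 a) \<and> tractor_parallel (ball x0 r1) F)" for F0
  have sol: "sol F0 a x0 = F0 a" "tractor_parallel (ball x0 r1) (sol F0)" for F0 a
  proof -
    obtain F where "(\<forall>a. F a x0 = F0 a \<and> smooth_on (ball x0 r1) (F a)) \<and>
      (\<forall>i a. \<forall>x\<in>ball x0 r1. partial i (F a) x = (\<Sum>b\<in>UNIV. tractor i a b x * F b x))"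
      using ex[of F0] by (rule exE)
    then have "(\<forall>a. F a x0 = F0 a) \<and> tractor_parallel (ball x0 r1) F"
      unfolding tractor_parallel_def by simp
    from someI[of "\<lambda>F. (\<forall>a. F a x0 = F0 a) \<and> tractor_parallel (ball x0 r1) F", OF this]
    show "sol F0 a x0 = F0 a" "tractor_parallel (ball x0 r1) (sol F0)"
      unfolding sol_def by simp_all
  qed
  \<comment> \<open>At \<open>x0\<close>, \<open>N\<close> has scale 1 and nothing else, hence is
    null; \<open>T a\<close> is the a-th coordinate covector, hence orthogonal to \<open>N\<close>,
    and the mutual products are \<open>H a b x0\<close>. These values persist because the tractor
    metric is constant on parallel sections.\<close>
  define N where "N = sol (\<lambda>b. if b = None then 1 else 0)"
  define T where "T a = sol (\<lambda>b. if b = Some (Some a) then 1 else 0)" for a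
  note pN = sol(2)[of "\<lambda>b. if b = None then 1 else 0", folded N_def]
  note pT = sol(2)[of "\<lambda>b. if b = Some (Some a) then 1 else 0" for a, folded T_def]
  have N0: "N b x0 = (if b = None then 1 else 0)" for b by (simp add: N_def sol)
  have T0: "T a b x0 = (if b = Some (Some a) then 1 else 0)" for a b by (simp add: T_def sol)
  have QNN: "tractor_form N N x = 0" and QNT: "tractor_form N (T a) x = 0" and QTN: "tractor_form (T a) N x = 0"
    and QTT: "tractor_form (T a) (T b) x = H a b x0" if "x \<in> ball x0 r1" for x a b
    unfolding tractor_form_constant[OF r1(2) that pN pN] tractor_form_constant[OF r1(2) that pN pT]
      tractor_form_constant[OF r1(2) that pT pN] tractor_form_constant[OF r1(2) that pT pT]
    by (simp_all add: tractor_form_def N0 T0 if_distrib[of "\<lambda>t. t * _"] if_distrib[of "\<lambda>t. _ * t"] cong: if_cong)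
  define \<tau> where "\<tau> = N None"
  have s\<tau>: "smooth_on (ball x0 r1) \<tau>" unfolding \<tau>_def by (rule tractor_parallelD(1)[OF pN])
  have "open {x \<in> ball x0 r1. \<tau> x \<in> {0<..}}"
    using continuous_open_preimage[OF smooth_on_imp_continuous_on[OF s\<tau>] open_ball open_greaterThan[of 0]]
    by (simp add: vimage_def Int_def)
  moreover have "x0 \<in> {x \<in> ball x0 r1. \<tau> x \<in> {0<..}}" using r1(1) by (simp add: \<tau>_def N0)
  ultimately obtain r where r: "r > 0" "ball x0 r \<subseteq> {x \<in> ball x0 r1. \<tau> x \<in> {0<..}}" using openE by blast
  have sub: "ball x0 r \<subseteq> ball x0 r1" and pos: "\<And>x. x \<in> ball x0 r \<Longrightarrow> \<tau> x > 0" using r(2) by auto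
  define y where "y a = (\<lambda>x. T a None x * inverse (\<tau> x))" for a
  have nz: "\<tau> x \<noteq> 0" if "x \<in> ball x0 r" for x using pos[OF that] by simp
  have s\<tau>r: "smooth_on (ball x0 r) \<tau>" by (rule smooth_on_subset[OF s\<tau> sub])
  have sT: "smooth_on (ball x0 r) (T a b)" for a b
    by (rule smooth_on_subset[OF tractor_parallelD(1)[OF pT] sub])
  have sy: "smooth_on (ball x0 r) (y a)" for a
    unfolding y_def by (intro smooth_on_mult smooth_on_inverse sT s\<tau>r nz open_ball)
  have main: "G i j x / (\<tau> x)\<^sup>2 = (\<Sum>a\<in>UNIV. \<Sum>b\<in>UNIV. G a b x0 * (partial i (y a) x * partial j (y b) x))"
    if x: "x \<in> ball x0 r" for x i j
  proof -
    have x1: "x \<in> ball x0 r1" and xS: "x \<in> S" using x sub r1(2) by auto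
    \<comment> \<open>The differential part of T_a - y_a N. The scale part of this tractor is zero
      by the choice of \<open>y\<close>, so on such tractors the form reduces to the inverse metric
      of \<open>d\<close>; since \<open>N\<close> is null and orthogonal to every
      \<open>T a\<close>, its value is still \<open>H a b x0\<close>.\<close>
    define d where "d a i = T a (Some (Some i)) x - y a x * N (Some (Some i)) x" for a i
    have dy: "partial i (y a) x = d a i / \<tau> x" for a i
    proof -
      have "partial i (y a) x = partial i (T a None) x * inverse (\<tau> x)
          + T a None x * - (partial i \<tau> x * (inverse (\<tau> x) * inverse (\<tau> x)))"
        unfolding y_def
        using smooth_on_imp_differentiable[OF sT x] smooth_on_imp_differentiable[OF s\<tau>r x]
          smooth_on_imp_differentiable[OF smooth_on_inverse[OF open_ball s\<tau>r nz] x] nz[OF x]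
        by (simp add: partial_mult partial_inverse)
      also have "partial i \<tau> x = N (Some (Some i)) x"
        unfolding \<tau>_def by (rule tractor_parallelD(2)[OF pN x1])
      also have "partial i (T a None) x = T a (Some (Some i)) x"
        by (rule tractor_parallelD(2)[OF pT x1])
      finally show ?thesis using nz[OF x] by (simp add: d_def y_def field_simps)
    qed
    have dHd: "(\<Sum>k\<in>UNIV. \<Sum>l\<in>UNIV. H k l x * (d a k * d b l)) = H a b x0" for a b
    proof -
      let ?B = "\<lambda>F F'. \<Sum>k\<in>UNIV. \<Sum>l\<in>UNIV. H k l x * (F (Some (Some k)) x * F' (Some (Some l)) x)"
      have B: "?B F F' = tractor_form F F' x + F None x * F' (Some None) x + F' None x * F (Some None) x" for F F'
        by (simp add: tractor_form_def)
      have "(\<Sum>k\<in>UNIV. \<Sum>l\<in>UNIV. H k l x * (d a k * d b l))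
        = ?B (T a) (T b) - y b x * ?B (T a) N - y a x * ?B N (T b) + y a x * y b x * ?B N N"
        by (simp add: d_def algebra_simps sum.distrib sum_subtractf sum_distrib_left)
      also have "\<dots> = H a b x0"
        unfolding B QTT[OF x1] QTN[OF x1] QNT[OF x1] QNN[OF x1] \<tau>_def[symmetric]
        using nz[OF x] by (simp add: y_def field_simps)
      finally show ?thesis .
    qed
    \<comment> \<open>\<open>dHd\<close> reads d H d^T = H(x0), so Y = H d^T G(x0) is a right
      inverse of \<open>d\<close>, hence a left inverse. This turns the identity around into G = d^T
      G(x0) d.\<close>
    define Y where "Y k c = (\<Sum>b\<in>UNIV. (\<Sum>l\<in>UNIV. H k l x * d b l) * G b c x0)" for k c
    have "(\<Sum>k\<in>UNIV. d a k * Y k c) = (if a = c then 1 else 0)" for a c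
    proof -
      have "(\<Sum>k\<in>UNIV. d a k * Y k c) = (\<Sum>b\<in>UNIV. (\<Sum>k\<in>UNIV. \<Sum>l\<in>UNIV. H k l x * (d a k * d b l)) * G b c x0)"
        unfolding Y_def sum_distrib_left sum_distrib_right
        by (subst sum.swap) (simp add: mult_ac)
      then show ?thesis by (simp add: dHd GH[OF x0] HG[OF x0])
    qed
    note inv = sum_inverse_commute[OF this]
    define Z where "Z i j = (\<Sum>a\<in>UNIV. \<Sum>b\<in>UNIV. G a b x0 * (d a i * d b j))" for i j
    have HZ: "(\<Sum>l\<in>UNIV. H k l x * Z l j) = (if k = j then 1 else 0)" for k j
    proof -
      have "(\<Sum>l\<in>UNIV. H k l x * Z l j) = (\<Sum>l\<in>UNIV. \<Sum>a\<in>UNIV. \<Sum>b\<in>UNIV. H k l x * d a l * G a b x0 * d b j)"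
        by (simp add: Z_def sum_distrib_left mult_ac)
      also have "\<dots> = (\<Sum>b\<in>UNIV. \<Sum>a\<in>UNIV. \<Sum>l\<in>UNIV. H k l x * d a l * G a b x0 * d b j)"
        by (rule sum3_reverse)
      also have "\<dots> = (\<Sum>b\<in>UNIV. Y k b * d b j)"
        by (simp add: Y_def sum_distrib_right)
      finally show ?thesis by (simp add: inv)
    qed
    have "Z i j = (\<Sum>l\<in>UNIV. (\<Sum>k\<in>UNIV. G i k x * H k l x) * Z l j)" by (simp add: GH[OF xS] sum_delta_mult)
    also have "\<dots> = (\<Sum>k\<in>UNIV. G i k x * (\<Sum>l\<in>UNIV. H k l x * Z l j))"
      unfolding sum_distrib_left sum_distrib_right by (subst sum.swap) (simp add: mult_ac)
    also have "\<dots> = G i j x" by (simp add: HZ sum_delta_mult)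
    finally have "G i j x = Z i j" by simp
    then show ?thesis
      unfolding Z_def dy by (simp add: sum_divide_distrib power2_eq_square)
  qed
  show ?thesis
    by (rule that[OF r(1) _ s\<tau>r pos sy main]) (use sub r1(2) in auto)
qed

text \<open>With J the Jacobian of \<open>y\<close>, uniqueness of the connection forces \<Gamma> to
  be J^{-1} applied to the second derivatives of \<open>y\<close>. Then commuting the third
  derivatives of \<open>y\<close> gives J applied to the curvature equal to zero, and J is
  invertible.\<close>

lemma riemann_zero_if_constant_coefficients:
  fixes y :: "'n \<Rightarrow> real^'n \<Rightarrow> real" and K :: "'n \<Rightarrow> 'n \<Rightarrow> real"
  assumes y: "\<And>a. smooth_on S (y a)"
    and eq: "\<And>x i j. x \<in> S \<Longrightarrow> G i j x =
       (\<Sum>a\<in>UNIV. \<Sum>b\<in>UNIV. K a b * (partial i (y a) x * partial j (y b) x))"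
    and x: "x \<in> S"
  shows "R i j k l x = 0"
proof -
  \<comment> \<open>The inverse of the Jacobian, read off from G = J^T K J as G^{-1} J^T K.\<close>
  define L where "L i b x = (\<Sum>k\<in>UNIV. \<Sum>a\<in>UNIV. H i k x * K a b * partial k (y a) x)" for i b x
  have LJ: "(\<Sum>b\<in>UNIV. L i b x * partial j (y b) x) = (if i = j then 1 else 0)" if x: "x \<in> S" for i j x
  proof -
    have "(\<Sum>b\<in>UNIV. L i b x * partial j (y b) x)
        = (\<Sum>b\<in>UNIV. \<Sum>k\<in>UNIV. \<Sum>a\<in>UNIV. H i k x * K a b * partial k (y a) x * partial j (y b) x)"
      by (simp add: L_def sum_distrib_right)
    also have "\<dots> = (\<Sum>k\<in>UNIV. \<Sum>b\<in>UNIV. \<Sum>a\<in>UNIV. H i k x * K a b * partial k (y a) x * partial j (y b) x)"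
      by (rule sum.swap)
    also have "\<dots> = (\<Sum>k\<in>UNIV. \<Sum>a\<in>UNIV. \<Sum>b\<in>UNIV. H i k x * K a b * partial k (y a) x * partial j (y b) x)"
      by (rule sum.cong[OF refl], rule sum.swap)
    also have "\<dots> = (\<Sum>k\<in>UNIV. H i k x * G k j x)"
      by (simp add: eq[OF x] sum_distrib_left mult_ac)
    finally show ?thesis by (simp add: HG[OF x])
  qed
  note JL = sum_inverse_commute[OF LJ]
  have dJ: "partial i (y a) differentiable (at x)" if "x \<in> S" for i a x
    by (rule smooth_on_imp_differentiable[OF smooth_on_partial[OF y] that])
  have \<Gamma>: "\<Gamma> m i j x = (\<Sum>c\<in>UNIV. L m c x * partial i (partial j (y c)) x)" if x: "x \<in> S" for m i j x
  proof (rule \<Gamma>_unique[OF x])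
    show "(\<Sum>c\<in>UNIV. L m c x * partial i (partial j (y c)) x) = (\<Sum>c\<in>UNIV. L m c x * partial j (partial i (y c)) x)" for m i j
      using partial_commute[OF open_S x y, of i j] by simp
    fix k i j
    let ?D = "\<lambda>i c. partial k (partial i (y c)) x"
    have JLD: "(\<Sum>m\<in>UNIV. partial m (y a) x * (\<Sum>c\<in>UNIV. L m c x * ?D i c)) = ?D i a" for i a
    proof -
      have "(\<Sum>m\<in>UNIV. partial m (y a) x * (\<Sum>c\<in>UNIV. L m c x * ?D i c))
        = (\<Sum>c\<in>UNIV. (\<Sum>m\<in>UNIV. partial m (y a) x * L m c x) * ?D i c)"
        unfolding sum_distrib_left sum_distrib_right by (subst sum.swap) (simp add: mult_ac)
      then show ?thesis by (simp add: JL[OF x] sum_delta_mult)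
    qed
    have "partial k (G i j) x = partial k (\<lambda>x. \<Sum>a\<in>UNIV. \<Sum>b\<in>UNIV. K a b * (partial i (y a) x * partial j (y b) x)) x"
      by (rule partial_cong[OF open_S x]) (rule eq)
    also have "\<dots> = (\<Sum>a\<in>UNIV. \<Sum>b\<in>UNIV. K a b * (?D i a * partial j (y b) x))
        + (\<Sum>a\<in>UNIV. \<Sum>b\<in>UNIV. K a b * (partial i (y a) x * ?D j b))"
      using dJ[OF x] by (simp add: partial_sum partial_mult sum.distrib distrib_left)
    also have "(\<Sum>a\<in>UNIV. \<Sum>b\<in>UNIV. K a b * (?D i a * partial j (y b) x))
       = (\<Sum>m\<in>UNIV. (\<Sum>c\<in>UNIV. L m c x * ?D i c) * G m j x)"
    proof -
      have "(\<Sum>m\<in>UNIV. b m * G m j x) = (\<Sum>a\<in>UNIV. \<Sum>c\<in>UNIV. K a c * ((\<Sum>m\<in>UNIV. partial m (y a) x * b m) * partial j (y c) x))"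
        for b
      proof -
        have "(\<Sum>m\<in>UNIV. b m * G m j x) = (\<Sum>m\<in>UNIV. \<Sum>a\<in>UNIV. \<Sum>c\<in>UNIV. K a c * (partial m (y a) x * b m * partial j (y c) x))"
          by (simp add: eq[OF x] sum_distrib_left mult_ac)
        also have "\<dots> = (\<Sum>a\<in>UNIV. \<Sum>m\<in>UNIV. \<Sum>c\<in>UNIV. K a c * (partial m (y a) x * b m * partial j (y c) x))"
          by (rule sum.swap)
        also have "\<dots> = (\<Sum>a\<in>UNIV. \<Sum>c\<in>UNIV. \<Sum>m\<in>UNIV. K a c * (partial m (y a) x * b m * partial j (y c) x))"
          by (rule sum.cong[OF refl], rule sum.swap)
        finally show ?thesis by (simp add: sum_distrib_left sum_distrib_right)
      qed
      from this[of "\<lambda>m. \<Sum>c\<in>UNIV. L m c x * ?D i c"] show ?thesis unfolding JLD by simp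
    qed
    also have "(\<Sum>a\<in>UNIV. \<Sum>b\<in>UNIV. K a b * (partial i (y a) x * ?D j b))
       = (\<Sum>m\<in>UNIV. (\<Sum>c\<in>UNIV. L m c x * ?D j c) * G i m x)"
    proof -
      have "(\<Sum>m\<in>UNIV. b m * G i m x) = (\<Sum>a\<in>UNIV. \<Sum>c\<in>UNIV. K a c * (partial i (y a) x * (\<Sum>m\<in>UNIV. partial m (y c) x * b m)))"
        for b
      proof -
        have "(\<Sum>m\<in>UNIV. b m * G i m x) = (\<Sum>m\<in>UNIV. \<Sum>a\<in>UNIV. \<Sum>c\<in>UNIV. K a c * (partial i (y a) x * (partial m (y c) x * b m)))"
          by (simp add: eq[OF x] sum_distrib_left mult_ac)
        also have "\<dots> = (\<Sum>a\<in>UNIV. \<Sum>m\<in>UNIV. \<Sum>c\<in>UNIV. K a c * (partial i (y a) x * (partial m (y c) x * b m)))"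
          by (rule sum.swap)
        also have "\<dots> = (\<Sum>a\<in>UNIV. \<Sum>c\<in>UNIV. \<Sum>m\<in>UNIV. K a c * (partial i (y a) x * (partial m (y c) x * b m)))"
          by (rule sum.cong[OF refl], rule sum.swap)
        finally show ?thesis by (simp add: sum_distrib_left)
      qed
      from this[of "\<lambda>m. \<Sum>c\<in>UNIV. L m c x * ?D j c"] show ?thesis unfolding JLD by simp
    qed
    finally show "partial k (G i j) x = (\<Sum>m\<in>UNIV. (\<Sum>c\<in>UNIV. L m c x * ?D i c) * G m j x)
      + (\<Sum>m\<in>UNIV. (\<Sum>c\<in>UNIV. L m c x * ?D j c) * G i m x)" .
  qed
  have hess: "partial i (partial j (y a)) x = (\<Sum>m\<in>UNIV. partial m (y a) x * \<Gamma> m i j x)" if x: "x \<in> S" for i j a x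
  proof -
    have "(\<Sum>m\<in>UNIV. partial m (y a) x * \<Gamma> m i j x)
      = (\<Sum>c\<in>UNIV. (\<Sum>m\<in>UNIV. partial m (y a) x * L m c x) * partial i (partial j (y c)) x)"
      unfolding \<Gamma>[OF x] sum_distrib_left sum_distrib_right by (subst sum.swap) (simp add: mult_ac)
    then show ?thesis by (simp add: JL[OF x] sum_delta_mult)
  qed
  \<comment> \<open>Differentiating \<open>hess\<close> and inserting it again reproduces
    \<open>half_curv\<close>; swapping the two outer derivatives then leaves
    \<open>curv\<close>.\<close>
  have third: "partial l (partial i (partial j (y a))) x = (\<Sum>p\<in>UNIV. partial p (y a) x * half_curv l i p j x)" for l i j a
  proof -
    have "partial l (partial i (partial j (y a))) x = partial l (\<lambda>x. \<Sum>m\<in>UNIV. partial m (y a) x * \<Gamma> m i j x) x"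
      by (rule partial_cong[OF open_S x]) (rule hess)
    also have "\<dots> = (\<Sum>m\<in>UNIV. (\<Sum>p\<in>UNIV. partial p (y a) x * \<Gamma> p l m x) * \<Gamma> m i j x) + (\<Sum>m\<in>UNIV. partial m (y a) x * partial l (\<Gamma> m i j) x)"
      using dJ[OF x] differentiable[OF x] by (simp add: partial_sum partial_mult sum.distrib hess[OF x])
    also have "(\<Sum>m\<in>UNIV. (\<Sum>p\<in>UNIV. partial p (y a) x * \<Gamma> p l m x) * \<Gamma> m i j x)
       = (\<Sum>p\<in>UNIV. partial p (y a) x * (\<Sum>m\<in>UNIV. \<Gamma> p l m x * \<Gamma> m i j x))"
      unfolding sum_distrib_left sum_distrib_right by (subst sum.swap) (simp add: mult_ac)
    finally show ?thesis by (simp add: half_curv_def distrib_left sum.distrib)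
  qed
  have "(\<Sum>p\<in>UNIV. partial p (y a) x * curv i j p l x) = 0" for a
    using partial_commute[OF open_S x smooth_on_partial[OF y], of i j l a]
    unfolding third curv_def by (simp add: right_diff_distrib sum_subtractf)
  moreover have "(\<Sum>a\<in>UNIV. L m a x * (\<Sum>p\<in>UNIV. partial p (y a) x * curv i j p l x)) = curv i j m l x" for m
  proof -
    have "(\<Sum>a\<in>UNIV. L m a x * (\<Sum>p\<in>UNIV. partial p (y a) x * curv i j p l x))
      = (\<Sum>p\<in>UNIV. (\<Sum>a\<in>UNIV. L m a x * partial p (y a) x) * curv i j p l x)"
      unfolding sum_distrib_left sum_distrib_right by (subst sum.swap) (simp add: mult_ac)
    then show ?thesis by (simp add: LJ[OF x] sum_delta_mult)
  qed
  ultimately have "curv i j m l x = 0" for m by simp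
  then show ?thesis by (simp add: riemann_curv)
qed

end

section \<open>Vanishing of the Weyl tensor\<close>

text \<open>Run by contradiction with one fixed component. Where it is nonzero, dF must vanish, and
  the equation then makes the Ricci tensor zero, against its positivity.\<close>

lemma weyl_zero_if_quasi_einstein:
  fixes g :: "4 metric_field" and F :: "real^4 \<Rightarrow> real"
  assumes "local_metric g S"
    and eq: "\<And>x i j. x \<in> S \<Longrightarrow>
      ricci g i j x + hessian g F i j x - 1 / m * partial i F x * partial j F x = 0"
    and pos: "\<And>x v. x \<in> S \<Longrightarrow> v \<noteq> 0 \<Longrightarrow> (\<Sum>i\<in>UNIV. \<Sum>k\<in>UNIV. ricci g i k x * v $ i * v $ k) > 0"
    and radial: "\<And>x i j k. x \<in> S \<Longrightarrow> (\<Sum>l\<in>UNIV. weyl g i j k l x * gradient g F l x) = 0"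
    and x: "x \<in> S"
  shows "weyl g i j k l x = 0"
proof (rule ccontr)
  interpret local_metric g S by fact
  assume ne: "weyl g i j k l x \<noteq> 0"
  \<comment> \<open>A whole neighbourhood is required: dF = 0 at the single point \<open>x\<close>
    would say nothing about the Hessian there.\<close>
  define V where "V = {y \<in> S. weyl g i j k l y \<in> - {0}}"
  have "open V"
    using continuous_open_preimage[OF smooth_on_imp_continuous_on[OF smooth_weyl] open_S open_Compl[OF closed_singleton[of 0]],
        of i j k l]
    by (simp add: V_def vimage_def Int_def)
  have "x \<in> V" using ne x by (simp add: V_def)
  have crit: "partial a F y = 0" if "y \<in> V" for a y
  proof (rule ccontr)
    assume F: "partial a F y \<noteq> 0"
    have y: "y \<in> S" "weyl g i j k l y \<noteq> 0" using that by (auto simp: V_def)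
    have "(\<Sum>l\<in>UNIV. G a l y * gradient g F l y) = (\<Sum>b\<in>UNIV. (\<Sum>l\<in>UNIV. G a l y * H l b y) * partial b F y)"
      unfolding gradient_def sum_distrib_left sum_distrib_right by (subst sum.swap) (simp add: mult_ac)
    then have "(\<Sum>l\<in>UNIV. G a l y * gradient g F l y) \<noteq> 0"
      using F by (simp add: GH[OF y(1)] sum_delta_mult)
    then have nz: "(\<chi> l. gradient g F l y) \<noteq> 0"
      by (rule contrapos_nn) (simp add: vec_eq_iff)
    have "weyl g i j k l y = 0"
    proof (rule trace_free_curvature_zero_4[where W = "\<lambda>i j k l. weyl g i j k l y"])
      show "weyl g j i k l y = - weyl g i j k l y" for i j k l by (rule weyl_anti12)
      show "weyl g k l i j y = weyl g i j k l y" for i j k l by (rule weyl_pair[OF y(1)])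
      show "(\<Sum>j\<in>UNIV. \<Sum>l\<in>UNIV. H j l y * weyl g i j k l y) = 0" for i k
        by (rule weyl_trace[OF y(1)]) simp
      show "(\<Sum>l\<in>UNIV. weyl g i j k l y * (\<chi> l. gradient g F l y) $ l) = 0" for i j k
        using radial[OF y(1)] by simp
    qed (fact transpose_g[OF y(1)] | fact pos_g[OF y(1)] | fact HG[OF y(1)] | fact nz)+
    with y(2) show False by simp
  qed
  have D: "cov_deriv g (scalar_field F) [b] = partial b F" for b
    by (rule ext) (simp add: scalar_field_def)
  have "ricci g a b x = 0" for a b
  proof -
    have "partial a (partial b F) x = partial a (\<lambda>_. 0) x"
      by (rule partial_cong[OF \<open>open V\<close> \<open>x \<in> V\<close>]) (rule crit)
    then have "hessian g F a b x = 0"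
      unfolding hessian_def using crit[OF \<open>x \<in> V\<close>] by (simp add: D)
    then show ?thesis using eq[OF x, of a b] crit[OF \<open>x \<in> V\<close>] by simp
  qed
  then show False using pos[OF x, of "axis 1 1"] by (simp add: axis_eq_0_iff)
qed

section \<open>Charts\<close>

lemma chart_of_domain:
  assumes "chart_of M c"
  shows "fst c \<subseteq> topspace M" "topspace (subtopology M (fst c)) = fst c"
  using assms openin_subset unfolding chart_of_def by fastforce+

lemma chart_inv_left:
  assumes "chart_of M c" "q \<in> fst c"
  shows "chart_inv c (snd c q) = q"
proof -
  have "inj_on (snd c) (fst c)"
    using assms(1) homeomorphic_imp_injective_map chart_of_domain(2)[OF assms(1)]
    unfolding chart_of_def by metis
  then show ?thesis using assms(2) by (simp add: chart_inv_def)
qed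

lemma open_chart_image_Int:
  assumes c: "chart_of M c" and W: "openin M W"
  shows "open (snd c ` (fst c \<inter> W))"
proof -
  have "openin (subtopology M (fst c)) (fst c \<inter> W)"
    using W by (metis inf_commute openin_subtopology_Int)
  then have "openin (top_of_set (chart_image c)) (snd c ` (fst c \<inter> W))"
    using c homeomorphic_imp_open_map unfolding chart_of_def open_map_def by blast
  then show ?thesis using c openin_open_trans unfolding chart_of_def by blast
qed

lemma openin_chart_preimage:
  assumes c: "chart_of M c" and B: "open B"
  shows "openin M {q \<in> fst c. snd c q \<in> B}"
proof -
  have "continuous_map (subtopology M (fst c)) (top_of_set (chart_image c)) (snd c)"
    using c homeomorphic_imp_continuous_map unfolding chart_of_def by blast
  then have "continuous_map (subtopology M (fst c)) euclidean (snd c)"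
    by (simp add: continuous_map_in_subtopology)
  then have "openin (subtopology M (fst c)) {q \<in> topspace (subtopology M (fst c)). snd c q \<in> B}"
    using B openin_continuous_map_preimage open_openin by blast
  then show ?thesis
    using c openin_trans_full unfolding chart_of_domain(2)[OF c] by (auto simp: chart_of_def)
qed

lemma local_metric_chart:
  assumes "riemannian_manifold M A g" "c \<in> A"
  shows "local_metric (g c) (chart_image c)"
  using assms
  unfolding riemannian_manifold_def smooth_manifold_def smooth_atlas_def chart_of_def riemannian_metric_def
  by unfold_locales auto

lemma matrix_frechet_derivative_component:
  "matrix (frechet_derivative \<phi> (at x)) $ p $ i = partial i \<phi> x $ p"
  by (simp add: matrix_def partial_def)

text \<open>The flat coordinates come from one chart \<open>d\<close> around the point, but flatness
  is demanded in every chart. They are composed with the transition map, and the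
  constant-coefficient criterion is applied afresh in each chart, so that no transformation law of
  the curvature enters.\<close>

lemma locally_conformally_flat_if_weyl_zero:
  fixes A :: "('a, 'n::finite) chart set"
  assumes M: "riemannian_manifold M A g" and card: "CARD('n) > 3"
    and W: "\<And>c x i j k l. c \<in> A \<Longrightarrow> x \<in> chart_image c \<Longrightarrow> weyl (g c) i j k l x = 0"
  shows "locally_conformally_flat M A g"
  unfolding locally_conformally_flat_def
proof
  fix p assume p: "p \<in> topspace M"
  have atlas: "\<And>c. c \<in> A \<Longrightarrow> chart_of M c" "(\<Union>c\<in>A. fst c) = topspace M"
    "\<And>c d. c \<in> A \<Longrightarrow> d \<in> A \<Longrightarrow> smooth_on (snd c ` (fst c \<inter> fst d)) (transition c d)"
    using M unfolding riemannian_manifold_def smooth_manifold_def smooth_atlas_def by blast+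
  have change: "g c x = transpose J ** g d (transition c d x) ** J"
    if "c \<in> A" "d \<in> A" "x \<in> snd c ` (fst c \<inter> fst d)" "J = matrix (frechet_derivative (transition c d) (at x))" for c d x J
    using M that unfolding riemannian_manifold_def riemannian_metric_def Let_def by blast
  obtain d where d: "d \<in> A" "p \<in> fst d" using p atlas(2) by blast
  interpret D: local_metric "g d" "chart_image d" by (rule local_metric_chart[OF M d(1)])
  let ?x0 = "snd d p"
  have "?x0 \<in> chart_image d" using d(2) by (simp add: chart_image_def)
  from D.conformally_flat_coordinates[OF this card W[OF d(1)]]
  obtain r \<tau> and y :: "'n \<Rightarrow> real^'n \<Rightarrow> real" where r: "r > 0" "ball ?x0 r \<subseteq> chart_image d"
    and \<tau>: "smooth_on (ball ?x0 r) \<tau>" "\<And>x. x \<in> ball ?x0 r \<Longrightarrow> \<tau> x > 0"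
    and y: "\<And>a. smooth_on (ball ?x0 r) (y a)"
    and flat: "\<And>x i j. x \<in> ball ?x0 r \<Longrightarrow> g d x $ i $ j / (\<tau> x)\<^sup>2 =
       (\<Sum>a\<in>UNIV. \<Sum>b\<in>UNIV. g d ?x0 $ a $ b * (partial i (y a) x * partial j (y b) x))"
    by blast
  let ?B = "ball ?x0 r" and ?K = "g d ?x0"
  define U where "U = {q \<in> fst d. snd d q \<in> ?B}"
  \<comment> \<open>Chosen so that e^{2u} is \<open>\<tau>\<close> to the power -2, the factor in
    \<open>conformally_flat_coordinates\<close>.\<close>
  define u where "u q = - ln (\<tau> (snd d q))" for q
  have oU: "openin M U"
    unfolding U_def by (rule openin_chart_preimage[OF atlas(1)[OF d(1)] open_ball])
  have pU: "p \<in> U" using d(2) r(1) by (simp add: U_def)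
  have conf: "smooth_on V (u \<circ> chart_inv c) \<and>
      (\<forall>x\<in>V. \<forall>i j k l. riemann (\<lambda>z. exp (2 * u (chart_inv c z)) *\<^sub>R g c z) i j k l x = 0)"
    if c: "c \<in> A" and V: "V = snd c ` (fst c \<inter> U)" for c V
  proof -
    interpret C: local_metric "g c" "chart_image c" by (rule local_metric_chart[OF M c])
    let ?\<phi> = "transition c d"
    have oV: "open V" unfolding V by (rule open_chart_image_Int[OF atlas(1)[OF c] oU])
    have Vsub: "V \<subseteq> chart_image c" "V \<subseteq> snd c ` (fst c \<inter> fst d)"
      unfolding V U_def chart_image_def by auto
    have \<phi>B: "?\<phi> x \<in> ?B" if "x \<in> V" for x
      using that chart_inv_left[OF atlas(1)[OF c]] by (auto simp: V U_def transition_def)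
    have s\<phi>: "smooth_on V ?\<phi>" by (rule smooth_on_subset[OF atlas(3)[OF c d(1)] Vsub(2)])
    have s\<tau>: "smooth_on V (\<lambda>x. \<tau> (?\<phi> x))" by (rule smooth_on_compose[OF oV \<phi>B s\<phi> \<tau>(1)])
    have p\<tau>: "\<tau> (?\<phi> x) > 0" if "x \<in> V" for x using \<tau>(2)[OF \<phi>B[OF that]] .
    have u: "u (chart_inv c x) = - ln (\<tau> (?\<phi> x))" for x by (simp add: u_def transition_def)
    have "smooth_on V (\<lambda>x. - ln (\<tau> (?\<phi> x)))"
      by (intro smooth_on_minus smooth_on_ln oV s\<tau> p\<tau>)
    then have 1: "smooth_on V (u \<circ> chart_inv c)" by (simp add: o_def u)
    define h where "h = (\<lambda>z. exp (2 * u (chart_inv c z)) *\<^sub>R g c z)"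
    have e: "exp (2 * u (chart_inv c x)) = inverse (\<tau> (?\<phi> x)) * inverse (\<tau> (?\<phi> x))" if "x \<in> V" for x
      unfolding u mult_2 exp_add exp_minus using p\<tau>[OF that] by simp
    have "smooth_on V (\<lambda>x. (inverse (\<tau> (?\<phi> x)) * inverse (\<tau> (?\<phi> x))) *\<^sub>R g c x)"
      by (intro smooth_on_scaleR smooth_on_mult smooth_on_inverse oV s\<tau> smooth_on_subset[OF C.smooth_g Vsub(1)]
          less_imp_neq[OF p\<tau>, symmetric])
    then have sh: "smooth_on V h"
      using smooth_on_cong[OF oV, of h] by (simp add: h_def e)
    interpret Hm: local_metric h V
    proof
      show "transpose (h x) = h x" if "x \<in> V" for x
        using C.transpose_g[of x] Vsub(1) that by (auto simp: h_def transpose_def vec_eq_iff)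
      show "v \<bullet> (h x *v v) > 0" if "x \<in> V" "v \<noteq> 0" for x v
        using C.pos_g[of x v] Vsub(1) that by (auto simp: h_def scaleR_matrix_vector_assoc[symmetric])
    qed (fact oV sh)+
    have "h x $ i $ j = (\<Sum>a\<in>UNIV. \<Sum>b\<in>UNIV. ?K $ a $ b *
        (partial i (\<lambda>x. y a (?\<phi> x)) x * partial j (\<lambda>x. y b (?\<phi> x)) x))" if x: "x \<in> V" for x i j
    proof -
      let ?J = "\<lambda>p i. partial i ?\<phi> x $ p"
      have dy: "partial i (\<lambda>x. y a (?\<phi> x)) x = (\<Sum>p\<in>UNIV. ?J p i * partial p (y a) (?\<phi> x))" for i a
        using partial_compose[OF smooth_on_imp_differentiable[OF y \<phi>B[OF x]] smooth_on_imp_differentiable[OF s\<phi> x]]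
        by simp
      have "g c x $ i $ j = (\<Sum>q\<in>UNIV. (\<Sum>p\<in>UNIV. ?J p i * g d (?\<phi> x) $ p $ q) * ?J q j)"
        using change[OF c d(1) _ refl, of x] x Vsub(2)
        by (auto simp: matrix_matrix_mult_def transpose_def matrix_frechet_derivative_component)
      then have "h x $ i $ j = (\<Sum>q\<in>UNIV. \<Sum>p\<in>UNIV. (g d (?\<phi> x) $ p $ q / (\<tau> (?\<phi> x))\<^sup>2) * (?J p i * ?J q j))"
        using p\<tau>[OF x] by (simp add: h_def e[OF x] sum_distrib_left sum_distrib_right field_simps power2_eq_square)
      also have "\<dots> = (\<Sum>q\<in>UNIV. \<Sum>p\<in>UNIV. \<Sum>a\<in>UNIV. \<Sum>b\<in>UNIV.
          ?K $ a $ b * (?J p i * partial p (y a) (?\<phi> x) * (?J q j * partial q (y b) (?\<phi> x))))"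
        unfolding flat[OF \<phi>B[OF x]] by (simp add: sum_distrib_left sum_distrib_right mult_ac)
      also have "\<dots> = (\<Sum>q\<in>UNIV. \<Sum>b\<in>UNIV. \<Sum>a\<in>UNIV. \<Sum>p\<in>UNIV.
          ?K $ a $ b * (?J p i * partial p (y a) (?\<phi> x) * (?J q j * partial q (y b) (?\<phi> x))))"
        by (rule sum.cong[OF refl], rule sum3_reverse)
      also have "\<dots> = (\<Sum>a\<in>UNIV. \<Sum>b\<in>UNIV. \<Sum>q\<in>UNIV. \<Sum>p\<in>UNIV.
          ?K $ a $ b * (?J p i * partial p (y a) (?\<phi> x) * (?J q j * partial q (y b) (?\<phi> x))))"
        by (rule sum3_reverse)
      also have "\<dots> = (\<Sum>a\<in>UNIV. \<Sum>b\<in>UNIV. ?K $ a $ b *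
          ((\<Sum>p\<in>UNIV. ?J p i * partial p (y a) (?\<phi> x)) * (\<Sum>q\<in>UNIV. ?J q j * partial q (y b) (?\<phi> x))))"
        by (simp add: sum_distrib_left sum_distrib_right mult_ac)
      finally show ?thesis unfolding dy .
    qed
    from Hm.riemann_zero_if_constant_coefficients[OF smooth_on_compose[OF oV \<phi>B s\<phi> y] this]
    have "riemann h i j k l x = 0" if "x \<in> V" for x i j k l using that by blast
    with 1 show ?thesis unfolding h_def by blast
  qed
  show "\<exists>U u. openin M U \<and> p \<in> U \<and> smooth_fun_on A U u \<and>
      (\<forall>c\<in>A. \<forall>x\<in>snd c ` (fst c \<inter> U). \<forall>i j k l.
         riemann (\<lambda>y. exp (2 * u (chart_inv c y)) *\<^sub>R g c y) i j k l x = 0)"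
    unfolding smooth_fun_on_def
    by (rule exI[of _ U], rule exI[of _ u]) (use oU pU conf[OF _ refl] in auto)
qed

theorem corollary1:
  fixes M :: "'a topology" and A :: "('a, 4) chart set"
    and g :: "('a, 4) chart \<Rightarrow> 4 metric_field"
    and f :: "'a \<Rightarrow> real" and m :: real
  assumes "1 < m"
    and "complete_riemannian_manifold M A g"
    and "\<not> compact_space M"
    and "steady_quasi_einstein M A g f m"
    and "positive_ricci A g"
    and "\<exists>p\<in>topspace M. critical_point A f p"
    and "zero_radial_weyl A g f"
    and "div4_weyl_zero A g"
  shows "locally_conformally_flat M A g"
proof -
  have M: "riemannian_manifold M A g"
    using assms(2) by (simp add: complete_riemannian_manifold_def)
  have "weyl (g c) i j k l x = 0" if c: "c \<in> A" and x: "x \<in> chart_image c" for c x i j k l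
  proof (rule weyl_zero_if_quasi_einstein[OF local_metric_chart[OF M c] _ _ _ x])
    show "ricci (g c) i j x + hessian (g c) (f \<circ> chart_inv c) i j x
        - 1 / m * partial i (f \<circ> chart_inv c) x * partial j (f \<circ> chart_inv c) x = 0"
      if "x \<in> chart_image c" for x i j
      using assms(4) c that unfolding steady_quasi_einstein_def quasi_einstein_def Let_def by simp
    show "(\<Sum>i\<in>UNIV. \<Sum>k\<in>UNIV. ricci (g c) i k x * v $ i * v $ k) > 0"
      if "x \<in> chart_image c" "v \<noteq> 0" for x v
      using assms(5) c that unfolding positive_ricci_def by blast
    show "(\<Sum>l\<in>UNIV. weyl (g c) i j k l x * gradient (g c) (f \<circ> chart_inv c) l x) = 0"
      if "x \<in> chart_image c" for x i j k
      using assms(7) c that unfolding zero_radial_weyl_def by blast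
  qed
  then show ?thesis
    by (intro locally_conformally_flat_if_weyl_zero[OF M]) auto
qed

end
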